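(* Let $N\subset\mathbb{R}^n$ be a nonempty open subset and let $u\colon N\to\mathbb{R}$ be a smooth strictly convex function solving the Monge–Ampère equation $$\log\det\left(\frac{\partial^2u}{\partial x^i\partial x^j}\right)=-\sum_j v_jx^j+\sum_i\xi^i\frac{\partial u}{\partial x^i}+c,$$ where $v\in(\mathbb{R}^n)^*$, $\xi\in\mathbb{R}^n$ and $c\in\mathbb{R}$ are constant. If the Riemannian metric $g=D^2u=\sum_{i,j}\frac{\partial^2u}{\partial x^i\partial x^j}dx^i dx^j$ on $N$ is complete, then $N=\mathbb{R}^n$ and $u$ is a quadratic polynomial.
   Context: Strictly convex means that the Hessian matrix $\left(\frac{\partial^2u}{\partial x^i\partial x^j}\right)$ is positive definite at every point of $N$. *)

theory Defs
  imports "HOL-Analysis.Analysis"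
begin

text \<open>Functions on an open subset of \<open>\<real>\<^sup>n\<close> are represented by total functions on \<open>real ^ 'n\<close>;
  on an open set all derivatives below only depend on the values of the function on that set.
  At a point where \<open>f\<close> is differentiable the \<open>i\<close>-th partial derivative is
  the Frechet derivative applied to the \<open>i\<close>-th standard basis vector.\<close>

definition partial_deriv :: "'n::finite \<Rightarrow> (real ^ 'n \<Rightarrow> real) \<Rightarrow> real ^ 'n \<Rightarrow> real" where
  "partial_deriv i f x = frechet_derivative f (at x) (axis i 1)"

primrec C_k_on :: "nat \<Rightarrow> (real ^ 'n::finite) set \<Rightarrow> (real ^ 'n \<Rightarrow> real) \<Rightarrow> bool" where
  "C_k_on 0 S f \<longleftrightarrow> continuous_on S f"
| "C_k_on (Suc k) S f \<longleftrightarrow>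
     (\<forall>x\<in>S. f differentiable (at x)) \<and> (\<forall>i. C_k_on k S (partial_deriv i f))"

definition smooth_on :: "(real ^ 'n::finite) set \<Rightarrow> (real ^ 'n \<Rightarrow> real) \<Rightarrow> bool" where
  "smooth_on S f \<longleftrightarrow> (\<forall>k. C_k_on k S f)"

definition hessian :: "(real ^ 'n::finite \<Rightarrow> real) \<Rightarrow> real ^ 'n \<Rightarrow> real ^ 'n ^ 'n" where
  "hessian u x = (\<chi> i j. partial_deriv i (partial_deriv j u) x)"

text \<open>Symmetry of the matrix is not part of this definition; for the Hessian of a smooth function it
  is automatic.\<close>

definition positive_definite :: "real ^ 'n ^ 'n \<Rightarrow> bool" where
  "positive_definite A \<longleftrightarrow> (\<forall>w. w \<noteq> 0 \<longrightarrow> w \<bullet> (A *v w) > 0)"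

definition strictly_convex_on :: "(real ^ 'n::finite) set \<Rightarrow> (real ^ 'n \<Rightarrow> real) \<Rightarrow> bool" where
  "strictly_convex_on N u \<longleftrightarrow> (\<forall>x\<in>N. positive_definite (hessian u x))"

text \<open>A metric \<open>g\<close> on an open subset of \<open>\<real>\<^sup>n\<close> is given by its coefficient matrices. Lengths are
  taken in \<^typ>\<open>ennreal\<close> on purpose: the library's piecewise \<open>C\<^sup>1\<close> paths may have an
  unbounded derivative near the exceptional points, and such a path of infinite length must get
  length \<open>\<infinity>\<close> (a real-valued integral would be \<open>0\<close> there).\<close>

definition riemannian_length ::
    "(real ^ 'n \<Rightarrow> real ^ 'n ^ 'n) \<Rightarrow> (real \<Rightarrow> real ^ 'n::finite) \<Rightarrow> ennreal" where
  "riemannian_length g \<gamma> =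
     (\<integral>\<^sup>+t\<in>{0..1}. ennreal (sqrt (vector_derivative \<gamma> (at t) \<bullet>
        (g (\<gamma> t) *v vector_derivative \<gamma> (at t)))) \<partial>lborel)"

text \<open>The distance is \<open>\<infinity>\<close> between points in different connected components of \<open>N\<close>, as the
  infimum is then over the empty set.\<close>

definition riemannian_dist ::
    "(real ^ 'n::finite) set \<Rightarrow> (real ^ 'n \<Rightarrow> real ^ 'n ^ 'n) \<Rightarrow> real ^ 'n \<Rightarrow> real ^ 'n \<Rightarrow> ennreal"
  where
  "riemannian_dist N g x y =
     (INF \<gamma> \<in> {\<gamma>. valid_path \<gamma> \<and> path_image \<gamma> \<subseteq> N \<and> pathstart \<gamma> = x \<and> pathfinish \<gamma> = y}.
        riemannian_length g \<gamma>)"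

definition riemannian_complete ::
    "(real ^ 'n::finite) set \<Rightarrow> (real ^ 'n \<Rightarrow> real ^ 'n ^ 'n) \<Rightarrow> bool" where
  "riemannian_complete N g \<longleftrightarrow>
     (\<forall>X :: nat \<Rightarrow> real ^ 'n.
        (\<forall>k. X k \<in> N) \<and>
        (\<forall>e>0. \<exists>M. \<forall>m\<ge>M. \<forall>k\<ge>M. riemannian_dist N g (X m) (X k) < e) \<longrightarrow>
        (\<exists>x\<in>N. (\<lambda>k. riemannian_dist N g (X k) x) \<longlonglongrightarrow> 0))"

text \<open>Polynomials of degree exactly two: the symmetric matrix \<open>A\<close> of the quadratic part is
  nonzero.\<close>

definition quadratic_polynomial :: "(real ^ 'n::finite \<Rightarrow> real) \<Rightarrow> bool" where
  "quadratic_polynomial u \<longleftrightarrow>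
     (\<exists>(A :: real ^ 'n ^ 'n) (b :: real ^ 'n) (d :: real).
        transpose A = A \<and> A \<noteq> 0 \<and>
        (\<forall>x. u x = (\<Sum>i\<in>UNIV. \<Sum>j\<in>UNIV. A $ i $ j * x $ i * x $ j)
                 + (\<Sum>i\<in>UNIV. b $ i * x $ i) + d))"

end

theory Submission
  imports Defs
begin

text \<open>
  Write \<open>g = D\<^sup>2u\<close>, \<open>T = D\<^sup>3u\<close>, \<open>y = \<nabla>u\<close>. Differentiating the equation shows that the diffusion with
  generator \<open>L = g\<^sup>i\<^sup>j \<partial>\<^sub>i\<partial>\<^sub>j - \<xi> \<cdot> \<partial>\<close> satisfies \<open>L x = - \<xi>\<close> and \<open>L y = - v\<close>. Hence for two points moved by
  suitably coupled copies of it the quantity \<open>(x' - x) \<cdot> (y' - y)\<close> has non-positive drift. This is a discrete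
  form of the non-negativity of the Bakry--Emery Ricci tensor of \<open>g\<close>, and it makes geodesics, the cut locus and
  comparison theorems unnecessary: the distance is replaced by the action \<open>A\<close> of polygonal chains
  \<open>x\<^sub>0, \<dots>, x\<^sub>m\<close>, the sum of \<open>(x\<^sub>i\<^sub>+\<^sub>1 - x\<^sub>i) \<cdot> (y\<^sub>i\<^sub>+\<^sub>1 - y\<^sub>i) / h + h\<close>.

  Fix \<open>z\<close> and maximize \<open>T(e,e,e) / g(e,e)\<^sup>3\<^sup>/\<^sup>2 \<cdot> (a - A) \<cdot> \<eta>(x\<^sub>0)\<^sup>\<epsilon>\<close>, the tensors being taken at \<open>x\<^sub>m\<close>, over all
  chains starting near \<open>z\<close> (where \<open>\<eta>\<close> is a cut-off function) and all directions \<open>e\<close>. Completeness gives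
  compactness. Since inserting a midpoint halves \<open>(x' - x) \<cdot> (y' - y)\<close>, the steps of a maximal chain have length
  at most \<open>\<surd>2 h\<close>, so that the gradient of \<open>A\<close> in the end points is bounded. The second-order condition at the
  maximum, with the drift of \<open>A\<close> discarded by its sign, bounds the square of the maximal \<open>T(e,e,e) (a - A)\<close> by
  \<open>const \<cdot> (1 + a)\<close> for \<open>\<epsilon> = 1 / a\<close>. As \<open>a \<rightarrow> \<infinity>\<close> this forces \<open>T = 0\<close> at \<open>z\<close>.
  So \<open>g\<close> is constant along segments in \<open>N\<close>, and completeness leaves \<open>N = \<real>\<^sup>n\<close> only.
\<close>


subsection \<open>Directional derivatives of smooth functions\<close>

text \<open>The sign of the drift of \<open>A\<close> requires both ends of every segment to
  diffuse, so the start cannot be kept at \<open>z\<close>; \<open>\<eta>\<close> confines it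
  instead. The price is the generator of \<open>- ln \<eta>\<close>, bounded by a constant plus a
  multiple of the squared gradient of \<open>ln \<eta>\<close>. That gradient is controlled only by
  the first-order condition at the start: \<open>\<epsilon>\<close> times it equals, up to sign, the
  gradient of \<open>ln (a - A)\<close>, which is of size const / (a - A). After multiplication by
  \<open>(a - A)\<^sup>2\<close> the two contributions are of order
  \<open>\<epsilon> * a\<^sup>2\<close> and \<open>1 / \<epsilon>\<close>;
  \<open>\<epsilon> = 1 / a\<close> makes both linear in \<open>a\<close>, against a quadratic left
  side. In the same way the variation of \<open>A\<close> under the coupled motion of all points is
  not estimated directly: criticality under motions of one end point alone supplies the bound.
  Maximality in \<open>e\<close> makes \<open>e\<close> an eigenvector of \<open>T(e,.,.)\<close>
  relative to \<open>g\<close> and bounds this form by \<open>g\<close>. Expectations are finite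
  sums, with one second-order variation per frame vector.\<close>

definition dird :: "real ^ 'n \<Rightarrow> (real ^ 'n::finite \<Rightarrow> real) \<Rightarrow> real ^ 'n \<Rightarrow> real" where
  "dird w f x = frechet_derivative f (at x) w"

lemma frechet_derivative_cong_open:
  assumes "open S" "x \<in> S" "\<And>y. y \<in> S \<Longrightarrow> f y = g y"
  shows "frechet_derivative f (at x) = frechet_derivative g (at x)"
proof -
  have "(f has_derivative f') (at x) \<longleftrightarrow> (g has_derivative f') (at x)" for f'
    using has_derivative_transform_within_open[OF _ assms(1,2), of f _ UNIV g]
      has_derivative_transform_within_open[OF _ assms(1,2), of g _ UNIV f] assms(3) by fastforce
  then show ?thesis by (simp add: frechet_derivative_def)
qed

lemma partial_deriv_cong_open:
  assumes "open S" "x \<in> S" "\<And>y. y \<in> S \<Longrightarrow> f y = g y"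
  shows "partial_deriv i f x = partial_deriv i g x"
  using frechet_derivative_cong_open[OF assms] by (simp add: partial_deriv_def)

lemma dird_cong_open:
  assumes "open S" "x \<in> S" "\<And>y. y \<in> S \<Longrightarrow> f y = g y"
  shows "dird w f x = dird w g x"
  using frechet_derivative_cong_open[OF assms] by (simp add: dird_def)

lemma differentiable_cong_open:
  assumes "open S" "x \<in> S" "\<And>y. y \<in> S \<Longrightarrow> f y = g y"
  shows "f differentiable (at x) \<longleftrightarrow> g differentiable (at x)"
  using has_derivative_transform_within_open[OF _ assms(1,2), of f _ UNIV g]
    has_derivative_transform_within_open[OF _ assms(1,2), of g _ UNIV f] assms(3)
  unfolding differentiable_def by fastforce

text \<open>The calculus rules give formulas for partial derivatives only at points of
  \<open>S\<close>, while \<open>C_k_on\<close> speaks of total functions; openness lets equality on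
  \<open>S\<close> pass to derivatives.\<close>

lemma C_k_on_cong:
  assumes "open S" "\<And>y. y \<in> S \<Longrightarrow> f y = g y"
  shows "C_k_on k S f \<longleftrightarrow> C_k_on k S g"
  using assms(2)
proof (induction k arbitrary: f g)
  case 0
  then show ?case by (simp cong: continuous_on_cong)
next
  case (Suc k)
  have "C_k_on k S (partial_deriv i f) \<longleftrightarrow> C_k_on k S (partial_deriv i g)" for i
    by (rule Suc.IH, rule partial_deriv_cong_open[OF assms(1)]) (use Suc.prems in auto)
  moreover have "f differentiable (at x) \<longleftrightarrow> g differentiable (at x)" if "x \<in> S" for x
    by (rule differentiable_cong_open[OF assms(1)]) (use Suc.prems that in auto)
  ultimately show ?case by simp
qed

lemma partial_deriv_add:
  assumes "f differentiable (at x)" "g differentiable (at x)"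
  shows "partial_deriv i (\<lambda>x. f x + g x) x = partial_deriv i f x + partial_deriv i g x"
proof -
  have "((\<lambda>x. f x + g x) has_derivative
      (\<lambda>w. frechet_derivative f (at x) w + frechet_derivative g (at x) w)) (at x)"
    using assms by (intro has_derivative_add) (auto simp: frechet_derivative_works[symmetric])
  from frechet_derivative_at[OF this, symmetric] show ?thesis by (simp add: partial_deriv_def)
qed

lemma partial_deriv_cmult:
  fixes c :: real
  assumes "f differentiable (at x)"
  shows "partial_deriv i (\<lambda>x. c * f x) x = c * partial_deriv i f x"
proof -
  have "((\<lambda>x. c * f x) has_derivative (\<lambda>w. c * frechet_derivative f (at x) w)) (at x)"
    using assms by (intro has_derivative_mult_right) (auto simp: frechet_derivative_works[symmetric])
  from frechet_derivative_at[OF this, symmetric] show ?thesis by (simp add: partial_deriv_def)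
qed

lemma C_k_on_add:
  assumes "open S" "C_k_on k S f" "C_k_on k S g"
  shows "C_k_on k S (\<lambda>x. f x + g x)"
  using assms(2,3)
proof (induction k arbitrary: f g)
  case 0
  then show ?case by (simp add: continuous_on_add)
next
  case (Suc k)
  have "C_k_on k S (partial_deriv i (\<lambda>x. f x + g x))" for i
    by (subst C_k_on_cong[OF assms(1), where g = "\<lambda>x. partial_deriv i f x + partial_deriv i g x"])
      (use Suc in \<open>auto simp: partial_deriv_add\<close>)
  then show ?case using Suc.prems by (auto intro: differentiable_add)
qed

lemma C_k_on_cmult:
  fixes c :: real
  assumes "open S" "C_k_on k S f"
  shows "C_k_on k S (\<lambda>x. c * f x)"
  using assms(2)
proof (induction k arbitrary: f)
  case 0
  then show ?case by (simp add: continuous_on_mult_left)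
next
  case (Suc k)
  have "C_k_on k S (partial_deriv i (\<lambda>x. c * f x))" for i
    by (subst C_k_on_cong[OF assms(1), where g = "\<lambda>x. c * partial_deriv i f x"])
      (use Suc in \<open>auto simp: partial_deriv_cmult\<close>)
  then show ?case using Suc.prems by (auto intro: differentiable_mult)
qed

lemma smooth_on_cmult: "open S \<Longrightarrow> smooth_on S f \<Longrightarrow> smooth_on S (\<lambda>x. c * f x)"
  by (simp add: smooth_on_def C_k_on_cmult)

lemma C_k_on_const:
  fixes S :: "(real ^ 'n::finite) set"
  shows "C_k_on k S (\<lambda>x. c)"
proof (induction k arbitrary: c)
  case (Suc k)
  have "partial_deriv i (\<lambda>x. c) = (\<lambda>x. 0)" for i :: 'n
    by (auto simp: partial_deriv_def fun_eq_iff)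
  with Suc show ?case by simp
qed simp

lemma smooth_on_sum:
  assumes "open S" "\<And>i. i \<in> I \<Longrightarrow> smooth_on S (f i)"
  shows "smooth_on S (\<lambda>x. \<Sum>i\<in>I. f i x)"
  using assms(2)
  by (induction I rule: infinite_finite_induct)
    (auto simp: smooth_on_def C_k_on_const intro: C_k_on_add[OF assms(1)])

lemma smooth_on_differentiable: "smooth_on S f \<Longrightarrow> x \<in> S \<Longrightarrow> f differentiable (at x)"
  unfolding smooth_on_def by (drule spec[of _ "Suc 0"]) simp

lemma smooth_on_partial_deriv: "smooth_on S f \<Longrightarrow> smooth_on S (partial_deriv i f)"
  unfolding smooth_on_def by (intro allI, drule_tac x = "Suc k" in spec) simp

lemma smooth_on_cong:
  "open S \<Longrightarrow> (\<And>y. y \<in> S \<Longrightarrow> f y = g y) \<Longrightarrow> smooth_on S f \<longleftrightarrow> smooth_on S g"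
  using C_k_on_cong[of S f g] by (simp add: smooth_on_def)

lemma smooth_on_imp_continuous_on: "smooth_on S f \<Longrightarrow> continuous_on S f"
  unfolding smooth_on_def by (drule spec[of _ 0]) simp

lemma has_derivative_dird:
  assumes "smooth_on S f" "x \<in> S"
  shows "(f has_derivative (\<lambda>w. dird w f x)) (at x)"
  using smooth_on_differentiable[OF assms] by (simp add: dird_def frechet_derivative_works)

lemma linear_dird: "smooth_on S f \<Longrightarrow> x \<in> S \<Longrightarrow> linear (\<lambda>w. dird w f x)"
  using has_derivative_dird has_derivative_linear by blast

lemma dird_eq_sum:
  assumes "smooth_on S f" "x \<in> S"
  shows "dird w f x = (\<Sum>i\<in>UNIV. w $ i * partial_deriv i f x)"
proof -
  have "dird w f x = dird (\<Sum>i\<in>UNIV. w $ i *\<^sub>R axis i 1) f x"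
    by (metis basis_expansion scalar_mult_eq_scaleR)
  also have "\<dots> = (\<Sum>i\<in>UNIV. w $ i * dird (axis i 1) f x)"
    by (simp add: linear_sum[OF linear_dird[OF assms]] linear_cmul[OF linear_dird[OF assms]])
  finally show ?thesis by (simp add: dird_def partial_deriv_def)
qed

lemma smooth_on_dird:
  assumes "open S" "smooth_on S f"
  shows "smooth_on S (dird w f)"
proof -
  have "smooth_on S (\<lambda>x. \<Sum>i\<in>UNIV. w $ i * partial_deriv i f x)"
    using assms by (intro smooth_on_sum smooth_on_cmult smooth_on_partial_deriv) auto
  then show ?thesis
    using smooth_on_cong[OF assms(1), of "dird w f" "\<lambda>x. \<Sum>i\<in>UNIV. w $ i * partial_deriv i f x"]
      dird_eq_sum[OF assms(2)] by auto
qed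

lemma has_real_derivative_along:
  assumes "smooth_on S f" "x t \<in> S" "(x has_vector_derivative v) (at t)"
  shows "((\<lambda>t. f (x t)) has_real_derivative dird v f (x t)) (at t)"
proof -
  have "(f \<circ> x has_derivative (\<lambda>w. dird w f (x t)) \<circ> (\<lambda>h. h *\<^sub>R v)) (at t)"
    using assms(3) has_derivative_dird[OF assms(1,2)]
    by (intro diff_chain_at) (auto simp: has_vector_derivative_def)
  moreover have "(\<lambda>w. dird w f (x t)) \<circ> (\<lambda>h. h *\<^sub>R v) = (*) (dird v f (x t))"
    by (auto simp: linear_cmul[OF linear_dird[OF assms(1,2)]])
  ultimately show ?thesis by (simp add: has_field_derivative_def o_def)
qed

text \<open>The mean value theorem is applied first in direction \<open>a\<close>, then in direction
  \<open>b\<close>. The second difference itself is unchanged when \<open>a\<close> and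
  \<open>b\<close> are exchanged.\<close>

lemma second_difference_MVT:
  assumes "open S" "smooth_on S f" "0 < s"
    and inS: "\<And>p q. 0 \<le> p \<Longrightarrow> p \<le> s \<Longrightarrow> 0 \<le> q \<Longrightarrow> q \<le> s \<Longrightarrow> x + p *\<^sub>R a + q *\<^sub>R b \<in> S"
  obtains p q where "0 < p" "p < s" "0 < q" "q < s"
    "f (x + s *\<^sub>R a + s *\<^sub>R b) - f (x + s *\<^sub>R a) - f (x + s *\<^sub>R b) + f x
      = s * (s * dird b (dird a f) (x + p *\<^sub>R a + q *\<^sub>R b))"
proof -
  have "\<exists>p>0. p < s \<and> (\<lambda>p. f (x + p *\<^sub>R a + s *\<^sub>R b) - f (x + p *\<^sub>R a)) s
      - (\<lambda>p. f (x + p *\<^sub>R a + s *\<^sub>R b) - f (x + p *\<^sub>R a)) 0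
      = (s - 0) * (dird a f (x + p *\<^sub>R a + s *\<^sub>R b) - dird a f (x + p *\<^sub>R a))"
  proof (rule MVT2[OF \<open>0 < s\<close>])
    fix p assume p: "0 \<le> p" "p \<le> s"
    show "((\<lambda>p. f (x + p *\<^sub>R a + s *\<^sub>R b) - f (x + p *\<^sub>R a)) has_real_derivative
        dird a f (x + p *\<^sub>R a + s *\<^sub>R b) - dird a f (x + p *\<^sub>R a)) (at p)"
      using inS[of p s] inS[of p 0] p \<open>0 < s\<close>
      by (intro DERIV_diff has_real_derivative_along[OF assms(2)])
        (auto intro!: derivative_eq_intros simp: has_vector_derivative_def)
  qed
  then obtain p where p: "0 < p" "p < s"
    and Rp: "f (x + s *\<^sub>R a + s *\<^sub>R b) - f (x + s *\<^sub>R a) - f (x + s *\<^sub>R b) + f x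
      = s * (dird a f (x + p *\<^sub>R a + s *\<^sub>R b) - dird a f (x + p *\<^sub>R a))"
    by (auto simp: algebra_simps)
  have "\<exists>q>0. q < s \<and> dird a f (x + p *\<^sub>R a + s *\<^sub>R b) - dird a f (x + p *\<^sub>R a + 0 *\<^sub>R b)
      = (s - 0) * (dird b (dird a f) (x + p *\<^sub>R a + q *\<^sub>R b))"
  proof (rule MVT2[OF \<open>0 < s\<close>])
    fix q assume q: "0 \<le> q" "q \<le> s"
    show "((\<lambda>q. dird a f (x + p *\<^sub>R a + q *\<^sub>R b)) has_real_derivative
        dird b (dird a f) (x + p *\<^sub>R a + q *\<^sub>R b)) (at q)"
      using inS[of p q] p q
      by (intro has_real_derivative_along[OF smooth_on_dird[OF assms(1,2)]])
        (auto intro!: derivative_eq_intros simp: has_vector_derivative_def)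
  qed
  then show ?thesis using that[OF p] Rp by auto
qed

text \<open>Half the gap between the two values serves as tolerance: near \<open>x\<close> both
  iterated derivatives stay within it of their values at \<open>x\<close>, yet the symmetric second
  difference makes them agree at two nearby points.\<close>

lemma dird_commute:
  assumes "open S" "smooth_on S f" "x \<in> S"
  shows "dird a (dird b f) x = dird b (dird a f) x"
proof (rule ccontr)
  assume neq: "dird a (dird b f) x \<noteq> dird b (dird a f) x"
  define e where "e = \<bar>dird a (dird b f) x - dird b (dird a f) x\<bar> / 2"
  have "e > 0" using neq by (simp add: e_def)
  have sm: "smooth_on S (dird c f)" for c using assms by (rule_tac smooth_on_dird)
  have cont: "continuous_on S (dird c (dird d f))" for c d
    by (intro smooth_on_imp_continuous_on smooth_on_dird sm assms)
  obtain d0 where d0: "d0 > 0" "ball x d0 \<subseteq> S" using assms openE by blast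
  have near: "\<exists>d>0. \<forall>y\<in>S. dist y x < d \<longrightarrow> \<bar>dird c (dird d' f) y - dird c (dird d' f) x\<bar> < e" for c d'
    using cont[of c d'] assms(3) \<open>e > 0\<close> unfolding continuous_on_iff by (auto simp: dist_real_def)
  obtain d1 where d1: "d1 > 0" "\<And>y. y \<in> S \<Longrightarrow> dist y x < d1 \<Longrightarrow>
      \<bar>dird a (dird b f) y - dird a (dird b f) x\<bar> < e" using near by blast
  obtain d2 where d2: "d2 > 0" "\<And>y. y \<in> S \<Longrightarrow> dist y x < d2 \<Longrightarrow>
      \<bar>dird b (dird a f) y - dird b (dird a f) x\<bar> < e" using near by blast
  define d where "d = min d0 (min d1 d2)"
  \<comment> \<open>Keeps the parallelogram within \<open>d / 2\<close> of \<open>x\<close>; the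
    summand 1 avoids a division by zero when both directions vanish.\<close>
  define s where "s = d / (2 * (norm a + norm b + 1))"
  have "d > 0" using d0 d1 d2 by (simp add: d_def)
  have np: "norm a + norm b + 1 > 0" using norm_ge_zero[of a] norm_ge_zero[of b] by linarith
  have "s > 0" using \<open>d > 0\<close> np by (simp add: s_def)
  have in_ball: "dist (x + p *\<^sub>R a + q *\<^sub>R b) x < d" if "0 \<le> p" "p \<le> s" "0 \<le> q" "q \<le> s" for p q
  proof -
    have "dist (x + p *\<^sub>R a + q *\<^sub>R b) x \<le> p * norm a + q * norm b"
      using norm_triangle_ineq[of "p *\<^sub>R a" "q *\<^sub>R b"] that by (simp add: dist_norm add.assoc)
    also have "\<dots> \<le> s * norm a + s * norm b" using that by (intro add_mono mult_right_mono) auto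
    also have "\<dots> \<le> s * (norm a + norm b + 1)" using \<open>s > 0\<close> by (simp add: algebra_simps)
    also have "\<dots> = d / 2" using np unfolding s_def by (simp add: field_simps del: distrib_left_numeral)
    finally show ?thesis using \<open>d > 0\<close> by linarith
  qed
  have inS: "x + p *\<^sub>R a + q *\<^sub>R b \<in> S" if "0 \<le> p" "p \<le> s" "0 \<le> q" "q \<le> s" for p q
    using in_ball[OF that] d0 by (auto simp: d_def dist_commute)
  obtain p q where pq: "0 < p" "p < s" "0 < q" "q < s"
    "f (x + s *\<^sub>R a + s *\<^sub>R b) - f (x + s *\<^sub>R a) - f (x + s *\<^sub>R b) + f x
      = s * (s * dird b (dird a f) (x + p *\<^sub>R a + q *\<^sub>R b))"
    by (rule second_difference_MVT[OF assms(1,2) \<open>s > 0\<close> inS])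
  have "x + p *\<^sub>R b + q *\<^sub>R a \<in> S" if "0 \<le> p" "p \<le> s" "0 \<le> q" "q \<le> s" for p q
    using inS[OF that(3,4,1,2)] by (simp add: add_ac)
  then obtain p' q' where pq': "0 < p'" "p' < s" "0 < q'" "q' < s"
    "f (x + s *\<^sub>R b + s *\<^sub>R a) - f (x + s *\<^sub>R b) - f (x + s *\<^sub>R a) + f x
      = s * (s * dird a (dird b f) (x + p' *\<^sub>R b + q' *\<^sub>R a))"
    by (rule second_difference_MVT[OF assms(1,2) \<open>s > 0\<close>])
  have swap: "f (x + s *\<^sub>R b + s *\<^sub>R a) = f (x + s *\<^sub>R a + s *\<^sub>R b)"
    "dird a (dird b f) (x + p' *\<^sub>R b + q' *\<^sub>R a) = dird a (dird b f) (x + q' *\<^sub>R a + p' *\<^sub>R b)"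
    by (simp_all add: add_ac)
  have "s * (s * dird b (dird a f) (x + p *\<^sub>R a + q *\<^sub>R b))
      = s * (s * dird a (dird b f) (x + q' *\<^sub>R a + p' *\<^sub>R b))"
    using pq(5) pq'(5) unfolding swap by linarith
  then have eq: "dird b (dird a f) (x + p *\<^sub>R a + q *\<^sub>R b) = dird a (dird b f) (x + q' *\<^sub>R a + p' *\<^sub>R b)"
    using \<open>s > 0\<close> by simp
  have "\<bar>dird b (dird a f) (x + p *\<^sub>R a + q *\<^sub>R b) - dird b (dird a f) x\<bar> < e"
    using inS[of p q] in_ball[of p q] pq by (intro d2) (auto simp: d_def)
  moreover have "\<bar>dird a (dird b f) (x + q' *\<^sub>R a + p' *\<^sub>R b) - dird a (dird b f) x\<bar> < e"
    using inS[of q' p'] in_ball[of q' p'] pq' by (intro d1) (auto simp: d_def)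
  moreover have "\<bar>dird a (dird b f) x - dird b (dird a f) x\<bar> = 2 * e" by (simp add: e_def)
  ultimately show False using eq by linarith
qed

text \<open>Such a parabola models one step of a diffusion: \<open>v\<close> is a noise direction
  and the second-order coefficient \<open>w\<close> carries the drift.\<close>

lemma parabola_derivative:
  assumes "smooth_on S f" "p + t *\<^sub>R v + t\<^sup>2 *\<^sub>R w \<in> S"
  shows "((\<lambda>t. f (p + t *\<^sub>R v + t\<^sup>2 *\<^sub>R w)) has_real_derivative
    dird v f (p + t *\<^sub>R v + t\<^sup>2 *\<^sub>R w) + 2 * t * dird w f (p + t *\<^sub>R v + t\<^sup>2 *\<^sub>R w)) (at t)"
proof -
  have "((\<lambda>t. p + t *\<^sub>R v + t\<^sup>2 *\<^sub>R w) has_vector_derivative v + (2 * t) *\<^sub>R w) (at t)"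
    by (auto intro!: derivative_eq_intros simp: has_vector_derivative_def algebra_simps)
  from has_real_derivative_along[OF assms(1) _ this] assms(2)
  show ?thesis
    by (simp add: linear_add[OF linear_dird[OF assms]] linear_cmul[OF linear_dird[OF assms]])
qed

lemma parabola_second_derivative:
  assumes "open S" "smooth_on S f" "p \<in> S"
  shows "((\<lambda>t. dird v f (p + t *\<^sub>R v + t\<^sup>2 *\<^sub>R w) + 2 * t * dird w f (p + t *\<^sub>R v + t\<^sup>2 *\<^sub>R w))
    has_real_derivative dird v (dird v f) p + 2 * dird w f p) (at 0)"
proof -
  have "((\<lambda>t. dird v f (p + t *\<^sub>R v + t\<^sup>2 *\<^sub>R w)) has_real_derivative dird v (dird v f) p) (at 0)"
    using parabola_derivative[OF smooth_on_dird[OF assms(1,2), of v], of p 0 v w] assms(3) by simp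
  moreover have "((\<lambda>t. dird w f (p + t *\<^sub>R v + t\<^sup>2 *\<^sub>R w)) has_real_derivative dird v (dird w f) p) (at 0)"
    using parabola_derivative[OF smooth_on_dird[OF assms(1,2), of w], of p 0 v w] assms(3) by simp
  then have "((\<lambda>t. 2 * t * dird w f (p + t *\<^sub>R v + t\<^sup>2 *\<^sub>R w)) has_real_derivative
      2 * dird w f p) (at 0)"
    using DERIV_mult[OF DERIV_cmult_Id[of 2 0 UNIV]] assms(3) by fastforce
  ultimately show ?thesis by (rule DERIV_add)
qed


subsection \<open>Frames and derivatives of the log-determinant\<close>

definition spd :: "('a::euclidean_space \<Rightarrow> 'a \<Rightarrow> real) \<Rightarrow> bool" where
  "spd g \<longleftrightarrow> bilinear g \<and> (\<forall>a b. g a b = g b a) \<and> (\<forall>a. a \<noteq> 0 \<longrightarrow> g a a > 0)"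

text \<open>In the uses below \<open>'a\<close> is \<open>real ^ 'n\<close> with the same index
  type, so a frame is an orthonormal basis and not merely an orthonormal family.\<close>

definition frame :: "('a::euclidean_space \<Rightarrow> 'a \<Rightarrow> real) \<Rightarrow> ('n \<Rightarrow> 'a) \<Rightarrow> bool" where
  "frame g V \<longleftrightarrow> (\<forall>i j. g (V i) (V j) = (if i = j then 1 else 0))"

lemma bilinear_simps:
  assumes "bilinear g"
  shows "g (a + b) c = g a c + g b c" "g a (b + c) = g a b + g a c"
    "g (a - b) c = g a c - g b c" "g a (b - c) = g a b - g a c"
    "g (r *\<^sub>R a) c = r *\<^sub>R g a c" "g a (r *\<^sub>R c) = r *\<^sub>R g a c"
    "g (- a) c = - g a c" "g a (- c) = - g a c"
    "g 0 c = 0" "g a 0 = 0"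
  using assms
  by (simp_all add: bilinear_ladd bilinear_radd bilinear_lsub bilinear_rsub bilinear_lmul
      bilinear_rmul bilinear_lneg bilinear_rneg bilinear_lzero bilinear_rzero)

lemma bilinear_sums:
  assumes "bilinear g"
  shows "g (\<Sum>i\<in>I. f i) c = (\<Sum>i\<in>I. g (f i) c)" "g c (\<Sum>i\<in>I. f i) = (\<Sum>i\<in>I. g c (f i))"
  using assms linear_sum unfolding bilinear_def by fastforce+

lemma spd_bilinear: "spd g \<Longrightarrow> bilinear g"
  and spd_sym: "spd g \<Longrightarrow> g a b = g b a"
  and spd_pos: "spd g \<Longrightarrow> a \<noteq> 0 \<Longrightarrow> g a a > 0"
  by (auto simp: spd_def)

lemma spd_nonneg: "spd g \<Longrightarrow> g a a \<ge> 0"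
  by (metis order.refl less_imp_le spd_pos spd_bilinear bilinear_simps(9))

text \<open>The synthesis map \<open>L\<close> is injective because pairing with \<open>V j\<close>
  recovers the coefficients, hence surjective by equality of dimensions.\<close>

lemma frame_expand:
  fixes V :: "'n::finite \<Rightarrow> real ^ 'n"
  assumes "bilinear g" "frame g V"
  shows "w = (\<Sum>i\<in>UNIV. g w (V i) *\<^sub>R V i)"
proof -
  define L where "L c = (\<Sum>i\<in>UNIV. (c $ i) *\<^sub>R V i)" for c :: "real ^ 'n"
  have lin: "linear L"
    by (rule linearI) (simp_all add: L_def scaleR_left_distrib sum.distrib scaleR_sum_right)
  have coeff: "g (L c) (V j) = c $ j" for c j
  proof -
    have "g (L c) (V j) = (\<Sum>i\<in>UNIV. c $ i * (if i = j then 1 else 0))"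
      using assms(2) by (simp add: L_def bilinear_sums[OF assms(1)] bilinear_simps[OF assms(1)] frame_def)
    then show ?thesis by (simp add: if_distrib cong: if_cong)
  qed
  have "inj L"
    unfolding linear_injective_0[OF lin]
    using coeff by (metis vec_eq_iff zero_index bilinear_simps(9)[OF assms(1)])
  then have "surj L" using linear_injective_imp_surjective lin by blast
  then obtain c where "w = L c" by blast
  then show ?thesis using coeff[of c] by (simp add: L_def)
qed

lemma frame_parseval:
  fixes V :: "'n::finite \<Rightarrow> real ^ 'n"
  assumes "bilinear g" "frame g V"
  shows "g a b = (\<Sum>i\<in>UNIV. g a (V i) * g (V i) b)"
proof -
  have "g a b = g (\<Sum>i\<in>UNIV. g a (V i) *\<^sub>R V i) b" using frame_expand[OF assms, of a] by simp
  then show ?thesis by (simp add: bilinear_sums[OF assms(1)] bilinear_simps[OF assms(1)])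
qed

text \<open>A nonnegative quadratic function has zero slope at a zero. Nonnegativity is asked on one
  line because the form in the diagonalization is semidefinite on a subspace only.\<close>

lemma semidefinite_null:
  assumes "bilinear q" "\<And>a b. q a b = q b a" "\<And>t. q (a + t *\<^sub>R b) (a + t *\<^sub>R b) \<ge> (0::real)" "q a a = 0"
  shows "q a b = 0"
proof (rule ccontr)
  assume ne: "q a b \<noteq> 0"
  define B where "B = q a b"
  define C where "C = \<bar>q b b\<bar> + 1"
  have "C > 0" by (simp add: C_def)
  have "q (a + t *\<^sub>R b) (a + t *\<^sub>R b) = 2 * t * B + t\<^sup>2 * q b b" for t
    using assms(2)[of b a] assms(4)
    by (simp add: bilinear_simps[OF assms(1)] B_def power2_eq_square algebra_simps)
  then have nonneg: "2 * t * B + t\<^sup>2 * q b b \<ge> 0" for t using assms(3)[of t] by metis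
  \<comment> \<open>\<open>C\<close> is positive and exceeds \<open>q b b\<close>, so the linear
    term wins whatever the sign of \<open>q b b\<close>.\<close>
  define t where "t = - B / C"
  have "2 * t * B + t\<^sup>2 * q b b < 2 * t * B + t\<^sup>2 * C"
    using ne \<open>C > 0\<close> by (intro add_strict_left_mono mult_strict_left_mono) (auto simp: C_def t_def B_def)
  also have "\<dots> = - B\<^sup>2 / C"
    using \<open>C > 0\<close> by (simp add: t_def power2_eq_square field_simps)
  finally show False using nonneg[of t] \<open>C > 0\<close> by (smt (verit) divide_nonneg_pos zero_le_power2 minus_divide_left)
qed

text \<open>Induction on the index set; the next vector maximizes the Rayleigh quotient
  \<open>g' w w / g w w\<close> on the \<open>g\<close>-complement \<open>W\<close> of the earlier
  ones. The third clause, that \<open>W\<close> is also \<open>g'\<close>-orthogonal to them, gives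
  the second clause for the new vector.\<close>

lemma simultaneous_diagonalization_on:
  fixes g g' :: "real ^ 'n::finite \<Rightarrow> real ^ 'n \<Rightarrow> real" and A :: "'n set"
  assumes "spd g" "bilinear g'" "\<And>a b. g' a b = g' b a"
  shows "\<exists>b. (\<forall>i\<in>A. \<forall>j\<in>A. g (b i) (b j) = (if i = j then 1 else 0)) \<and>
    (\<forall>i\<in>A. \<forall>j\<in>A. i \<noteq> j \<longrightarrow> g' (b i) (b j) = 0) \<and>
    (\<forall>w. (\<forall>i\<in>A. g w (b i) = 0) \<longrightarrow> (\<forall>i\<in>A. g' w (b i) = 0))"
proof (induction A rule: infinite_finite_induct)
  case (insert k A)
  note bg = spd_bilinear[OF assms(1)] and sg = spd_sym[OF assms(1)]
  obtain b where b: "\<forall>i\<in>A. \<forall>j\<in>A. g (b i) (b j) = (if i = j then 1 else 0)"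
    "\<forall>i\<in>A. \<forall>j\<in>A. i \<noteq> j \<longrightarrow> g' (b i) (b j) = 0"
    "\<forall>w. (\<forall>i\<in>A. g w (b i) = 0) \<longrightarrow> (\<forall>i\<in>A. g' w (b i) = 0)"
    using insert.IH by (elim exE conjE)
  have b1: "g (b i) (b j) = (if i = j then 1 else 0)" if "i \<in> A" "j \<in> A" for i j
    using b(1) that by simp
  have b2: "g' (b i) (b j) = 0" if "i \<in> A" "j \<in> A" "i \<noteq> j" for i j
    using b(2) that by simp
  have b3: "g' w (b i) = 0" if "\<forall>i\<in>A. g w (b i) = 0" "i \<in> A" for w i
    using b(3) that by simp
  define W where "W = {w. \<forall>i\<in>A. g w (b i) = 0}"
  have W_lin: "x + t *\<^sub>R y \<in> W" if "x \<in> W" "y \<in> W" for x y t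
    using that by (simp add: W_def bilinear_simps[OF bg])
  have W_scale: "t *\<^sub>R y \<in> W" if "y \<in> W" for y t
    using that by (simp add: W_def bilinear_simps[OF bg])
  define f where "f w = (\<chi> i. if i \<in> A then g w (b i) else 0)" for w
  have linf: "linear f"
    by (rule linearI) (auto simp: f_def vec_eq_iff bilinear_simps[OF bg])
  \<comment> \<open>Coordinate \<open>k\<close> of \<open>f\<close> is always 0, as \<open>k\<close>
    is not in \<open>A\<close>; so \<open>f\<close> has a kernel, and \<open>W\<close> contains a
    nonzero vector.\<close>
  have "\<not> surj f"
  proof
    assume "surj f"
    then obtain w where "f w = axis k 1" unfolding surj_def by metis
    then have "f w $ k = 1" by simp
    then show False using insert.hyps by (simp add: f_def)
  qed
  then have "\<not> inj f" using linear_injective_imp_surjective linf by blast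
  then obtain w1 where w1: "f w1 = 0" "w1 \<noteq> 0" using linear_injective_0[OF linf] by blast
  have "w1 \<in> W"
  proof -
    have "g w1 (b i) = 0" if "i \<in> A" for i
      using arg_cong[OF w1(1), of "\<lambda>x. x $ i"] that by (simp add: f_def)
    then show ?thesis by (simp add: W_def)
  qed
  define S where "S = W \<inter> sphere 0 1"
  have contg: "continuous_on T (\<lambda>w. g w c)" "continuous_on T (\<lambda>w. g w w)" "continuous_on T (\<lambda>w. g' w w)" for c T
    using bilinear_continuous_on_compose[OF continuous_on_id continuous_on_const bg]
      bilinear_continuous_on_compose[OF continuous_on_id continuous_on_id bg]
      bilinear_continuous_on_compose[OF continuous_on_id continuous_on_id assms(2)] by auto
  have "closed W"
  proof -
    have "W = (\<Inter>i\<in>A. {w. g w (b i) = 0})" by (auto simp: W_def)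
    moreover have "closed {w. g w (b i) = 0}" for i
      by (intro closed_Collect_eq contg continuous_on_const)
    ultimately show ?thesis by auto
  qed
  then have "compact S" unfolding S_def by (intro closed_Int_compact compact_sphere)
  have "(1 / norm w1) *\<^sub>R w1 \<in> S" using W_scale[OF \<open>w1 \<in> W\<close>] w1(2) by (simp add: S_def)
  then have "S \<noteq> {}" by blast
  have nz: "g w w > 0" if "w \<in> S" for w using that by (intro spd_pos[OF assms(1)]) (auto simp: S_def)
  have "continuous_on S (\<lambda>w. g' w w / g w w)"
    using nz by (intro continuous_on_divide contg) force
  from continuous_attains_sup[OF \<open>compact S\<close> \<open>S \<noteq> {}\<close> this]
  obtain w0 where w0: "w0 \<in> S" "\<And>w. w \<in> S \<Longrightarrow> g' w w / g w w \<le> g' w0 w0 / g w0 w0"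
    by blast
  define \<mu> where "\<mu> = g' w0 w0 / g w0 w0"
  \<comment> \<open>Maximality says that \<open>q\<close> is semidefinite on \<open>W\<close> and
    vanishes at \<open>w0\<close>, so \<open>w0\<close> is an eigenvector relative to
    \<open>W\<close>.\<close>
  define q where "q x y = \<mu> * g x y - g' x y" for x y
  have bq: "bilinear q"
    unfolding bilinear_def q_def
    by (auto intro!: linearI simp: bilinear_simps[OF bg] bilinear_simps[OF assms(2)] algebra_simps)
  have qW: "q w w \<ge> 0" if "w \<in> W" for w
  proof (cases "w = 0")
    case False
    define w' where "w' = (1 / norm w) *\<^sub>R w"
    have "w' \<in> S" using that False W_scale by (auto simp: S_def w'_def)
    then have "g' w' w' / g w' w' \<le> \<mu>" using w0(2) by (simp add: \<mu>_def)
    moreover have "g' w' w' / g w' w' = g' w w / g w w"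
      using False by (simp add: w'_def bilinear_simps[OF bg] bilinear_simps[OF assms(2)])
    ultimately show ?thesis using spd_pos[OF assms(1) False] by (simp add: q_def divide_le_eq)
  qed (simp add: bilinear_simps[OF bq])
  have w0W: "w0 \<in> W" and w0pos: "g w0 w0 > 0" using w0(1) nz by (auto simp: S_def)
  have eig: "g' w0 w = \<mu> * g w0 w" if "w \<in> W" for w
  proof -
    have "q w0 w = 0"
    proof (rule semidefinite_null[OF bq])
      show "q a b = q b a" for a b using sg[of a b] assms(3)[of a b] by (simp add: q_def)
      show "q (w0 + t *\<^sub>R w) (w0 + t *\<^sub>R w) \<ge> 0" for t by (rule qW[OF W_lin[OF w0W that]])
      show "q w0 w0 = 0" using w0pos by (simp add: q_def \<mu>_def)
    qed
    then show ?thesis by (simp add: q_def)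
  qed
  define s where "s = 1 / sqrt (g w0 w0)"
  define c where "c = b(k := s *\<^sub>R w0)"
  have ck: "c k = s *\<^sub>R w0" and cA: "i \<in> A \<Longrightarrow> c i = b i" for i
    using insert.hyps by (auto simp: c_def)
  have w0b: "g w0 (b i) = 0" "g' w0 (b i) = 0" if "i \<in> A" for i
    using w0W b3[of w0 i] that by (auto simp: W_def)
  have "g (c k) (c k) = 1"
    using w0pos by (simp add: ck s_def bilinear_simps[OF bg] power2_eq_square[symmetric])
  then have "\<forall>i\<in>insert k A. \<forall>j\<in>insert k A. g (c i) (c j) = (if i = j then 1 else 0)"
    using b1 w0b insert.hyps by (auto simp: ck cA bilinear_simps[OF bg] sg[of "b _" w0])
  moreover have "\<forall>i\<in>insert k A. \<forall>j\<in>insert k A. i \<noteq> j \<longrightarrow> g' (c i) (c j) = 0"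
    using b2 w0b insert.hyps by (auto simp: ck cA bilinear_simps[OF assms(2)] assms(3)[of "b _" w0])
  moreover have "\<forall>i\<in>insert k A. g' w (c i) = 0" if w: "\<forall>i\<in>insert k A. g w (c i) = 0" for w
  proof -
    have "w \<in> W" using w by (simp add: W_def cA)
    moreover have "g w w0 = 0" using w w0pos by (simp add: ck bilinear_simps[OF bg] s_def)
    ultimately have "g' w w0 = 0" using eig[of w] assms(3)[of w w0] sg[of w w0] by simp
    then show ?thesis using b3[of w] \<open>w \<in> W\<close> by (auto simp: ck cA W_def bilinear_simps[OF assms(2)])
  qed
  ultimately show ?case by blast
qed auto

lemma simultaneous_diagonalization:
  fixes g g' :: "real ^ 'n::finite \<Rightarrow> real ^ 'n \<Rightarrow> real"
  assumes "spd g" "bilinear g'" "\<And>a b. g' a b = g' b a"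
  obtains b :: "'n \<Rightarrow> real ^ 'n" where "frame g b" "\<And>i j. i \<noteq> j \<Longrightarrow> g' (b i) (b j) = 0"
proof -
  obtain b where "\<forall>i\<in>UNIV. \<forall>j\<in>UNIV. g (b i) (b j) = (if i = j then 1 else 0)"
    "\<forall>i\<in>(UNIV::'n set). \<forall>j\<in>UNIV. i \<noteq> j \<longrightarrow> g' (b i) (b j) = 0"
    using simultaneous_diagonalization_on[OF assms, of UNIV] by (elim exE conjE)
  then show ?thesis by (intro that[of b]) (simp_all add: frame_def)
qed

lemma frame_exists:
  fixes g :: "real ^ 'n::finite \<Rightarrow> real ^ 'n \<Rightarrow> real"
  assumes "spd g"
  obtains V :: "'n \<Rightarrow> real ^ 'n" where "frame g V"
proof -
  obtain b :: "'n \<Rightarrow> real ^ 'n" where "frame g b"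
    by (rule simultaneous_diagonalization[OF assms spd_bilinear[OF assms] spd_sym[OF assms]])
  then show ?thesis by (rule that)
qed

text \<open>If \<open>g'\<close> is diagonal with entries \<open>\<mu>\<^sub>k\<close> in a \<open>g\<close>-orthonormal basis \<open>b\<close>, then
  \<open>b\<^sub>k \<mapsto> \<mu>\<^sub>k\<^sup>-\<^sup>1\<^sup>/\<^sup>2 b\<^sub>k\<close> maps \<open>g\<close>-frames to \<open>g'\<close>-frames, and the trace below becomes
  \<open>\<Sum>\<^sub>k \<mu>\<^sub>k\<^sup>-\<^sup>1\<^sup>/\<^sup>2 + \<mu>\<^sub>k\<^sup>1\<^sup>/\<^sup>2\<close>.\<close>

lemma coupled_frame:
  fixes g g' :: "real ^ 'n::finite \<Rightarrow> real ^ 'n \<Rightarrow> real" and V :: "'n \<Rightarrow> real ^ 'n"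
  assumes "spd g" "spd g'" "frame g V"
  obtains V' :: "'n \<Rightarrow> real ^ 'n" where "frame g' V'"
    "(\<Sum>i\<in>UNIV. g (V' i) (V i) + g' (V' i) (V i)) \<ge> 2 * real CARD('n)"
proof -
  note bg = spd_bilinear[OF assms(1)] and sg = spd_sym[OF assms(1)]
  note bg' = spd_bilinear[OF assms(2)] and sg' = spd_sym[OF assms(2)]
  obtain b :: "'n \<Rightarrow> real ^ 'n" where b: "frame g b" "\<And>i j. i \<noteq> j \<Longrightarrow> g' (b i) (b j) = 0"
    by (rule simultaneous_diagonalization[OF assms(1) bg' sg']) blast
  define \<mu> where "\<mu> k = g' (b k) (b k)" for k
  have b0: "b k \<noteq> 0" for k using b(1) by (metis frame_def bilinear_simps(9)[OF bg] zero_neq_one)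
  have \<mu>: "\<mu> k > 0" for k using spd_pos[OF assms(2) b0] by (simp add: \<mu>_def)
  have g'b: "g' (b j) (b k) = (if j = k then \<mu> k else 0)" for j k using b(2) by (auto simp: \<mu>_def)
  define V' where "V' i = (\<Sum>k\<in>UNIV. (g (V i) (b k) / sqrt (\<mu> k)) *\<^sub>R b k)" for i
  have V: "V i = (\<Sum>k\<in>UNIV. g (V i) (b k) *\<^sub>R b k)" for i by (rule frame_expand[OF bg b(1)])
  have gV': "g (V' i) (V i) = (\<Sum>k\<in>UNIV. (g (V i) (b k))\<^sup>2 / sqrt (\<mu> k))" for i
    by (simp add: V'_def bilinear_sums[OF bg] bilinear_simps[OF bg] power2_eq_square sg[of "b _"])
  have g'bV: "g' (b k) (V i) = g (V i) (b k) * \<mu> k" for i k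
  proof -
    have "g' (b k) (V i) = (\<Sum>j\<in>UNIV. g (V i) (b j) * g' (b k) (b j))"
      by (subst V) (simp add: bilinear_sums[OF bg'] bilinear_simps[OF bg'])
    also have "\<dots> = (\<Sum>j\<in>UNIV. if k = j then g (V i) (b j) * \<mu> j else 0)"
      by (rule sum.cong) (auto simp: g'b)
    finally show ?thesis by simp
  qed
  have g'bV': "g' (b k) (V' i) = g (V i) (b k) * sqrt (\<mu> k)" for i k
  proof -
    have "g' (b k) (V' i) = (\<Sum>j\<in>UNIV. g (V i) (b j) / sqrt (\<mu> j) * g' (b k) (b j))"
      by (simp add: V'_def bilinear_sums[OF bg'] bilinear_simps[OF bg'])
    also have "\<dots> = (\<Sum>j\<in>UNIV. if k = j then g (V i) (b j) / sqrt (\<mu> j) * \<mu> j else 0)"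
      by (rule sum.cong) (auto simp: g'b)
    also have "\<dots> = g (V i) (b k) * sqrt (\<mu> k)"
      using real_div_sqrt[of "\<mu> k"] \<mu>[of k] by (simp flip: times_divide_eq_right)
    finally show ?thesis .
  qed
  have g'V': "g' (V' i) (V i) = (\<Sum>k\<in>UNIV. (g (V i) (b k))\<^sup>2 * sqrt (\<mu> k))" for i
  proof -
    have "g' (V' i) (V i) = (\<Sum>k\<in>UNIV. g (V i) (b k) / sqrt (\<mu> k) * (g (V i) (b k) * \<mu> k))"
      by (simp add: V'_def[of i] bilinear_sums[OF bg'] bilinear_simps[OF bg'] g'bV)
    also have "\<dots> = (\<Sum>k\<in>UNIV. (g (V i) (b k))\<^sup>2 * sqrt (\<mu> k))"
    proof (rule sum.cong)
      fix k
      have "g (V i) (b k) / sqrt (\<mu> k) * (g (V i) (b k) * \<mu> k) = (g (V i) (b k))\<^sup>2 * (\<mu> k / sqrt (\<mu> k))"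
        by (simp add: power2_eq_square)
      then show "g (V i) (b k) / sqrt (\<mu> k) * (g (V i) (b k) * \<mu> k) = (g (V i) (b k))\<^sup>2 * sqrt (\<mu> k)"
        using real_div_sqrt[of "\<mu> k"] \<mu>[of k] by simp
    qed simp
    finally show ?thesis .
  qed
  have "g' (V' i) (V' j) = (if i = j then 1 else 0)" for i j
  proof -
    have "g' (V' i) (V' j) = (\<Sum>k\<in>UNIV. g (V i) (b k) / sqrt (\<mu> k) * (g (V j) (b k) * sqrt (\<mu> k)))"
      by (simp add: V'_def[of i] bilinear_sums[OF bg'] bilinear_simps[OF bg'] g'bV')
    also have "\<dots> = (\<Sum>k\<in>UNIV. g (V i) (b k) * g (b k) (V j))"
      by (rule sum.cong) (use \<mu> in \<open>auto simp: sg[of "V j"] less_imp_neq[symmetric]\<close>)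
    also have "\<dots> = g (V i) (V j)" by (rule frame_parseval[OF bg b(1), symmetric])
    finally show ?thesis using assms(3) by (simp add: frame_def)
  qed
  then have fr: "frame g' V'" by (simp add: frame_def)
  \<comment> \<open>The matrix of the numbers \<open>g (V i) (b k)\<close> is orthogonal, so the
    trace does not depend on the frame \<open>V\<close>.\<close>
  have tr: "(\<Sum>i\<in>UNIV. (g (V i) (b k))\<^sup>2) = 1" for k
    using frame_parseval[OF bg assms(3), of "b k" "b k"] b(1)
    by (simp add: frame_def power2_eq_square sg[of "V _"])
  have "(\<Sum>i\<in>UNIV. g (V' i) (V i) + g' (V' i) (V i))
      = (\<Sum>i\<in>UNIV. \<Sum>k\<in>UNIV. (g (V i) (b k))\<^sup>2 * (1 / sqrt (\<mu> k) + sqrt (\<mu> k)))"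
    by (simp add: gV' g'V' sum.distrib algebra_simps)
  also have "\<dots> = (\<Sum>k\<in>UNIV. \<Sum>i\<in>UNIV. (g (V i) (b k))\<^sup>2 * (1 / sqrt (\<mu> k) + sqrt (\<mu> k)))"
    by (rule sum.swap)
  also have "\<dots> = (\<Sum>k\<in>UNIV. 1 / sqrt (\<mu> k) + sqrt (\<mu> k))"
    by (simp add: sum_distrib_right[symmetric] tr)
  also have "\<dots> \<ge> (\<Sum>k\<in>(UNIV::'n set). 2)"
  proof (rule sum_mono)
    fix k
    have s: "sqrt (\<mu> k) > 0" using \<mu> by simp
    have "0 \<le> (sqrt (\<mu> k) - 1)\<^sup>2 / sqrt (\<mu> k)" using s by simp
    also have "\<dots> = 1 / sqrt (\<mu> k) + sqrt (\<mu> k) - 2"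
      using s by (simp add: power2_eq_square field_simps)
    finally show "2 \<le> 1 / sqrt (\<mu> k) + sqrt (\<mu> k)" by simp
  qed
  finally show ?thesis using that[OF fr] by simp
qed

section \<open>Derivatives of determinants and inverse matrices\<close>

lemma matrix_inv_inverse:
  assumes "invertible (A :: real ^ 'n ^ 'n::finite)"
  shows "A ** matrix_inv A = mat 1" "matrix_inv A ** A = mat 1"
  using someI_ex[OF assms[unfolded invertible_def]] by (auto simp: matrix_inv_def)

text \<open>A permutation fixing all indices but one fixes that one too. So in the differentiated
  Leibniz formula at the identity matrix, every term of a nontrivial permutation keeps an
  off-diagonal factor 0.\<close>

lemma det_permutation_vanish:
  fixes p :: "'n::finite \<Rightarrow> 'n"
  assumes "p permutes UNIV" "p \<noteq> id"
  shows "\<exists>j. j \<noteq> i \<and> p j \<noteq> j"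
proof (rule ccontr)
  assume "\<not> ?thesis"
  then have fx: "p j = j" if "j \<noteq> i" for j using that by blast
  have "p i = i"
    using fx[of "p i"] assms(1) by (metis permutes_inj injD)
  with fx have "p = id" by (metis eq_id_iff)
  with assms(2) show False by simp
qed

lemma has_real_derivative_det:
  fixes G :: "real \<Rightarrow> real ^ 'n ^ 'n::finite"
  assumes "\<And>i j. ((\<lambda>t. G t $ i $ j) has_real_derivative G' i j) (at s)"
  shows "((\<lambda>t. det (G t)) has_real_derivative
    (\<Sum>p | p permutes UNIV. of_int (sign p) *
      (\<Sum>i\<in>UNIV. G' i (p i) * (\<Prod>j\<in>UNIV - {i}. G s $ j $ p j)))) (at s)"
  unfolding det_def
  by (intro DERIV_sum DERIV_cmult has_field_derivative_prod assms)

lemma has_real_derivative_det_identity: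
  fixes G :: "real \<Rightarrow> real ^ 'n ^ 'n::finite"
  assumes "\<And>i j. ((\<lambda>t. G t $ i $ j) has_real_derivative G' i j) (at s)" "G s = mat 1"
  shows "((\<lambda>t. det (G t)) has_real_derivative (\<Sum>i\<in>UNIV. G' i i)) (at s)"
proof -
  have z: "(\<Prod>j\<in>UNIV - {i}. G s $ j $ p j) = 0" if p: "p permutes UNIV" "p \<noteq> id" for p and i :: 'n
  proof -
    obtain j where "j \<noteq> i" "p j \<noteq> j" using det_permutation_vanish[OF p] by metis
    then show ?thesis by (intro prod_zero) (auto simp: assms(2) mat_def intro!: bexI[of _ j])
  qed
  have "(\<Sum>p | p permutes UNIV. of_int (sign p) *
      (\<Sum>i\<in>UNIV. G' i (p i) * (\<Prod>j\<in>UNIV - {i}. G s $ j $ p j)))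
    = (\<Sum>p\<in>{id}. of_int (sign p) *
      (\<Sum>i\<in>UNIV. G' i (p i) * (\<Prod>j\<in>UNIV - {i}. G s $ j $ p j)))"
    by (rule sum.mono_neutral_right) (auto simp: z permutes_id finite_permutations)
  also have "\<dots> = (\<Sum>i\<in>UNIV. G' i i)" by (simp add: assms(2) mat_def sign_id)
  finally show ?thesis using has_real_derivative_det[of G, OF assms(1)] by simp
qed

text \<open>Jacobi's formula: multiplication by the constant inverse of \<open>G s\<close> moves the
  base point to the identity, where the derivative of \<open>det\<close> is the trace.\<close>

lemma has_real_derivative_ln_det:
  fixes G :: "real \<Rightarrow> real ^ 'n ^ 'n::finite"
  assumes "\<And>i j. ((\<lambda>t. G t $ i $ j) has_real_derivative G' i j) (at s)" "det (G s) > 0"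
  shows "((\<lambda>t. ln (det (G t))) has_real_derivative
    (\<Sum>i\<in>UNIV. \<Sum>k\<in>UNIV. matrix_inv (G s) $ i $ k * G' k i)) (at s)"
proof -
  define H where "H = matrix_inv (G s)"
  have inv: "invertible (G s)" using assms(2) by (simp add: invertible_det_nz)
  then have HG: "H ** G s = mat 1" "G s ** H = mat 1" by (simp_all add: H_def matrix_inv_inverse)
  have "((\<lambda>t. det (H ** G t)) has_real_derivative (\<Sum>i\<in>UNIV. (\<Sum>k\<in>UNIV. H $ i $ k * G' k i))) (at s)"
    by (rule has_real_derivative_det_identity[where G' = "\<lambda>i j. \<Sum>k\<in>UNIV. H $ i $ k * G' k j"])
      (auto simp: matrix_matrix_mult_def HG(1)[unfolded matrix_matrix_mult_def]
        intro!: DERIV_sum DERIV_cmult assms(1))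
  then have "((\<lambda>t. det (G s) * det (H ** G t)) has_real_derivative
      det (G s) * (\<Sum>i\<in>UNIV. (\<Sum>k\<in>UNIV. H $ i $ k * G' k i))) (at s)" by (rule DERIV_cmult)
  moreover have "det (G s) * det (H ** G t) = det (G t)" for t
    using HG(2) by (metis det_mul matrix_mul_assoc matrix_mul_lid)
  ultimately have "((\<lambda>t. det (G t)) has_real_derivative
      det (G s) * (\<Sum>i\<in>UNIV. (\<Sum>k\<in>UNIV. H $ i $ k * G' k i))) (at s)" by simp
  from DERIV_chain2[OF DERIV_ln[OF assms(2)] this] show ?thesis
    using assms(2) by (simp add: H_def field_simps)
qed

text \<open>Cramer's rule; as quotients of determinants the entries of the inverse inherit
  differentiability.\<close>

lemma matrix_inv_entry:
  fixes A :: "real ^ 'n ^ 'n::finite"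
  assumes "det A \<noteq> 0"
  shows "matrix_inv A $ k $ l = det (\<chi> i j. if j = k then axis l 1 $ i else A $ i $ j) / det A"
proof -
  have "A *v (matrix_inv A *v axis l 1) = axis l 1"
    using assms by (simp add: invertible_det_nz matrix_inv_inverse matrix_vector_mul_assoc)
  then have "matrix_inv A *v axis l 1 = (\<chi> k. det (\<chi> i j. if j = k then axis l 1 $ i else A $ i $ j) / det A)"
    using cramer[OF assms] by blast
  moreover have "(matrix_inv A *v axis l 1) $ k = matrix_inv A $ k $ l"
    by (simp add: matrix_vector_mult_basis column_def)
  ultimately show ?thesis by simp
qed

lemma has_real_derivative_matrix_inv:
  fixes G :: "real \<Rightarrow> real ^ 'n ^ 'n::finite"
  assumes "open S" "s \<in> S" "\<And>t. t \<in> S \<Longrightarrow> det (G t) > 0"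
    and G': "\<And>i j. ((\<lambda>t. G t $ i $ j) has_real_derivative G' i j) (at s)"
  shows "((\<lambda>t. matrix_inv (G t) $ i $ j) has_real_derivative
    - (\<Sum>k\<in>UNIV. \<Sum>l\<in>UNIV. matrix_inv (G s) $ i $ k * G' k l * matrix_inv (G s) $ l $ j)) (at s)"
proof -
  have "\<exists>D. ((\<lambda>t. matrix_inv (G t) $ i $ j) has_real_derivative D) (at s)" for i j
  proof -
    define F where "F t = (\<chi> a b. if b = i then axis j 1 $ a else G t $ a $ b)" for t
    have "\<exists>D. ((\<lambda>t. det (F t)) has_real_derivative D) (at s)"
      by (rule exI, rule has_real_derivative_det[where G' = "\<lambda>a b. if b = i then 0 else G' a b"])
        (auto simp: F_def G')
    moreover have "\<exists>D. ((\<lambda>t. det (G t)) has_real_derivative D) (at s)"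
      by (rule exI, rule has_real_derivative_det[OF G'])
    ultimately obtain D1 D2 where "((\<lambda>t. det (F t)) has_real_derivative D1) (at s)"
        "((\<lambda>t. det (G t)) has_real_derivative D2) (at s)" by (elim exE)
    then have "\<exists>D. ((\<lambda>t. det (F t) / det (G t)) has_real_derivative D) (at s)"
      using assms(3)[OF assms(2)] by (intro exI) (rule DERIV_divide, auto)
    moreover have "\<forall>\<^sub>F t in nhds s. det (F t) / det (G t) = matrix_inv (G t) $ i $ j"
      using eventually_nhds_in_open[OF assms(1,2)]
      by eventually_elim (use assms(3) in \<open>force simp: matrix_inv_entry F_def\<close>)
    ultimately show ?thesis using DERIV_cong_ev[OF refl, of "\<lambda>t. det (F t) / det (G t)"] by auto
  qed
  then obtain D where D: "\<And>i j. ((\<lambda>t. matrix_inv (G t) $ i $ j) has_real_derivative D i j) (at s)"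
    by metis
  define H where "H = matrix_inv (G s)"
  have HG: "matrix_inv (G t) ** G t = mat 1" "G t ** matrix_inv (G t) = mat 1" if "t \<in> S" for t
    using assms(3)[OF that] by (auto intro!: matrix_inv_inverse simp: invertible_det_nz)
  \<comment> \<open>With differentiability known, the value \<open>D\<close> is found by
    differentiating \<open>matrix_inv (G t) ** G t = mat 1\<close>.\<close>
  have zero: "(\<Sum>k\<in>UNIV. D i k * G s $ k $ l + H $ i $ k * G' k l) = 0" for l
  proof -
    have "((\<lambda>t. \<Sum>k\<in>UNIV. matrix_inv (G t) $ i $ k * G t $ k $ l) has_real_derivative
        (\<Sum>k\<in>UNIV. D i k * G s $ k $ l + H $ i $ k * G' k l)) (at s)"
      by (auto intro!: DERIV_sum derivative_eq_intros D G' simp: H_def algebra_simps)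
    moreover have "\<forall>\<^sub>F t in nhds s. (\<Sum>k\<in>UNIV. matrix_inv (G t) $ i $ k * G t $ k $ l) = mat 1 $ i $ l"
      using eventually_nhds_in_open[OF assms(1,2)]
      by eventually_elim (use HG(1) in \<open>force simp: matrix_matrix_mult_def vec_eq_iff\<close>)
    then have "((\<lambda>t. \<Sum>k\<in>UNIV. matrix_inv (G t) $ i $ k * G t $ k $ l) has_real_derivative 0) (at s)"
      using DERIV_cong_ev[OF refl _ refl, of "\<lambda>t. \<Sum>k\<in>UNIV. matrix_inv (G t) $ i $ k * G t $ k $ l" "\<lambda>t. mat 1 $ i $ l"]
      by simp
    ultimately show ?thesis by (rule DERIV_unique)
  qed
  have GH: "(\<Sum>l\<in>UNIV. G s $ k $ l * H $ l $ j) = (if k = j then 1 else 0)" for k j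
    using HG(2)[OF assms(2)] by (simp add: H_def[symmetric] matrix_matrix_mult_def vec_eq_iff mat_def)
  have "0 = (\<Sum>l\<in>UNIV. (\<Sum>k\<in>UNIV. D i k * G s $ k $ l + H $ i $ k * G' k l) * H $ l $ j)"
    by (simp add: zero)
  also have "\<dots> = (\<Sum>l\<in>UNIV. \<Sum>k\<in>UNIV. D i k * (G s $ k $ l * H $ l $ j) + H $ i $ k * G' k l * H $ l $ j)"
    by (simp add: sum_distrib_right distrib_right mult.assoc)
  also have "\<dots> = (\<Sum>k\<in>UNIV. \<Sum>l\<in>UNIV. D i k * (G s $ k $ l * H $ l $ j) + H $ i $ k * G' k l * H $ l $ j)"
    by (rule sum.swap)
  also have "\<dots> = (\<Sum>k\<in>UNIV. D i k * (\<Sum>l\<in>UNIV. G s $ k $ l * H $ l $ j))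
      + (\<Sum>k\<in>UNIV. \<Sum>l\<in>UNIV. H $ i $ k * G' k l * H $ l $ j)"
    by (simp add: sum.distrib sum_distrib_left)
  also have "(\<Sum>k\<in>UNIV. D i k * (\<Sum>l\<in>UNIV. G s $ k $ l * H $ l $ j)) = D i j"
    by (simp add: GH if_distrib cong: if_cong)
  finally have "D i j = - (\<Sum>k\<in>UNIV. \<Sum>l\<in>UNIV. H $ i $ k * G' k l * H $ l $ j)" by simp
  then show ?thesis using D[of i j] by (simp add: H_def)
qed

lemma DERIV_cong_on_open:
  assumes "open S" "s \<in> S" "\<And>t. t \<in> S \<Longrightarrow> f t = g t" "(g has_real_derivative D) (at s)"
  shows "(f has_real_derivative D) (at s)"
  using has_field_derivative_transform_within_open[OF assms(4,1,2)] assms(3) by simp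

text \<open>With \<open>H\<close> the inverse of \<open>G\<close>, the formula
  \<open>H' = - H G' H\<close> is used on all of \<open>S\<close>, while the second derivative of
  \<open>H\<close> is taken at 0 only, where \<open>H\<close> is the identity and all sums become
  traces.\<close>

lemma ln_det_derivatives:
  fixes G :: "real \<Rightarrow> real ^ 'n ^ 'n::finite"
  assumes S: "open S" "0 \<in> S" and pos: "\<And>t. t \<in> S \<Longrightarrow> det (G t) > 0" and G0: "G 0 = mat 1"
    and G1: "\<And>t i j. t \<in> S \<Longrightarrow> ((\<lambda>t. G t $ i $ j) has_real_derivative G1 t i j) (at t)"
    and G2: "\<And>t i j. t \<in> S \<Longrightarrow> ((\<lambda>t. G1 t i j) has_real_derivative G2 t i j) (at t)"
    and G3: "\<And>i j. ((\<lambda>t. G2 t i j) has_real_derivative G3 i j) (at 0)"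
    and F: "\<And>t. t \<in> S \<Longrightarrow> ln (det (G t)) = F t"
    and F1: "\<And>t. t \<in> S \<Longrightarrow> (F has_real_derivative F1 t) (at t)"
    and F2: "\<And>t. t \<in> S \<Longrightarrow> (F1 has_real_derivative F2 t) (at t)"
    and F3: "(F2 has_real_derivative F3) (at 0)"
  shows "F1 0 = (\<Sum>i\<in>UNIV. G1 0 i i)"
    and "F2 0 = (\<Sum>i\<in>UNIV. G2 0 i i) - (\<Sum>i\<in>UNIV. \<Sum>k\<in>UNIV. G1 0 i k * G1 0 k i)"
    and "F3 = (\<Sum>i\<in>UNIV. G3 i i) - 3 * (\<Sum>i\<in>UNIV. \<Sum>k\<in>UNIV. G1 0 i k * G2 0 k i)
      + 2 * (\<Sum>i\<in>UNIV. \<Sum>k\<in>UNIV. \<Sum>l\<in>UNIV. G1 0 i l * G1 0 l k * G1 0 k i)"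
proof -
  define H where "H t i k = matrix_inv (G t) $ i $ k" for t i k
  define HD where "HD t i k = - (\<Sum>a\<in>UNIV. \<Sum>b\<in>UNIV. H t i a * G1 t a b * H t b k)" for t i k
  have "matrix_inv (mat 1 :: real ^ 'n ^ 'n) = mat 1"
    using matrix_inv_inverse(1)[of "mat 1 :: real ^ 'n ^ 'n"] by (simp add: invertible_det_nz)
  then have H0: "H 0 i k = (if i = k then 1 else 0)" for i k by (simp add: H_def G0 mat_def)
  have H1: "((\<lambda>t. H t i k) has_real_derivative HD t i k) (at t)" if "t \<in> S" for t i k
    unfolding H_def HD_def by (rule has_real_derivative_matrix_inv[OF S(1) that pos G1[OF that]])
  have HD0: "HD 0 i k = - G1 0 i k" for i k
    by (simp add: HD_def H0 mult_delta_left mult_delta_right)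
  define HDD where "HDD i k = 2 * (\<Sum>l\<in>UNIV. G1 0 i l * G1 0 l k) - G2 0 i k" for i k
  have sum_if: "(\<Sum>b\<in>UNIV. if P then f b else 0) = (if P then \<Sum>b\<in>UNIV. f b else 0)"
    for P and f :: "'n \<Rightarrow> real" by simp
  have H2: "((\<lambda>t. HD t i k) has_real_derivative HDD i k) (at 0)" for i k
  proof -
    have "((\<lambda>t. HD t i k) has_real_derivative - (\<Sum>a\<in>UNIV. \<Sum>b\<in>UNIV.
        (HD 0 i a * G1 0 a b + G2 0 a b * H 0 i a) * H 0 b k + HD 0 b k * (H 0 i a * G1 0 a b))) (at 0)"
      unfolding HD_def[of _ i k]
      by (intro DERIV_minus DERIV_sum DERIV_mult H1 G2 S)
    moreover have "(\<Sum>a\<in>UNIV. \<Sum>b\<in>UNIV.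
        (HD 0 i a * G1 0 a b + G2 0 a b * H 0 i a) * H 0 b k + HD 0 b k * (H 0 i a * G1 0 a b)) = - HDD i k"
      by (simp add: HD0 H0 HDD_def sum_if mult_delta_left mult_delta_right sum.distrib sum_negf mult.commute sum_subtractf)
    ultimately show ?thesis by simp
  qed
  have ln1: "((\<lambda>t. ln (det (G t))) has_real_derivative (\<Sum>i\<in>UNIV. \<Sum>k\<in>UNIV. H t i k * G1 t k i)) (at t)"
    if "t \<in> S" for t unfolding H_def using that by (intro has_real_derivative_ln_det G1 pos)
  have F1_eq: "F1 t = (\<Sum>i\<in>UNIV. \<Sum>k\<in>UNIV. H t i k * G1 t k i)" if "t \<in> S" for t
    by (rule DERIV_unique[OF DERIV_cong_on_open[OF S(1) that F F1[OF that]] ln1[OF that]])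
  have F2_eq: "F2 t = (\<Sum>i\<in>UNIV. \<Sum>k\<in>UNIV. HD t i k * G1 t k i + G2 t k i * H t i k)" if "t \<in> S" for t
  proof (rule DERIV_unique[OF F2[OF that] DERIV_cong_on_open[OF S(1) that F1_eq]])
    show "((\<lambda>t. \<Sum>i\<in>UNIV. \<Sum>k\<in>UNIV. H t i k * G1 t k i) has_real_derivative
        (\<Sum>i\<in>UNIV. \<Sum>k\<in>UNIV. HD t i k * G1 t k i + G2 t k i * H t i k)) (at t)"
      using that by (intro DERIV_sum DERIV_mult H1 G2)
  qed
  have F3_eq: "F3 = (\<Sum>i\<in>UNIV. \<Sum>k\<in>UNIV. (HDD i k * G1 0 k i + G2 0 k i * HD 0 i k)
      + (G3 k i * H 0 i k + HD 0 i k * G2 0 k i))"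
  proof (rule DERIV_unique[OF F3 DERIV_cong_on_open[OF S F2_eq]])
    show "((\<lambda>t. \<Sum>i\<in>UNIV. \<Sum>k\<in>UNIV. HD t i k * G1 t k i + G2 t k i * H t i k) has_real_derivative
       (\<Sum>i\<in>UNIV. \<Sum>k\<in>UNIV. (HDD i k * G1 0 k i + G2 0 k i * HD 0 i k)
      + (G3 k i * H 0 i k + HD 0 i k * G2 0 k i))) (at 0)"
      by (intro DERIV_sum DERIV_mult DERIV_add H1 H2 G2 G3 S)
  qed
  show "F1 0 = (\<Sum>i\<in>UNIV. G1 0 i i)"
    using F1_eq[OF S(2)] by (simp add: H0 mult_delta_left mult_delta_right)
  show "F2 0 = (\<Sum>i\<in>UNIV. G2 0 i i) - (\<Sum>i\<in>UNIV. \<Sum>k\<in>UNIV. G1 0 i k * G1 0 k i)"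
    using F2_eq[OF S(2)] by (simp add: H0 HD0 mult_delta_left mult_delta_right sum.distrib sum_negf sum_subtractf)
  have sw: "(\<Sum>i\<in>UNIV. \<Sum>k\<in>UNIV. G2 0 i k * G1 0 k i) = (\<Sum>i\<in>UNIV. \<Sum>k\<in>UNIV. G1 0 i k * G2 0 k i)"
    by (subst sum.swap) (simp add: mult.commute)
  have "F3 = (\<Sum>i\<in>UNIV. \<Sum>k\<in>UNIV. 2 * (\<Sum>l\<in>UNIV. G1 0 i l * G1 0 l k * G1 0 k i) - G2 0 i k * G1 0 k i
      - 2 * (G1 0 i k * G2 0 k i) + G3 k i * (if i = k then 1 else 0))"
    unfolding F3_eq
    by (intro sum.cong refl) (simp add: H0 HD0 HDD_def algebra_simps sum_distrib_left)
  also have "\<dots> = 2 * (\<Sum>i\<in>UNIV. \<Sum>k\<in>UNIV. \<Sum>l\<in>UNIV. G1 0 i l * G1 0 l k * G1 0 k i)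
      - (\<Sum>i\<in>UNIV. \<Sum>k\<in>UNIV. G2 0 i k * G1 0 k i) - 2 * (\<Sum>i\<in>UNIV. \<Sum>k\<in>UNIV. G1 0 i k * G2 0 k i)
      + (\<Sum>i\<in>UNIV. G3 i i)"
    by (simp add: sum.distrib sum_subtractf sum_distrib_left mult_delta_left mult_delta_right)
  finally show "F3 = (\<Sum>i\<in>UNIV. G3 i i) - 3 * (\<Sum>i\<in>UNIV. \<Sum>k\<in>UNIV. G1 0 i k * G2 0 k i)
      + 2 * (\<Sum>i\<in>UNIV. \<Sum>k\<in>UNIV. \<Sum>l\<in>UNIV. G1 0 i l * G1 0 l k * G1 0 k i)"
    unfolding sw by simp
qed


subsection \<open>Hessian metrics and completeness\<close>

definition speed :: "(real ^ 'n \<Rightarrow> real ^ 'n ^ 'n) \<Rightarrow> (real \<Rightarrow> real ^ 'n::finite) \<Rightarrow> real \<Rightarrow> real" where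
  "speed G \<gamma> t = sqrt (vector_derivative \<gamma> (at t) \<bullet> (G (\<gamma> t) *v vector_derivative \<gamma> (at t)))"

text \<open>Halving the parameter interval doubles the speed. The joint at 1/2 and the finitely many
  corners are discarded as a finite set.\<close>

lemma speed_join:
  fixes \<gamma>1 \<gamma>2 :: "real \<Rightarrow> real ^ 'n::finite"
  assumes "(speed G \<gamma>1 has_integral r1) {0..1}" "(speed G \<gamma>2 has_integral r2) {0..1}"
    "valid_path \<gamma>1" "valid_path \<gamma>2"
  shows "(speed G (\<gamma>1 +++ \<gamma>2) has_integral r1 + r2) {0..1}"
proof -
  obtain s1 s2
    where s1: "finite s1" "\<forall>x\<in>{0..1} - s1. \<gamma>1 differentiable at x"
      and s2: "finite s2" "\<forall>x\<in>{0..1} - s2. \<gamma>2 differentiable at x"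
    using assms
    by (auto simp: valid_path_def piecewise_C1_differentiable_on_def C1_differentiable_on_eq)
  have i1: "((\<lambda>x. 2 * speed G \<gamma>1 (2 * x)) has_integral r1) {0..1/2}"
    and i2: "((\<lambda>x. 2 * speed G \<gamma>2 (2 * x - 1)) has_integral r2) {1/2..1}"
    using has_integral_affinity01 [OF assms(1), where m = 2 and c = 0, THEN has_integral_cmul [where c = 2]]
      has_integral_affinity01 [OF assms(2), where m = 2 and c = "-1", THEN has_integral_cmul [where c = 2]]
    by (simp_all only: image_affinity_atLeastAtMost_div_diff, simp_all)
  have scale: "sqrt ((2 *\<^sub>R w) \<bullet> (A *v (2 *\<^sub>R w))) = 2 * sqrt (w \<bullet> (A *v w))" for w :: "real ^ 'n" and A
  proof -
    have "(2 *\<^sub>R w) \<bullet> (A *v (2 *\<^sub>R w)) = 4 * (w \<bullet> (A *v w))"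
      by (simp add: matrix_vector_mult_scaleR)
    then show ?thesis by (simp add: real_sqrt_mult)
  qed
  have v1: "speed G (\<gamma>1 +++ \<gamma>2) z = 2 * speed G \<gamma>1 (2 * z)"
    if "0 \<le> z" "z * 2 < 1" "2 * z \<notin> s1" for z
  proof -
    have "vector_derivative (\<gamma>1 +++ \<gamma>2) (at z) = 2 *\<^sub>R vector_derivative \<gamma>1 (at (2 * z))"
    proof (rule vector_derivative_at [OF has_vector_derivative_transform_within])
      show "0 < \<bar>z - 1/2\<bar>" using that by auto
      have "((*) 2 has_vector_derivative 2) (at z)"
        by (auto intro!: derivative_eq_intros simp: has_vector_derivative_def)
      moreover have "(\<gamma>1 has_vector_derivative vector_derivative \<gamma>1 (at (2 * z))) (at (2 * z))"
        using s1 that by (auto simp: vector_derivative_works[symmetric])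
      ultimately show "((\<lambda>x. \<gamma>1 (2 * x)) has_vector_derivative 2 *\<^sub>R vector_derivative \<gamma>1 (at (2 * z))) (at z)"
        by (intro vector_diff_chain_at [simplified o_def])
    qed (use that in \<open>simp_all add: joinpaths_def dist_real_def abs_if split: if_split_asm\<close>)
    moreover have "(\<gamma>1 +++ \<gamma>2) z = \<gamma>1 (2 * z)" using that by (simp add: joinpaths_def)
    ultimately show ?thesis unfolding speed_def by (simp only: scale)
  qed
  have v2: "speed G (\<gamma>1 +++ \<gamma>2) z = 2 * speed G \<gamma>2 (2 * z - 1)"
    if "1 < z * 2" "z \<le> 1" "2 * z - 1 \<notin> s2" for z
  proof -
    have "vector_derivative (\<gamma>1 +++ \<gamma>2) (at z) = 2 *\<^sub>R vector_derivative \<gamma>2 (at (2 * z - 1))"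
    proof (rule vector_derivative_at [OF has_vector_derivative_transform_within])
      show "0 < \<bar>z - 1/2\<bar>" using that by auto
      have "((\<lambda>x. 2 * x - 1) has_vector_derivative 2) (at z)"
        by (auto intro!: derivative_eq_intros simp: has_vector_derivative_def)
      moreover have "(\<gamma>2 has_vector_derivative vector_derivative \<gamma>2 (at (2 * z - 1))) (at (2 * z - 1))"
        using s2 that by (auto simp: vector_derivative_works[symmetric])
      ultimately show "((\<lambda>x. \<gamma>2 (2 * x - 1)) has_vector_derivative 2 *\<^sub>R vector_derivative \<gamma>2 (at (2 * z - 1))) (at z)"
        by (intro vector_diff_chain_at [simplified o_def])
    qed (use that in \<open>simp_all add: joinpaths_def dist_real_def abs_if split: if_split_asm\<close>)
    moreover have "(\<gamma>1 +++ \<gamma>2) z = \<gamma>2 (2 * z - 1)" using that by (simp add: joinpaths_def)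
    ultimately show ?thesis unfolding speed_def by (simp only: scale)
  qed
  have "(speed G (\<gamma>1 +++ \<gamma>2) has_integral r1) {0..1/2}"
  proof (rule has_integral_spike_finite [OF _ _ i1])
    show "finite (insert (1/2) ((*) 2 -` s1))"
      using s1 by (force intro: finite_vimageI [where h = "(*) 2"] inj_onI)
  qed (auto simp: v1)
  moreover have "(speed G (\<gamma>1 +++ \<gamma>2) has_integral r2) {1/2..1}"
  proof (rule has_integral_spike_finite [OF _ _ i2])
    show "finite (insert (1/2) ((\<lambda>x. 2 * x - 1) -` s2))"
      using s2 by (force intro: finite_vimageI [where h = "\<lambda>x. 2 * x - 1"] inj_onI)
  qed (auto simp: v2)
  ultimately show ?thesis by (simp add: has_integral_combine [where c = "1/2"])
qed

text \<open>Cauchy-Schwarz for \<open>(sqrt s, sqrt (1 - s))\<close>, of length 1, and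
  \<open>(sqrt a, sqrt b)\<close>; the square added in the proof is its defect.\<close>

lemma sqrt_split_le:
  fixes a b s :: real
  assumes "0 \<le> a" "0 \<le> b" "0 \<le> s" "s \<le> 1"
  shows "sqrt (s * a) + sqrt ((1 - s) * b) \<le> sqrt (a + b)"
proof (rule real_le_rsqrt)
  define p q x y where "p = sqrt s" "q = sqrt (1 - s)" "x = sqrt a" "y = sqrt b"
  have sq: "p\<^sup>2 = s" "q\<^sup>2 = 1 - s" "x\<^sup>2 = a" "y\<^sup>2 = b" using assms by (simp_all add: p_q_x_y_def)
  have "(sqrt (s * a) + sqrt ((1 - s) * b))\<^sup>2 = (p * x + q * y)\<^sup>2"
    by (simp add: p_q_x_y_def real_sqrt_mult)
  also have "\<dots> \<le> (p * x + q * y)\<^sup>2 + (p * y - q * x)\<^sup>2" by simp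
  also have "\<dots> = (p\<^sup>2 + q\<^sup>2) * (x\<^sup>2 + y\<^sup>2)" by (simp add: power2_eq_square algebra_simps)
  also have "\<dots> = a + b" by (simp add: sq)
  finally show "(sqrt (s * a) + sqrt ((1 - s) * b))\<^sup>2 \<le> a + b" .
qed

locale hessian_domain =
  fixes N :: "(real ^ 'n::finite) set" and u :: "real ^ 'n \<Rightarrow> real"
  assumes open_N: "open N" and smooth_u: "smooth_on N u" and convex_u: "strictly_convex_on N u"
begin

section \<open>The Hessian metric and the symmetrized Bregman divergence\<close>

definition g :: "real ^ 'n \<Rightarrow> real ^ 'n \<Rightarrow> real ^ 'n \<Rightarrow> real" where
  "g x a b = dird a (dird b u) x"

text \<open>Symmetrized Bregman divergence of \<open>u\<close>. For a segment in \<open>N\<close> it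
  is the integral of the squared speed, that is, the energy of the affine parametrization.\<close>

definition breg :: "real ^ 'n \<Rightarrow> real ^ 'n \<Rightarrow> real" where
  "breg x y = dird (y - x) u y - dird (y - x) u x"

lemma smooth_dird: "smooth_on N (dird a u)" "smooth_on N (dird a (dird b u))"
  by (intro smooth_on_dird open_N smooth_u)+

lemma g_sym: "x \<in> N \<Longrightarrow> g x a b = g x b a"
  unfolding g_def by (rule dird_commute[OF open_N smooth_u])

lemma bilinear_g:
  assumes x: "x \<in> N"
  shows "bilinear (g x)"
  unfolding bilinear_def
proof (intro conjI allI)
  show lin: "linear (\<lambda>b. g x b a)" for a unfolding g_def by (rule linear_dird[OF smooth_dird(1) x])
  have eq: "g x a = (\<lambda>b. g x b a)" for a by (rule ext) (rule g_sym[OF x])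
  show "linear (g x a)" for a unfolding eq[of a] by (rule lin)
qed

lemma dird_linear: "x \<in> N \<Longrightarrow> linear (\<lambda>a. dird a u x)"
  by (rule linear_dird[OF smooth_u])

lemma hessian_entry: "hessian u x $ i $ j = g x (axis i 1) (axis j 1)"
proof -
  have "partial_deriv k f = dird (axis k 1) f" for k :: 'n and f
    by (simp add: fun_eq_iff partial_deriv_def dird_def)
  then show ?thesis by (simp add: hessian_def g_def)
qed

lemma g_expand: "x \<in> N \<Longrightarrow> g x a b = (\<Sum>i\<in>UNIV. \<Sum>j\<in>UNIV. a $ i * b $ j * hessian u x $ i $ j)"
proof -
  assume x: "x \<in> N"
  have "g x a b = g x (\<Sum>i\<in>UNIV. a $ i *\<^sub>R axis i 1) (\<Sum>j\<in>UNIV. b $ j *\<^sub>R axis j 1)"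
    using basis_expansion[of a] basis_expansion[of b] by (simp add: scalar_mult_eq_scaleR)
  then show ?thesis
    unfolding bilinear_sums[OF bilinear_g[OF x]] bilinear_simps[OF bilinear_g[OF x]] hessian_entry
    by (subst sum.swap) (simp add: sum_distrib_left mult_ac)
qed

lemma g_hessian: "x \<in> N \<Longrightarrow> a \<bullet> (hessian u x *v b) = g x a b"
  by (simp add: g_expand inner_vec_def matrix_vector_mult_def sum_distrib_left mult_ac)

lemma spd_g:
  assumes "x \<in> N"
  shows "spd (g x)"
proof -
  have "0 < g x a a" if "a \<noteq> 0" for a
    using convex_u assms that unfolding strictly_convex_on_def positive_definite_def
    by (auto simp flip: g_hessian[OF assms])
  then show ?thesis using bilinear_g[OF assms] g_sym[OF assms] unfolding spd_def by blast
qed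

lemma g_nonneg: "x \<in> N \<Longrightarrow> 0 \<le> g x a a"
  by (rule spd_nonneg[OF spd_g])

lemma g_pos: "x \<in> N \<Longrightarrow> a \<noteq> 0 \<Longrightarrow> 0 < g x a a"
  by (rule spd_pos[OF spd_g])

lemma continuous_on_g:
  assumes "continuous_on S p" "continuous_on S a" "continuous_on S b" "p ` S \<subseteq> N"
  shows "continuous_on S (\<lambda>t. g (p t) (a t) (b t))"
proof -
  have hc: "continuous_on S (\<lambda>t. hessian u (p t) $ i $ j)" for i j
    unfolding hessian_entry g_def
    by (rule continuous_on_compose2[OF smooth_on_imp_continuous_on[OF smooth_dird(2)] assms(1,4)])
  have "continuous_on S (\<lambda>t. a t $ i)" "continuous_on S (\<lambda>t. b t $ i)" for i
    using continuous_on_component[OF assms(2)] continuous_on_component[OF assms(3)] by auto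
  with hc have "continuous_on S (\<lambda>t. \<Sum>i\<in>UNIV. \<Sum>j\<in>UNIV. a t $ i * b t $ j * hessian u (p t) $ i $ j)"
    by (intro continuous_on_sum continuous_on_mult)
  then show ?thesis
    by (rule continuous_on_eq) (use assms(4) in \<open>auto simp: g_expand\<close>)
qed

lemma segment_derivative:
  assumes "x + t *\<^sub>R c \<in> N"
  shows "((\<lambda>t. dird a u (x + t *\<^sub>R c)) has_real_derivative g (x + t *\<^sub>R c) c a) (at t)"
  unfolding g_def
  by (rule has_real_derivative_along[OF smooth_dird(1), of "\<lambda>t. x + t *\<^sub>R c", OF assms])
    (auto intro!: derivative_eq_intros simp: has_vector_derivative_def)

lemma in_closed_segmentI: "0 \<le> t \<Longrightarrow> t \<le> 1 \<Longrightarrow> x + t *\<^sub>R (y - x) \<in> closed_segment x y"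
  for x y :: "real ^ 'n"
  by (auto simp: in_segment algebra_simps intro!: exI[of _ t])

lemma in_segmentI: "closed_segment x y \<subseteq> N \<Longrightarrow> 0 \<le> t \<Longrightarrow> t \<le> 1 \<Longrightarrow> x + t *\<^sub>R (y - x) \<in> N"
  using in_closed_segmentI by blast

lemma segment_mono:
  assumes "closed_segment x y \<subseteq> N" "0 \<le> s" "s \<le> t" "t \<le> 1"
  shows "dird (y - x) u (x + s *\<^sub>R (y - x)) \<le> dird (y - x) u (x + t *\<^sub>R (y - x))"
proof (rule DERIV_nonneg_imp_nondecreasing[OF assms(3)])
  fix r assume "s \<le> r" "r \<le> t"
  then have "x + r *\<^sub>R (y - x) \<in> N" using assms by (intro in_segmentI) auto
  then show "\<exists>d. ((\<lambda>r. dird (y - x) u (x + r *\<^sub>R (y - x))) has_real_derivative d) (at r) \<and> 0 \<le> d"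
    using segment_derivative g_nonneg by blast
qed

lemma breg_nonneg: "closed_segment x y \<subseteq> N \<Longrightarrow> 0 \<le> breg x y"
  using segment_mono[of x y 0 1] by (simp add: breg_def)

lemma breg_MVT:
  assumes "closed_segment x y \<subseteq> N"
  obtains t where "0 < t" "t < 1" "breg x y = g (x + t *\<^sub>R (y - x)) (y - x) (y - x)"
proof -
  have "\<exists>t>0. t < 1 \<and> dird (y - x) u (x + 1 *\<^sub>R (y - x)) - dird (y - x) u (x + 0 *\<^sub>R (y - x))
      = (1 - 0) * g (x + t *\<^sub>R (y - x)) (y - x) (y - x)"
    by (rule MVT2) (use segment_derivative in_segmentI[OF assms] in auto)
  then show ?thesis using that by (auto simp: breg_def)
qed

lemma breg_sym: "x \<in> N \<Longrightarrow> y \<in> N \<Longrightarrow> breg y x = breg x y"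
  using linear_diff[OF dird_linear] by (simp add: breg_def)

lemma breg_self [simp]: "breg x x = 0"
  by (simp add: breg_def)

lemma breg_split:
  assumes "closed_segment x y \<subseteq> N" "0 \<le> s" "s \<le> 1" "w = x + s *\<^sub>R (y - x)"
  defines "F \<equiv> \<lambda>t. dird (y - x) u (x + t *\<^sub>R (y - x))"
  shows "breg x w = s * (F s - F 0)" "breg w y = (1 - s) * (F 1 - F s)" "breg x y = F 1 - F 0"
proof -
  have N: "x \<in> N" "y \<in> N" "w \<in> N" using in_segmentI[OF assms(1), of 0] in_segmentI[OF assms(1), of 1]
    in_segmentI[OF assms(1-3)] assms(4) by auto
  have "w - x = s *\<^sub>R (y - x)" "y - w = (1 - s) *\<^sub>R (y - x)" by (auto simp: assms(4) algebra_simps)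
  then show "breg x w = s * (F s - F 0)" "breg w y = (1 - s) * (F 1 - F s)"
    using N by (simp_all add: breg_def F_def assms(4) linear_cmul[OF dird_linear] right_diff_distrib)
  show "breg x y = F 1 - F 0" by (simp add: F_def breg_def)
qed

lemma closed_segment_split:
  assumes "w \<in> closed_segment x y"
  shows "closed_segment x w \<subseteq> closed_segment x y" "closed_segment w y \<subseteq> closed_segment x y"
  using assms by (simp_all add: subset_closed_segment)

text \<open>The two pieces are \<open>s\<close> and \<open>1 - s\<close> times increments of the
  nondecreasing function \<open>F\<close>, which add up to \<open>breg x y\<close>; then
  Cauchy-Schwarz. It allows cutting a polygon inside a segment without using up more length.\<close>

lemma sqrt_breg_split:
  assumes "closed_segment x y \<subseteq> N" "0 \<le> s" "s \<le> 1" "w = x + s *\<^sub>R (y - x)"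
  shows "sqrt (breg x w) + sqrt (breg w y) \<le> sqrt (breg x y)"
proof -
  define F where "F t = dird (y - x) u (x + t *\<^sub>R (y - x))" for t
  note sp = breg_split[OF assms, folded F_def]
  have "F 0 \<le> F s" "F s \<le> F 1"
    unfolding F_def by (intro segment_mono[OF assms(1)]; use assms(2,3) in simp)+
  then have "sqrt (s * (F s - F 0)) + sqrt ((1 - s) * (F 1 - F s)) \<le> sqrt ((F s - F 0) + (F 1 - F s))"
    using assms by (intro sqrt_split_le) auto
  then show ?thesis by (simp add: sp)
qed

text \<open>The slope at the midpoint enters both pieces with factor 1/2 and opposite signs and
  cancels; hence an equality.\<close>

lemma breg_midpoint:
  assumes "closed_segment x y \<subseteq> N"
  shows "breg x (midpoint x y) + breg (midpoint x y) y = breg x y / 2"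
proof -
  have "midpoint x y = x + (1/2) *\<^sub>R (y - x)"
  proof -
    have "x + (1/2) *\<^sub>R (y - x) = (1/2 + 1/2) *\<^sub>R x + (1/2) *\<^sub>R (y - x)" by simp
    also have "\<dots> = midpoint x y" unfolding midpoint_def scaleR_right_diff_distrib scaleR_left_distrib
      by (simp add: scaleR_add_right inverse_eq_divide)
    finally show ?thesis by simp
  qed
  from breg_split[OF assms _ _ this] show ?thesis by (simp add: field_simps)
qed

text \<open>Requiring a gauge integrable speed keeps measurability out of the concatenation of curves; such
  curves suffice to bound the Riemannian distance from above.\<close>

definition curve_of_length :: "(real \<Rightarrow> real ^ 'n) \<Rightarrow> real \<Rightarrow> bool" where
  "curve_of_length \<gamma> r \<longleftrightarrow> valid_path \<gamma> \<and> path_image \<gamma> \<subseteq> N \<and>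
    (speed (hessian u) \<gamma> has_integral r) {0..1}"

lemma curve_of_length_join:
  assumes "curve_of_length \<gamma>1 r1" "curve_of_length \<gamma>2 r2" "pathfinish \<gamma>1 = pathstart \<gamma>2"
  shows "curve_of_length (\<gamma>1 +++ \<gamma>2) (r1 + r2)"
  using assms speed_join unfolding curve_of_length_def
  by (auto simp: path_image_join intro: valid_path_join)

lemma curve_of_length_dist:
  assumes "curve_of_length \<gamma> r" "pathstart \<gamma> = x" "pathfinish \<gamma> = y"
  shows "riemannian_dist N (hessian u) x y \<le> ennreal r"
proof -
  have "riemannian_length (hessian u) \<gamma> = (\<integral>\<^sup>+t. ennreal (speed (hessian u) \<gamma> t) * indicator {0..1} t \<partial>lborel)"
    by (simp add: riemannian_length_def speed_def)
  also have "\<dots> = ennreal r"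
  proof (rule nn_integral_has_integral_lebesgue')
    fix t :: real assume "t \<in> {0..1}"
    then have "\<gamma> t \<in> N" using assms(1) by (auto simp: curve_of_length_def path_image_def)
    then show "0 \<le> speed (hessian u) \<gamma> t" using g_nonneg by (simp add: speed_def g_hessian)
  qed (use assms(1) in \<open>simp add: curve_of_length_def\<close>)
  finally have "riemannian_length (hessian u) \<gamma> = ennreal r" .
  then show ?thesis
    unfolding riemannian_dist_def using assms
    by (intro INF_lower2[of \<gamma>]) (auto simp: curve_of_length_def)
qed

text \<open>Length is at most the root of the energy. Cauchy-Schwarz for integrals is replaced by
  the pointwise bound \<open>sqrt q \<le> (q / s + s) / 2\<close>, with \<open>s\<close> the root of
  the energy.\<close>

lemma curve_of_length_linepath:
  assumes "closed_segment x y \<subseteq> N"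
  shows "\<exists>r. curve_of_length (linepath x y) r \<and> r \<le> sqrt (breg x y)"
proof -
  define q where "q t = g (x + t *\<^sub>R (y - x)) (y - x) (y - x)" for t
  have lp: "linepath x y t = x + t *\<^sub>R (y - x)" for t by (simp add: linepath_def algebra_simps)
  have sp: "speed (hessian u) (linepath x y) t = sqrt (q t)" if "t \<in> {0..1}" for t
    using in_segmentI[OF assms] that by (simp add: speed_def lp g_hessian q_def)
  have q0: "0 \<le> q t" if "t \<in> {0..1}" for t using in_segmentI[OF assms] g_nonneg that by (simp add: q_def)
  have "continuous_on {0..1} (\<lambda>t. sqrt (q t))"
    unfolding q_def using in_segmentI[OF assms] by (intro continuous_intros continuous_on_g) auto
  then obtain r where r: "((\<lambda>t. sqrt (q t)) has_integral r) {0..1}"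
    using integrable_continuous_interval by blast
  have cl: "curve_of_length (linepath x y) r"
    using assms has_integral_eq[OF _ r] sp by (auto simp: curve_of_length_def)
  have Q: "(q has_integral breg x y) {0..1}"
  proof -
    have "(q has_integral (dird (y - x) u (x + 1 *\<^sub>R (y - x)) - dird (y - x) u (x + 0 *\<^sub>R (y - x)))) {0..1}"
      unfolding q_def
      by (rule fundamental_theorem_of_calculus)
        (auto intro!: has_field_derivative_at_within segment_derivative in_segmentI[OF assms]
          simp flip: has_real_derivative_iff_has_vector_derivative)
    then show ?thesis by (simp add: breg_def)
  qed
  have "r \<le> sqrt (breg x y)"
  \<comment> \<open>The pointwise bound divides by \<open>s\<close>; zero energy means
    \<open>x = y\<close> by positive definiteness.\<close>
  proof (cases "breg x y = 0")
    case True
    from breg_MVT[OF assms] obtain t where t: "0 < t" "t < 1" "breg x y = g (x + t *\<^sub>R (y - x)) (y - x) (y - x)" .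
    then have "x = y" using g_pos[OF in_segmentI[OF assms, of t], of "y - x"] True by fastforce
    then have "((\<lambda>t. sqrt (q t)) has_integral 0) {0..1}"
      using assms by (simp add: q_def bilinear_simps[OF bilinear_g])
    then show ?thesis using has_integral_unique[OF r] breg_nonneg[OF assms] by auto
  next
    case False
    define s where "s = sqrt (breg x y)"
    have s: "s > 0" "s * s = breg x y" using False breg_nonneg[OF assms] by (auto simp: s_def)
    have "((\<lambda>t. (q t / s + s) / 2) has_integral ((breg x y / s + s * (1 - 0)) / 2)) {0..1}"
      using has_integral_const_real[of s 0 1] by (intro has_integral_divide has_integral_add Q) simp
    then have "r \<le> (breg x y / s + s * (1 - 0)) / 2"
    proof (rule has_integral_le[OF r])
      fix t :: real assume "t \<in> {0..1}"
      then have "0 \<le> (sqrt (q t) - s)\<^sup>2 / s" using s by simp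
      also have "\<dots> = q t / s + s - 2 * sqrt (q t)"
        using s q0[OF \<open>t \<in> {0..1}\<close>] by (simp add: power2_diff field_simps power2_eq_square)
      finally show "sqrt (q t) \<le> (q t / s + s) / 2" by simp
    qed
    also have "\<dots> = s" using s(1) by (simp flip: s(2))
    finally show ?thesis by (simp add: s_def)
  qed
  with cl show ?thesis by blast
qed

section \<open>Comparison with the Euclidean metric, and polygonal balls\<close>

lemma g_bounds:
  assumes "compact C" "C \<subseteq> N"
  obtains l L where "0 < l" "0 < L" "\<And>x a. x \<in> C \<Longrightarrow> l * (norm a)\<^sup>2 \<le> g x a a"
    "\<And>x a. x \<in> C \<Longrightarrow> g x a a \<le> L * (norm a)\<^sup>2"
proof (cases "C = {}")
  case True
  then show ?thesis using that[of 1 1] by simp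
next
  case False
  define S where "S = C \<times> sphere (0 :: real ^ 'n) 1"
  have "compact S" unfolding S_def by (intro compact_Times assms(1) compact_sphere)
  moreover have "S \<noteq> {}" using False by (simp add: S_def)
  moreover have "continuous_on S (\<lambda>p. g (fst p) (snd p) (snd p))"
    by (rule continuous_on_g) (use assms(2) in \<open>auto simp: S_def intro!: continuous_intros\<close>)
  ultimately obtain p q where p: "p \<in> S" "\<And>r. r \<in> S \<Longrightarrow> g (fst p) (snd p) (snd p) \<le> g (fst r) (snd r) (snd r)"
    and q: "q \<in> S" "\<And>r. r \<in> S \<Longrightarrow> g (fst r) (snd r) (snd r) \<le> g (fst q) (snd q) (snd q)"
    using continuous_attains_inf[of S "\<lambda>p. g (fst p) (snd p) (snd p)"]
      continuous_attains_sup[of S "\<lambda>p. g (fst p) (snd p) (snd p)"] by blast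
  define l where "l = g (fst p) (snd p) (snd p)"
  define L where "L = g (fst q) (snd q) (snd q)"
  have pos: "r \<in> S \<Longrightarrow> 0 < g (fst r) (snd r) (snd r)" for r
    using assms(2) by (intro g_pos) (auto simp: S_def)
  have scale: "l * (norm a)\<^sup>2 \<le> g x a a \<and> g x a a \<le> L * (norm a)\<^sup>2" if "x \<in> C" for x a
  proof (cases "a = 0")
    case True
    then show ?thesis using that assms(2) by (auto simp: bilinear_simps[OF bilinear_g])
  next
    case nz: False
    define b where "b = (1 / norm a) *\<^sub>R a"
    have "(x, b) \<in> S" using that nz by (simp add: S_def b_def)
    then have "l \<le> g x b b" "g x b b \<le> L" using p(2)[of "(x, b)"] q(2)[of "(x, b)"] by (auto simp: l_def L_def)
    moreover have "x \<in> N" using that assms(2) by blast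
    then have "g x b b = g x a a / (norm a)\<^sup>2"
      by (simp add: b_def bilinear_simps[OF bilinear_g] power2_eq_square)
    ultimately show ?thesis using nz by (simp add: field_simps)
  qed
  show ?thesis using that[of l L] pos[OF p(1)] pos[OF q(1)] scale by (simp add: l_def L_def)
qed

text \<open>The polygonal substitute for curves of length at most \<open>r\<close>.\<close>

inductive reach :: "real ^ 'n \<Rightarrow> real \<Rightarrow> real ^ 'n \<Rightarrow> bool" for z where
  start: "z \<in> N \<Longrightarrow> 0 \<le> r \<Longrightarrow> reach z r z"
| step: "reach z r y \<Longrightarrow> closed_segment y w \<subseteq> N \<Longrightarrow> r + sqrt (breg y w) \<le> r' \<Longrightarrow> reach z r' w"

lemma reach_in: "reach z r y \<Longrightarrow> z \<in> N \<and> y \<in> N"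
  by (induction rule: reach.induct) auto

lemma reach_mono: "reach z r y \<Longrightarrow> r \<le> r' \<Longrightarrow> reach z r' y"
  by (erule reach.cases) (auto intro: reach.intros order_trans)

lemma reach_trans: "reach y s w \<Longrightarrow> reach z r y \<Longrightarrow> reach z (r + s) w"
proof (induction rule: reach.induct)
  case (start s)
  then show ?case by (intro reach_mono[OF start(3)]) simp
next
  case (step s x w s')
  then show ?case by (intro reach.step[OF step.IH[OF step.prems]]) auto
qed

lemma reach_segment: "closed_segment x y \<subseteq> N \<Longrightarrow> sqrt (breg x y) \<le> r \<Longrightarrow> reach x r y"
  by (rule reach.step[OF reach.start[of x 0]]) auto

lemma reach_sym: "reach z r y \<Longrightarrow> reach y r z"
proof (induction rule: reach.induct)
  case (start r)
  then show ?case by (rule reach.start)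
next
  case (step r y w r')
  have "y \<in> N" "w \<in> N" using step(2) by auto
  then have "reach w (sqrt (breg y w)) y"
    using step(2) by (intro reach_segment) (auto simp: closed_segment_commute breg_sym)
  from reach_trans[OF step.IH this] show ?case by (rule reach_mono) (use step(3) in simp)
qed

lemma reach_curve: "reach z r y \<Longrightarrow> \<exists>\<gamma> r'. curve_of_length \<gamma> r' \<and> pathstart \<gamma> = z \<and> pathfinish \<gamma> = y \<and> r' \<le> r"
proof (induction rule: reach.induct)
  case (start r)
  obtain r' where "curve_of_length (linepath z z) r'" "r' \<le> sqrt (breg z z)"
    using curve_of_length_linepath[of z z] start(1) by auto
  then show ?case using start(2) real_sqrt_ge_0_iff[of 0]
    by (intro exI[of _ "linepath z z"] exI[of _ r'] conjI pathstart_linepath pathfinish_linepath)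
      (assumption, simp)
next
  case (step r y w r')
  obtain \<gamma> s where \<gamma>: "curve_of_length \<gamma> s" "pathstart \<gamma> = z" "pathfinish \<gamma> = y" "s \<le> r"
    using step.IH by blast
  obtain s' where "curve_of_length (linepath y w) s'" "s' \<le> sqrt (breg y w)"
    using curve_of_length_linepath[OF step(2)] by blast
  then show ?case using \<gamma> step(3)
    by (intro exI[of _ "\<gamma> +++ linepath y w"] exI[of _ "s + s'"]) (auto intro: curve_of_length_join)
qed

lemma reach_dist:
  assumes "reach z r y"
  shows "riemannian_dist N (hessian u) z y \<le> ennreal r"
proof -
  obtain \<gamma> r' where "curve_of_length \<gamma> r'" "pathstart \<gamma> = z" "pathfinish \<gamma> = y" "r' \<le> r"
    using reach_curve[OF assms] by blast
  then show ?thesis using curve_of_length_dist[of \<gamma> r' z y] ennreal_leI[of r' r] by auto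
qed

text \<open>The value \<open>s\<close> falls before, after or inside the last segment; inside, the
  intermediate value theorem finds the cut. Splitting at every prescribed value is how polygons
  stand in for minimizing geodesics.\<close>

lemma reach_intermediate:
  "reach z r y \<Longrightarrow> 0 \<le> s \<Longrightarrow> s \<le> r \<Longrightarrow> \<exists>w. reach z s w \<and> reach w (r - s) y"
proof (induction rule: reach.induct)
  case (start r)
  then show ?case by (intro exI[of _ z]) (auto intro: reach.start)
next
  case (step r y w r')
  have yw: "y \<in> N" "w \<in> N" using step(2) by auto
  consider "s \<le> r" | "r + sqrt (breg y w) \<le> s" | "r < s" "s < r + sqrt (breg y w)" by linarith
  then show ?case
  proof cases
    case 1
    then obtain p where "reach z s p" "reach p (r - s) y" using step.IH step.prems by blast
    moreover from this(2) have "reach p (r' - s) w"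
      by (rule reach.step[OF _ step(2)]) (use step(3) in linarith)
    ultimately show ?thesis by blast
  next
    case 2
    then have "reach z s w" using step by (blast intro: reach.step)
    moreover have "reach w (r' - s) w" using step.prems yw by (intro reach.start) auto
    ultimately show ?thesis by blast
  next
    case 3
    define F where "F t = dird (w - y) u (y + t *\<^sub>R (w - y))" for t
    have contF: "continuous_on {0..1} F"
    proof (intro continuous_at_imp_continuous_on ballI)
      fix t :: real assume "t \<in> {0..1}"
      then have "y + t *\<^sub>R (w - y) \<in> N" using in_segmentI[OF step(2)] by simp
      from DERIV_isCont[OF segment_derivative[OF this, of "w - y"]] show "isCont F t" by (simp add: F_def[abs_def])
    qed
    define p where "p t = y + t *\<^sub>R (w - y)" for t
    have br: "breg y (p t) = t * (F t - F 0)" if "0 \<le> t" "t \<le> 1" for t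
      using breg_split(1)[OF step(2) that refl] by (simp add: F_def p_def)
    have "\<exists>t\<ge>0. t \<le> 1 \<and> r + sqrt (t * (F t - F 0)) = s"
    proof (rule IVT')
      show "r + sqrt (0 * (F 0 - F 0)) \<le> s" using 3 by simp
      show "s \<le> r + sqrt (1 * (F 1 - F 0))" using 3 by (simp add: F_def breg_def)
      show "continuous_on {0..1} (\<lambda>t. r + sqrt (t * (F t - F 0)))"
        by (intro continuous_intros contF)
    qed simp
    then obtain t where t: "0 \<le> t" "t \<le> 1" "r + sqrt (breg y (p t)) = s" using br by auto
    have "p t \<in> closed_segment y w" unfolding p_def using t by (intro in_closed_segmentI)
    then have seg: "closed_segment y (p t) \<subseteq> N" "closed_segment (p t) w \<subseteq> N"
      using closed_segment_split[of "p t" y w] step(2) by auto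
    have "reach z s (p t)" using t(3) by (intro reach.step[OF step(1) seg(1)]) simp
    moreover have "reach (p t) (r' - s) w"
      using sqrt_breg_split[OF step(2) t(1,2) p_def[of t]] t(3) step(3)
      by (intro reach_segment[OF seg(2)]) linarith
    ultimately show ?thesis by blast
  qed
qed

lemma reach_cball:
  assumes "cball z \<rho> \<subseteq> N" "0 < L" and L: "\<And>x a. x \<in> cball z \<rho> \<Longrightarrow> g x a a \<le> L * (norm a)\<^sup>2"
    and y: "norm (y - z) \<le> d" "d \<le> \<rho>"
  shows "reach z (sqrt L * d) y"
proof (rule reach_segment)
  have d: "0 \<le> d" using y(1) norm_ge_zero[of "y - z"] by linarith
  have sub: "closed_segment z y \<subseteq> cball z \<rho>"
    using y d by (intro closed_segment_subset) (auto simp: dist_norm norm_minus_commute)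
  then show seg: "closed_segment z y \<subseteq> N" using assms(1) by blast
  obtain t where t: "0 < t" "t < 1" "breg z y = g (z + t *\<^sub>R (y - z)) (y - z) (y - z)"
    by (rule breg_MVT[OF seg])
  have "breg z y \<le> L * (norm (y - z))\<^sup>2" using t L sub in_closed_segmentI[of t z y] by auto
  also have "\<dots> \<le> L * d\<^sup>2" using y \<open>0 < L\<close> by (intro mult_left_mono power_mono) auto
  finally have "sqrt (breg z y) \<le> sqrt (L * d\<^sup>2)" by simp
  then show "sqrt (breg z y) \<le> sqrt L * d" using d by (simp add: real_sqrt_mult)
qed

lemma reach_near:
  assumes "z \<in> N" "0 < e"
  obtains d where "0 < d" "\<And>y. y \<in> ball z d \<Longrightarrow> reach z e y"
proof -
  obtain d0 where d0: "0 < d0" "cball z d0 \<subseteq> N" using open_N assms(1) open_contains_cball by blast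
  obtain l L where L: "0 < L" "\<And>x a. x \<in> cball z d0 \<Longrightarrow> g x a a \<le> L * (norm a)\<^sup>2"
    using g_bounds[OF compact_cball d0(2)] by metis
  define d where "d = min d0 (e / sqrt L)"
  have "0 < d" using d0 L assms by (simp add: d_def)
  moreover have "reach z e y" if y: "y \<in> ball z d" for y
  proof -
    have "reach z (sqrt L * d) y"
      using y by (intro reach_cball[OF d0(2) L]) (auto simp: d_def dist_norm norm_minus_commute)
    moreover have "sqrt L * d \<le> sqrt L * (e / sqrt L)" using L(1) by (intro mult_left_mono) (auto simp: d_def)
    ultimately show ?thesis using L(1) by (auto elim: reach_mono)
  qed
  ultimately show ?thesis using that by blast
qed

lemma segment_euclidean:
  assumes "\<And>x a. x \<in> closed_segment y w \<Longrightarrow> l\<^sup>2 * (norm a)\<^sup>2 \<le> g x a a" "0 < l" "closed_segment y w \<subseteq> N"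
  shows "norm (w - y) \<le> sqrt (breg y w) / l"
proof -
  obtain t where t: "0 < t" "t < 1" "breg y w = g (y + t *\<^sub>R (w - y)) (w - y) (w - y)"
    by (rule breg_MVT[OF assms(3)])
  have "(l * norm (w - y))\<^sup>2 \<le> breg y w" using assms(1)[OF in_closed_segmentI] t by (auto simp: power_mult_distrib)
  then have "l * norm (w - y) \<le> sqrt (breg y w)" by (rule real_le_rsqrt)
  then show ?thesis using assms(2) by (simp add: field_simps)
qed

text \<open>The lower bound on the metric holds in the larger ball only, so it must be shown along
  the way that the polygon stays there; \<open>s < l * d\<close> excludes an exit.\<close>

lemma reach_local:
  assumes z: "cball z (2 * d) \<subseteq> N" "0 < d" "0 < l"
    and l: "\<And>x a. x \<in> cball z (2 * d) \<Longrightarrow> l\<^sup>2 * (norm a)\<^sup>2 \<le> g x a a"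
    and y0: "y0 \<in> ball z d"
  shows "reach y0 s y \<Longrightarrow> s < l * d \<Longrightarrow> norm (y - y0) \<le> s / l"
proof (induction rule: reach.induct)
  case (start r)
  then show ?case using assms by simp
next
  case (step r y w r')
  have sub: "cball y0 d \<subseteq> cball z (2 * d)"
  proof
    fix x assume "x \<in> cball y0 d"
    then show "x \<in> cball z (2 * d)" using y0 dist_triangle[of z x y0] by (auto simp: dist_commute)
  qed
  have b0: "0 \<le> sqrt (breg y w)" using breg_nonneg[OF step(2)] by simp
  have y: "norm (y - y0) \<le> r / l" using step b0 by auto
  have r': "r / l + sqrt (breg y w) / l \<le> r' / l"
    using step(3) z(3) by (simp add: add_divide_distrib[symmetric] divide_right_mono)
  have rd: "r' / l < d" using step.prems z(3) by (simp add: field_simps)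
  have rb: "0 \<le> sqrt (breg y w) / l" using b0 z(3) by simp
  have yd: "norm (y - y0) < d" using y r' rd rb by linarith
  define p where "p t = y + t *\<^sub>R (w - y)" for t
  have key: "norm (p t - y) \<le> sqrt (breg y w) / l" if t: "0 \<le> t" "t \<le> 1" "norm (p t - y0) \<le> d" for t
  proof -
    have pin: "p t \<in> closed_segment y w" unfolding p_def using t by (intro in_closed_segmentI)
    then have sN: "closed_segment y (p t) \<subseteq> N" "closed_segment (p t) w \<subseteq> N"
      using closed_segment_split[of "p t" y w] step(2) by auto
    have "closed_segment y (p t) \<subseteq> cball y0 d"
      using yd t(3) by (intro closed_segment_subset) (auto simp: dist_norm norm_minus_commute)
    then have "norm (p t - y) \<le> sqrt (breg y (p t)) / l"
      using sub l by (intro segment_euclidean z sN) blast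
    also have "sqrt (breg y (p t)) \<le> sqrt (breg y w)"
      using sqrt_breg_split[OF step(2) t(1,2) p_def[of t]] real_sqrt_ge_zero[OF breg_nonneg[OF sN(2)]] by linarith
    finally show ?thesis using z(3) by (simp add: divide_right_mono)
  qed
  have tri: "norm (p t - y0) \<le> norm (p t - y) + norm (y - y0)" for t
    using norm_triangle_ineq[of "p t - y" "y - y0"] by simp
  have "norm (w - y0) \<le> d"
  proof (rule ccontr)
    assume far: "\<not> norm (w - y0) \<le> d"
    \<comment> \<open>A segment ending too far away meets the sphere of radius \<open>d\<close>
      about \<open>y0\<close>, but there \<open>key\<close> gives a distance below
      \<open>d\<close>.\<close>
    have "\<exists>t\<ge>0. t \<le> 1 \<and> norm (p t - y0) = d"
      by (rule IVT') (use yd far in \<open>auto simp: p_def intro!: continuous_intros\<close>)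
    then obtain t where t: "0 \<le> t" "t \<le> 1" "norm (p t - y0) = d" by blast
    then show False using key[of t] tri[of t] y r' rd by linarith
  qed
  then have "norm (w - y) \<le> sqrt (breg y w) / l" using key[of 1] by (simp add: p_def)
  then show ?case using tri[of 1] y r' by (simp add: p_def)
qed

section \<open>The Hopf-Rinow theorem for polygonal balls\<close>

definition good :: "real ^ 'n \<Rightarrow> real \<Rightarrow> bool" where
  "good z r \<longleftrightarrow> (\<exists>C. compact C \<and> C \<subseteq> N \<and> (\<forall>y. reach z r y \<longrightarrow> y \<in> C))"

lemma good_mono: "good z r \<Longrightarrow> s \<le> r \<Longrightarrow> good z s"
  unfolding good_def by (meson reach_mono)

lemma local_lower_bound:
  assumes "z \<in> N"
  obtains d l where "0 < d" "0 < l" "cball z (2 * d) \<subseteq> N"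
    "\<And>x a. x \<in> cball z (2 * d) \<Longrightarrow> l\<^sup>2 * (norm a)\<^sup>2 \<le> g x a a"
proof -
  obtain d0 where d0: "0 < d0" "cball z d0 \<subseteq> N" using open_N assms(1) open_contains_cball by blast
  obtain l L where l: "0 < l" "\<And>x a. x \<in> cball z d0 \<Longrightarrow> l * (norm a)\<^sup>2 \<le> g x a a"
    using g_bounds[OF compact_cball d0(2)] by metis
  show ?thesis by (rule that[of "d0 / 2" "sqrt l"]) (use d0 l in auto)
qed

text \<open>One radius serves all centres near \<open>z\<close>; \<open>hopf_rinow\<close> plays it
  against bad radii tending to 0 at converging centres.\<close>

lemma good_near:
  assumes "z \<in> N"
  obtains d e where "0 < d" "0 < e" "\<And>y. y \<in> ball z d \<Longrightarrow> good y e"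
proof -
  obtain d l where dl: "0 < d" "0 < l" "cball z (2 * d) \<subseteq> N"
    "\<And>x a. x \<in> cball z (2 * d) \<Longrightarrow> l\<^sup>2 * (norm a)\<^sup>2 \<le> g x a a" using local_lower_bound[OF assms] by blast
  have "good y (l * d / 2)" if y: "y \<in> ball z d" for y
    unfolding good_def
  proof (intro exI conjI allI impI)
    fix w assume "reach y (l * d / 2) w"
    then have "norm (w - y) \<le> l * d / 2 / l"
      using dl y by (intro reach_local[of z d l y]) auto
    then have "dist w y \<le> d / 2" using dl by (simp add: dist_norm)
    then show "w \<in> cball z (2 * d)" using y dist_triangle[of z w y] dl(1) by (auto simp: dist_commute)
  qed (use dl in auto)
  then show ?thesis using that[of d "l * d / 2"] dl by simp
qed

text \<open>Iterated in \<open>hopf_rinow\<close>, this produces a Cauchy sequence without a limit.\<close>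

lemma bad_step:
  assumes "z \<in> N" "0 < r" "\<not> good z r"
  shows "\<exists>z'. reach z r z' \<and> \<not> good z' (r / 2)"
proof (rule ccontr)
  assume "\<not> ?thesis"
  then have all: "good z' (r / 2)" if "reach z r z'" for z' using that by blast
  have extend: "good z (s + r / 4)" if s: "0 \<le> s" "s \<le> r" "good z s" for s
  proof -
    obtain C where C: "compact C" "C \<subseteq> N" "\<And>y. reach z s y \<Longrightarrow> y \<in> C"
      using s(3) unfolding good_def by blast
    \<comment> \<open>Prepares a finite net: two points in a ball of the cover are joined with
      length \<open>r / 8 + r / 8\<close>, so a polygon of length \<open>r / 4\<close> from one
      extends to one of length \<open>r / 2\<close> from the other, the radius covered by
      \<open>all\<close>.\<close>
    have "\<forall>c\<in>C. \<exists>d>0. \<forall>y\<in>ball c d. reach c (r / 8) y"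
    proof
      fix c assume "c \<in> C"
      then show "\<exists>d>0. \<forall>y\<in>ball c d. reach c (r / 8) y"
        using reach_near[of c "r / 8"] C(2) assms(2) by (metis divide_pos_pos subsetD zero_less_numeral)
    qed
    then obtain d where d: "\<And>c. c \<in> C \<Longrightarrow> 0 < d c" "\<And>c y. c \<in> C \<Longrightarrow> y \<in> ball c (d c) \<Longrightarrow> reach c (r / 8) y"
      by metis
    obtain C' where C': "C' \<subseteq> C" "finite C'" "C \<subseteq> (\<Union>c\<in>C'. ball c (d c))"
      by (rule compactE_image[OF C(1), of C "\<lambda>c. ball c (d c)"]) (use d(1) in auto)
    have "\<forall>c\<in>C'. \<exists>K. compact K \<and> K \<subseteq> N \<and>
        (\<forall>w y. w \<in> ball c (d c) \<longrightarrow> reach z s w \<longrightarrow> reach w (r / 4) y \<longrightarrow> y \<in> K)"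
    proof
      fix c assume c: "c \<in> C'"
      show "\<exists>K. compact K \<and> K \<subseteq> N \<and>
        (\<forall>w y. w \<in> ball c (d c) \<longrightarrow> reach z s w \<longrightarrow> reach w (r / 4) y \<longrightarrow> y \<in> K)"
      proof (cases "\<exists>w\<in>ball c (d c). reach z s w")
        case True
        then obtain w0 where w0: "w0 \<in> ball c (d c)" "reach z s w0" by blast
        have "good w0 (r / 2)" using all reach_mono[OF w0(2) s(2)] by blast
        then obtain K where K: "compact K" "K \<subseteq> N" "\<And>y. reach w0 (r / 2) y \<Longrightarrow> y \<in> K"
          unfolding good_def by blast
        have "y \<in> K" if "w \<in> ball c (d c)" "reach w (r / 4) y" for w y
        proof -
          have "reach c (r / 8) w0" "reach c (r / 8) w" using d(2) c C'(1) w0(1) that(1) by blast+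
          from reach_trans[OF reach_trans[OF that(2) this(2)] reach_sym[OF this(1)]]
          show ?thesis using K(3) by simp
        qed
        then show ?thesis using K by blast
      qed (intro exI[of _ "{}"]; auto)
    qed
    then obtain K where K: "\<And>c. c \<in> C' \<Longrightarrow> compact (K c)" "\<And>c. c \<in> C' \<Longrightarrow> K c \<subseteq> N"
      "\<And>c w y. c \<in> C' \<Longrightarrow> w \<in> ball c (d c) \<Longrightarrow> reach z s w \<Longrightarrow> reach w (r / 4) y \<Longrightarrow> y \<in> K c"
      by metis
    show ?thesis
      unfolding good_def
    proof (intro exI conjI allI impI)
      show "compact (\<Union>c\<in>C'. K c)" using C'(2) K(1) by (intro compact_UN) auto
      show "(\<Union>c\<in>C'. K c) \<subseteq> N" using K(2) by blast
      fix y assume "reach z (s + r / 4) y"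
      then obtain w where w: "reach z s w" "reach w (r / 4) y"
        using reach_intermediate[of z "s + r / 4" y s] s(1) assms(2) by auto
      then obtain c where "c \<in> C'" "w \<in> ball c (d c)" using C(3) C'(3) by blast
      then show "y \<in> (\<Union>c\<in>C'. K c)" using K(3) w by blast
    qed
  qed
  \<comment> \<open>Good radii cannot stop short of \<open>r\<close>, since each can be enlarged by
    the fixed amount \<open>r / 4\<close>.\<close>
  define R where "R = {s. 0 \<le> s \<and> s \<le> r \<and> good z s}"
  obtain d e where "0 < d" "0 < e" "\<And>y. y \<in> ball z d \<Longrightarrow> good y e" using good_near[OF assms(1)] by blast
  then have "good z 0" using good_mono[of z e 0] by auto
  then have "0 \<in> R" using assms(2) by (simp add: R_def)
  then have "R \<noteq> {}" by blast
  have bdd: "bdd_above R" by (auto simp: R_def bdd_above_def)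
  obtain s where s: "s \<in> R" "Sup R - r / 8 < s"
    using less_cSupD[OF \<open>R \<noteq> {}\<close>, of "Sup R - r / 8"] assms(2) by auto
  have "good z (s + r / 4)" using extend s(1) by (auto simp: R_def)
  show False
  proof (cases "s + r / 4 \<le> r")
    case True
    then have "s + r / 4 \<in> R" using \<open>good z (s + r / 4)\<close> s(1) assms(2) by (auto simp: R_def)
    then have "s + r / 4 \<le> Sup R" using bdd by (rule cSup_upper)
    then show False using s(2) assms(2) by linarith
  next
    case False
    then show False using \<open>good z (s + r / 4)\<close> good_mono assms(3) by force
  qed
qed

text \<open>A curve to \<open>z\<close> starting outside the open ball of radius \<open>d\<close>
  has a last time \<open>t0\<close> outside it. Afterwards the metric dominates
  \<open>l\<^sup>2\<close> times the Euclidean one, so the rest of the curve has length at least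
  \<open>l * d\<close>.\<close>

lemma riemannian_dist_lower:
  assumes d: "0 < d" "0 < l" "cball z d \<subseteq> N"
    and l: "\<And>x a. x \<in> cball z d \<Longrightarrow> l\<^sup>2 * (norm a)\<^sup>2 \<le> g x a a"
    and small: "riemannian_dist N (hessian u) y z < ennreal (l * d)"
  shows "norm (y - z) < d"
proof (rule ccontr)
  assume far: "\<not> norm (y - z) < d"
  obtain \<gamma> where \<gamma>: "valid_path \<gamma>" "path_image \<gamma> \<subseteq> N" "\<gamma> 0 = y" "\<gamma> 1 = z"
    "riemannian_length (hessian u) \<gamma> < ennreal (l * d)"
    using small unfolding riemannian_dist_def INF_less_iff by (auto simp: pathstart_def pathfinish_def)
  have cont: "continuous_on {0..1} \<gamma>" using \<gamma>(1) by (simp add: valid_path_def piecewise_C1_differentiable_on_def)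
  obtain S where S: "finite S" "\<And>t. t \<in> {0..1} - S \<Longrightarrow> \<gamma> differentiable at t"
    "continuous_on ({0..1} - S) (\<lambda>t. vector_derivative \<gamma> (at t))"
    using \<gamma>(1) by (auto simp: valid_path_def piecewise_C1_differentiable_on_def C1_differentiable_on_eq)
  define E where "E = {t \<in> {0..1}. d \<le> norm (\<gamma> t - z)}"
  have "E = {0..1} \<inter> (\<lambda>t. norm (\<gamma> t - z)) -` {d..}" by (auto simp: E_def)
  moreover have "continuous_on {0..1} (\<lambda>t. norm (\<gamma> t - z))" by (intro continuous_intros cont)
  ultimately have "closed E" by (simp add: continuous_closed_preimage)
  have "0 \<in> E" using far \<gamma>(3) by (simp add: E_def)
  have bdd: "bdd_above E" by (auto simp: E_def bdd_above_def intro: exI[of _ 1])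
  define t0 where "t0 = Sup E"
  have "t0 \<in> E" unfolding t0_def using \<open>closed E\<close> \<open>0 \<in> E\<close> bdd by (intro closed_contains_Sup) auto
  then have t0: "0 \<le> t0" "t0 \<le> 1" "d \<le> norm (\<gamma> t0 - z)" by (auto simp: E_def)
  have after: "norm (\<gamma> t - z) < d" if "t0 < t" "t \<le> 1" for t
  proof (rule ccontr)
    assume "\<not> ?thesis"
    then have "t \<in> E" using that t0 by (simp add: E_def)
    then have "t \<le> t0" unfolding t0_def using bdd by (rule cSup_upper)
    then show False using that by simp
  qed
  define T where "T = {t0<..1} - S"
  \<comment> \<open>On \<open>T\<close> the curve is continuously differentiable, so extending the
    speed by 0 gives a Borel function; a finite Lebesgue integral then makes it gauge
    integrable.\<close>
  define \<phi> where "\<phi> t = (if t \<in> T then speed (hessian u) \<gamma> t else 0)" for t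
  have TN: "t \<in> {0..1} \<Longrightarrow> \<gamma> t \<in> N" for t using \<gamma>(2) by (auto simp: path_image_def)
  have sp: "speed (hessian u) \<gamma> t = sqrt (g (\<gamma> t) (vector_derivative \<gamma> (at t)) (vector_derivative \<gamma> (at t)))"
    if "t \<in> {0..1}" for t using g_hessian[OF TN[OF that]] by (simp add: speed_def)
  have T01: "T \<subseteq> {0..1} - S" using t0 by (auto simp: T_def)
  have "continuous_on T (\<lambda>t. sqrt (g (\<gamma> t) (vector_derivative \<gamma> (at t)) (vector_derivative \<gamma> (at t))))"
    using T01 TN
    by (intro continuous_intros continuous_on_g continuous_on_subset[OF S(3)] continuous_on_subset[OF cont]) auto
  then have "continuous_on T (speed (hessian u) \<gamma>)"
    by (rule continuous_on_eq) (use T01 sp in auto)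
  moreover have "T \<in> sets borel"
    using borel_closed[OF finite_imp_closed[OF S(1)]] by (simp add: T_def sets.Diff)
  ultimately have meas: "\<phi> \<in> borel_measurable borel"
    unfolding \<phi>_def by (intro borel_measurable_continuous_on_if continuous_on_const)
  have \<phi>0: "0 \<le> \<phi> t" for t
    using T01 sp g_nonneg TN by (auto simp: \<phi>_def intro!: real_sqrt_ge_zero)
  have "(\<integral>\<^sup>+t. ennreal (\<phi> t) \<partial>lborel) \<le> riemannian_length (hessian u) \<gamma>"
    unfolding riemannian_length_def speed_def[symmetric] using T01
    by (intro nn_integral_mono) (auto simp: \<phi>_def indicator_def)
  then have less: "(\<integral>\<^sup>+t. ennreal (\<phi> t) \<partial>lborel) < ennreal (l * d)" using \<gamma>(5) by (rule le_less_trans)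
  then obtain r where r: "0 \<le> r" "(\<integral>\<^sup>+t. ennreal (\<phi> t) \<partial>lborel) = ennreal r"
    by (cases "\<integral>\<^sup>+t. ennreal (\<phi> t) \<partial>lborel") auto
  have "r < l * d" using less r by (simp add: ennreal_less_iff)
  have "(\<phi> has_integral r) UNIV" by (rule nn_integral_has_integral[OF meas \<phi>0 r(2,1)])
  moreover have "(\<lambda>t. if t \<in> {t0..1} then \<phi> t else 0) = \<phi>" by (auto simp: \<phi>_def T_def fun_eq_iff)
  ultimately have I\<phi>: "(\<phi> has_integral r) {t0..1}"
    using has_integral_restrict_UNIV[of "{t0..1}" \<phi> r] by simp
  \<comment> \<open>Pairing the velocity with the unit vector towards \<open>z\<close> gives a
    scalar integral that the fundamental theorem of calculus evaluates to the distance from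
    \<open>\<gamma> t0\<close> to \<open>z\<close>.\<close>
  define w where "w = (1 / norm (z - \<gamma> t0)) *\<^sub>R (z - \<gamma> t0)"
  have nz: "norm (z - \<gamma> t0) > 0" using t0(3) d(1) norm_minus_commute[of z "\<gamma> t0"] by linarith
  then have nw: "norm w = 1" by (simp add: w_def)
  have "((\<lambda>t. vector_derivative \<gamma> (at t)) has_integral (\<gamma> 1 - \<gamma> t0)) {t0..1}"
    using t0 S(2) cont
    by (intro fundamental_theorem_of_calculus_interior_strong[OF S(1)])
      (auto simp: vector_derivative_works[symmetric] intro: continuous_on_subset)
  from has_integral_linear[OF this bounded_linear_inner_left[of w]]
  have "((\<lambda>t. l * (vector_derivative \<gamma> (at t) \<bullet> w)) has_integral l * ((\<gamma> 1 - \<gamma> t0) \<bullet> w)) {t0..1}"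
    by (intro has_integral_mult_right) (simp add: o_def)
  then have "((\<lambda>t. if t \<in> T then l * (vector_derivative \<gamma> (at t) \<bullet> w) else 0) has_integral l * ((\<gamma> 1 - \<gamma> t0) \<bullet> w)) {t0..1}"
    by (rule has_integral_spike_finite[rotated 2, of _ _ _ "insert t0 S"]) (use S(1) in \<open>auto simp: T_def\<close>)
  then have "l * ((\<gamma> 1 - \<gamma> t0) \<bullet> w) \<le> r"
  proof (rule has_integral_le[OF _ I\<phi>])
    fix t assume "t \<in> {t0..1}"
    show "(if t \<in> T then l * (vector_derivative \<gamma> (at t) \<bullet> w) else 0) \<le> \<phi> t"
    proof (cases "t \<in> T")
      case True
      define v where "v = vector_derivative \<gamma> (at t)"
      have "norm (\<gamma> t - z) < d" using True after by (auto simp: T_def)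
      then have "\<gamma> t \<in> cball z d" by (simp add: dist_norm norm_minus_commute)
      then have "(l * norm v)\<^sup>2 \<le> g (\<gamma> t) v v" using l by (simp add: power_mult_distrib)
      then have "l * norm v \<le> sqrt (g (\<gamma> t) v v)" by (rule real_le_rsqrt)
      moreover have "v \<bullet> w \<le> norm v" using norm_cauchy_schwarz[of v w] nw by simp
      ultimately have "l * (v \<bullet> w) \<le> sqrt (g (\<gamma> t) v v)"
        using d(2) by (meson mult_left_mono less_imp_le order_trans)
      then show ?thesis using True T01 sp by (auto simp: \<phi>_def v_def)
    qed (simp add: \<phi>_def)
  qed
  moreover have "(\<gamma> 1 - \<gamma> t0) \<bullet> w = norm (z - \<gamma> t0)"
    using nz \<gamma>(4) by (simp add: w_def power2_norm_eq_inner[symmetric] power2_eq_square)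
  moreover have "l * d \<le> l * norm (z - \<gamma> t0)" using t0(3) d(2) by (simp add: norm_minus_commute)
  ultimately show False using \<open>r < l * d\<close> by simp
qed

text \<open>Turns the limit supplied by completeness into one in the Euclidean topology.\<close>

lemma riemannian_limit_imp_limit:
  assumes "z \<in> N" "(\<lambda>k. riemannian_dist N (hessian u) (X k) z) \<longlonglongrightarrow> 0"
  shows "X \<longlonglongrightarrow> z"
  unfolding tendsto_iff
proof (intro allI impI)
  fix e :: real assume "0 < e"
  obtain d l where dl: "0 < d" "0 < l" "cball z (2 * d) \<subseteq> N"
    "\<And>x a. x \<in> cball z (2 * d) \<Longrightarrow> l\<^sup>2 * (norm a)\<^sup>2 \<le> g x a a" using local_lower_bound[OF assms(1)] by blast
  define d' where "d' = min d e"
  have d': "0 < d'" "cball z d' \<subseteq> cball z (2 * d)" using dl \<open>0 < e\<close> by (auto simp: d'_def)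
  have "\<forall>\<^sub>F k in sequentially. riemannian_dist N (hessian u) (X k) z < ennreal (l * d')"
    using assms(2) d'(1) dl(2) by (intro order_tendstoD(2)) (auto simp: ennreal_zero_less_mult_iff)
  then show "\<forall>\<^sub>F k in sequentially. dist (X k) z < e"
  proof eventually_elim
    case (elim k)
    then have "norm (X k - z) < d'"
      using dl d' by (intro riemannian_dist_lower[of d' l]) auto
    then show ?case by (simp add: dist_norm d'_def)
  qed
qed

text \<open>Bad centres \<open>X k\<close> of radius \<open>R / 2 ^ k\<close> are Cauchy by the
  geometric series. Near a limit some fixed radius would be good, contrary to the radii tending to
  0.\<close>

theorem hopf_rinow:
  assumes "riemannian_complete N (hessian u)" "z \<in> N"
  shows "good z r"
proof (rule ccontr)
  assume bad: "\<not> good z r"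
  \<comment> \<open>\<open>bad_step\<close> asks for a positive radius.\<close>
  define R where "R = max r 1"
  have R: "0 < R" "\<not> good z R" using bad good_mono[of z R r] by (auto simp: R_def)
  have "\<exists>X. \<forall>k. (X k \<in> N \<and> \<not> good (X k) (R / 2 ^ k)) \<and> reach (X k) (R / 2 ^ k) (X (Suc k))"
  proof (rule dependent_nat_choice)
    show "\<exists>x. x \<in> N \<and> \<not> good x (R / 2 ^ 0)" using R assms(2) by auto
    fix x k assume "x \<in> N \<and> \<not> good x (R / 2 ^ k)"
    then obtain z' where "reach x (R / 2 ^ k) z'" "\<not> good z' (R / 2 ^ k / 2)"
      using bad_step[of x "R / 2 ^ k"] R by auto
    then show "\<exists>y. (y \<in> N \<and> \<not> good y (R / 2 ^ Suc k)) \<and> reach x (R / 2 ^ k) y"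
      using reach_in by (intro exI[of _ z']) (auto simp: mult.commute)
  qed
  then obtain X where X: "\<And>k. X k \<in> N" "\<And>k. \<not> good (X k) (R / 2 ^ k)"
    "\<And>k. reach (X k) (R / 2 ^ k) (X (Suc k))" by blast
  have tail: "reach (X m) (2 * R / 2 ^ m - 2 * R / 2 ^ (m + j)) (X (m + j))" for m j
  proof (induction j)
    case 0
    then show ?case using X(1) by (simp add: reach.start)
  next
    case (Suc j)
    have eq: "2 * R / 2 ^ m - 2 * R / 2 ^ (m + j) + R / 2 ^ (m + j) = 2 * R / 2 ^ m - 2 * R / 2 ^ (m + Suc j)"
      by (simp add: field_simps)
    show ?case using reach_trans[OF X(3)[of "m + j"] Suc.IH] unfolding eq by simp
  qed
  have close: "riemannian_dist N (hessian u) (X m) (X k) \<le> ennreal (2 * R / 2 ^ M)" if "M \<le> m" "M \<le> k" for m k M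
  proof -
    have "reach (X p) (2 * R / 2 ^ M) (X q)" if "M \<le> p" "p \<le> q" for p q
    proof -
      have "2 * R / 2 ^ p - 2 * R / 2 ^ (p + (q - p)) \<le> 2 * R / 2 ^ p" using R by simp
      also have "\<dots> \<le> 2 * R / 2 ^ M" using R that by (intro divide_left_mono power_increasing) auto
      finally show ?thesis using reach_mono[OF tail[of p "q - p"]] that by simp
    qed
    then have "reach (X m) (2 * R / 2 ^ M) (X k)" using that reach_sym nat_le_linear by metis
    then show ?thesis by (rule reach_dist)
  qed
  have "\<exists>M. \<forall>m\<ge>M. \<forall>k\<ge>M. riemannian_dist N (hessian u) (X m) (X k) < e" if "0 < e" for e :: ennreal
  proof -
    have "(\<lambda>M. 2 * R / 2 ^ M) \<longlonglongrightarrow> 0"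
      using tendsto_mult_right_zero[OF LIMSEQ_inverse_realpow_zero[of 2], of "2 * R"] by (simp add: divide_inverse)
    then have "(\<lambda>M. ennreal (2 * R / 2 ^ M)) \<longlonglongrightarrow> 0" using tendsto_ennrealI by fastforce
    then have "\<forall>\<^sub>F M in sequentially. ennreal (2 * R / 2 ^ M) < e" using that by (rule order_tendstoD(2))
    then obtain M where "ennreal (2 * R / 2 ^ M) < e" using eventually_happens by force
    then show ?thesis using close by (meson le_less_trans)
  qed
  then obtain x where x: "x \<in> N" "(\<lambda>k. riemannian_dist N (hessian u) (X k) x) \<longlonglongrightarrow> 0"
    using assms(1) X(1) unfolding riemannian_complete_def by blast
  have lim: "X \<longlonglongrightarrow> x" by (rule riemannian_limit_imp_limit[OF x])
  obtain d e where de: "0 < d" "0 < e" "\<And>y. y \<in> ball x d \<Longrightarrow> good y e" using good_near[OF x(1)] by blast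
  have "\<forall>\<^sub>F k in sequentially. dist (X k) x < d" using lim de(1) by (rule tendstoD)
  moreover have "(\<lambda>k. R / 2 ^ k) \<longlonglongrightarrow> 0"
    using tendsto_mult_right_zero[OF LIMSEQ_inverse_realpow_zero[of 2], of R] by (simp add: divide_inverse)
  then have "\<forall>\<^sub>F k in sequentially. R / 2 ^ k < e" using de(2) by (rule order_tendstoD(2))
  ultimately have "\<forall>\<^sub>F k in sequentially. False"
  proof eventually_elim
    case (elim k)
    then have "good (X k) e" using de(3) by (simp add: dist_commute)
    then show False using good_mono[of "X k" e "R / 2 ^ k"] elim X(2) by auto
  qed
  then show False by simp
qed

end


subsection \<open>Second-order jets and iterated directional derivatives\<close>

text \<open>Value, first and second derivative at 0, with \<open>f\<close> differentiable near 0 and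
  its derivative differentiable at 0. As a relation it is computed by composing rules, without
  naming the derivative function.\<close>

definition jet2 :: "(real \<Rightarrow> real) \<Rightarrow> real \<Rightarrow> real \<Rightarrow> real \<Rightarrow> bool" where
  "jet2 f a b c \<longleftrightarrow> f 0 = a \<and>
    (\<exists>f'. (\<forall>\<^sub>F t in nhds 0. (f has_real_derivative f' t) (at t)) \<and> f' 0 = b \<and>
      (f' has_real_derivative c) (at 0))"

lemma jet2I:
  assumes "f 0 = a" "\<forall>\<^sub>F t in nhds 0. (f has_real_derivative f' t) (at t)" "f' 0 = b"
    "(f' has_real_derivative c) (at 0)"
  shows "jet2 f a b c"
  using assms unfolding jet2_def by blast

lemma jet2E:
  assumes "jet2 f a b c"
  obtains f' where "f 0 = a" "\<forall>\<^sub>F t in nhds 0. (f has_real_derivative f' t) (at t)" "f' 0 = b"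
    "(f' has_real_derivative c) (at 0)" "(f has_real_derivative b) (at 0)"
proof -
  obtain f' where *: "f 0 = a" "\<forall>\<^sub>F t in nhds 0. (f has_real_derivative f' t) (at t)" "f' 0 = b"
    "(f' has_real_derivative c) (at 0)" using assms unfolding jet2_def by blast
  with eventually_nhds_x_imp_x[OF *(2)] show ?thesis using that by blast
qed

lemma jet2_const: "jet2 (\<lambda>t. k) k 0 0"
  by (rule jet2I[where f' = "\<lambda>t. 0"]) auto

lemma jet2_id: "jet2 (\<lambda>t. t) 0 1 0"
  by (rule jet2I[where f' = "\<lambda>t. 1"]) auto

lemma jet2_add:
  assumes "jet2 f a b c" "jet2 g a' b' c'"
  shows "jet2 (\<lambda>t. f t + g t) (a + a') (b + b') (c + c')"
proof -
  obtain f' where f: "f 0 = a" "\<forall>\<^sub>F t in nhds 0. (f has_real_derivative f' t) (at t)" "f' 0 = b"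
    "(f' has_real_derivative c) (at 0)" using assms(1) by (rule jet2E)
  obtain g' where g: "g 0 = a'" "\<forall>\<^sub>F t in nhds 0. (g has_real_derivative g' t) (at t)" "g' 0 = b'"
    "(g' has_real_derivative c') (at 0)" using assms(2) by (rule jet2E)
  show ?thesis
  proof (rule jet2I[where f' = "\<lambda>t. f' t + g' t"])
    show "\<forall>\<^sub>F t in nhds 0. ((\<lambda>t. f t + g t) has_real_derivative f' t + g' t) (at t)"
      using f(2) g(2) by eventually_elim (rule DERIV_add)
  qed (use f g in \<open>auto intro: DERIV_add\<close>)
qed

lemma jet2_mult:
  assumes "jet2 f a b c" "jet2 g a' b' c'"
  shows "jet2 (\<lambda>t. f t * g t) (a * a') (a * b' + b * a') (a * c' + 2 * b * b' + c * a')"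
proof -
  obtain f' where f: "f 0 = a" "\<forall>\<^sub>F t in nhds 0. (f has_real_derivative f' t) (at t)" "f' 0 = b"
    "(f' has_real_derivative c) (at 0)" "(f has_real_derivative b) (at 0)" using assms(1) by (rule jet2E)
  obtain g' where g: "g 0 = a'" "\<forall>\<^sub>F t in nhds 0. (g has_real_derivative g' t) (at t)" "g' 0 = b'"
    "(g' has_real_derivative c') (at 0)" "(g has_real_derivative b') (at 0)" using assms(2) by (rule jet2E)
  show ?thesis
  proof (rule jet2I[where f' = "\<lambda>t. f' t * g t + g' t * f t"])
    show "\<forall>\<^sub>F t in nhds 0. ((\<lambda>t. f t * g t) has_real_derivative f' t * g t + g' t * f t) (at t)"
      using f(2) g(2) by eventually_elim (rule DERIV_mult)
    have "((\<lambda>t. f' t * g t + g' t * f t) has_real_derivative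
        (c * g 0 + b' * f' 0) + (c' * f 0 + b * g' 0)) (at 0)"
      by (intro DERIV_add DERIV_mult f g)
    then show "((\<lambda>t. f' t * g t + g' t * f t) has_real_derivative a * c' + 2 * b * b' + c * a') (at 0)"
      by (simp add: f(1,3) g(1,3) algebra_simps)
  qed (use f g in \<open>auto simp: algebra_simps\<close>)
qed

lemma jet2_cmult: "jet2 f a b c \<Longrightarrow> jet2 (\<lambda>t. k * f t) (k * a) (k * b) (k * c)"
  using jet2_mult[OF jet2_const[of k]] by fastforce

lemma jet2_diff: "jet2 f a b c \<Longrightarrow> jet2 g a' b' c' \<Longrightarrow> jet2 (\<lambda>t. f t - g t) (a - a') (b - b') (c - c')"
  using jet2_add[OF _ jet2_cmult[of g a' b' c' "-1"]] by fastforce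

lemma jet2_sum:
  "(\<And>i. i \<in> I \<Longrightarrow> jet2 (f i) (a i) (b i) (c i)) \<Longrightarrow>
    jet2 (\<lambda>t. \<Sum>i\<in>I. f i t) (\<Sum>i\<in>I. a i) (\<Sum>i\<in>I. b i) (\<Sum>i\<in>I. c i)"
  by (induction I rule: infinite_finite_induct) (auto intro: jet2_const jet2_add)

lemma jet2_ln:
  assumes "jet2 f a b c" "0 < a"
  shows "jet2 (\<lambda>t. ln (f t)) (ln a) (b / a) (c / a - (b / a)\<^sup>2)"
proof -
  obtain f' where f: "f 0 = a" "\<forall>\<^sub>F t in nhds 0. (f has_real_derivative f' t) (at t)" "f' 0 = b"
    "(f' has_real_derivative c) (at 0)" "(f has_real_derivative b) (at 0)" using assms(1) by (rule jet2E)
  have "isCont f 0" using f(5) by (rule DERIV_isCont)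
  then have "(f \<longlongrightarrow> a) (nhds 0)" using f(1) by (simp add: isCont_def tendsto_nhds_iff)
  then have "\<forall>\<^sub>F t in nhds 0. 0 < f t" using assms(2) by (rule order_tendstoD(1))
  show ?thesis
  proof (rule jet2I[where f' = "\<lambda>t. f' t / f t"])
    show "\<forall>\<^sub>F t in nhds 0. ((\<lambda>t. ln (f t)) has_real_derivative f' t / f t) (at t)"
      using f(2) \<open>\<forall>\<^sub>F t in nhds 0. 0 < f t\<close>
    proof eventually_elim
      case (elim t)
      show ?case using DERIV_chain2[OF DERIV_ln[OF elim(2)] elim(1)] by (simp add: divide_inverse mult.commute)
    qed
    have "((\<lambda>t. f' t / f t) has_real_derivative (c * f 0 - f' 0 * b) / (f 0 * f 0)) (at 0)"
      by (rule DERIV_divide[OF f(4,5)]) (use f(1) assms(2) in simp)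
    moreover have "(c * f 0 - f' 0 * b) / (f 0 * f 0) = c / a - (b / a)\<^sup>2"
      using assms(2) by (simp add: f(1,3) power2_eq_square field_simps)
    ultimately show "((\<lambda>t. f' t / f t) has_real_derivative c / a - (b / a)\<^sup>2) (at 0)" by simp
  qed (use f in auto)
qed

lemma jet2_cong:
  assumes "\<forall>\<^sub>F t in nhds 0. f t = g t" "jet2 g a b c"
  shows "jet2 f a b c"
proof -
  obtain g' where g: "g 0 = a" "\<forall>\<^sub>F t in nhds 0. (g has_real_derivative g' t) (at t)" "g' 0 = b"
    "(g' has_real_derivative c) (at 0)" using assms(2) by (rule jet2E)
  have "\<forall>\<^sub>F t in nhds 0. (f has_real_derivative g' t) (at t)"
    using g(2) assms(1)[THEN iffD2[OF eventually_eventually]]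
  proof eventually_elim
    case (elim t)
    show ?case using DERIV_cong_ev[OF refl elim(2) refl, of "g' t"] elim(1) by simp
  qed
  then show ?thesis using g eventually_nhds_x_imp_x[OF assms(1)] by (intro jet2I) auto
qed

lemma jet2_continuous: "jet2 f a b c \<Longrightarrow> (f \<longlongrightarrow> a) (nhds 0)"
proof -
  assume "jet2 f a b c"
  then obtain f' where "f 0 = a" "(f has_real_derivative b) (at 0)" by (rule jet2E)
  then show ?thesis using DERIV_isCont[of f b 0] by (simp add: isCont_def tendsto_nhds_iff)
qed

text \<open>If \<open>c\<close> were positive, the derivative, zero at 0, would be positive just to
  the right, and the mean value theorem would give a larger value there.\<close>

lemma jet2_max:
  assumes "jet2 f a b c" "\<forall>\<^sub>F t in nhds 0. f t \<le> f 0"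
  shows "b = 0" "c \<le> 0"
proof -
  obtain f' where f: "\<forall>\<^sub>F t in nhds 0. (f has_real_derivative f' t) (at t)" "f' 0 = b"
    "(f' has_real_derivative c) (at 0)" "(f has_real_derivative b) (at 0)" using assms(1) by (rule jet2E)
  obtain d where d: "d > 0" "\<And>t. dist t 0 < d \<Longrightarrow> (f has_real_derivative f' t) (at t) \<and> f t \<le> f 0"
    using eventually_conj[OF f(1) assms(2)] unfolding eventually_nhds_metric by metis
  show b: "b = 0"
    by (rule DERIV_local_max[OF f(4) d(1)]) (use d(2) in \<open>auto simp: dist_real_def\<close>)
  show "c \<le> 0"
  proof (rule ccontr)
    assume "\<not> c \<le> 0"
    then obtain e where e: "e > 0" "\<And>h. 0 < h \<Longrightarrow> h < e \<Longrightarrow> f' 0 < f' (0 + h)"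
      using DERIV_pos_inc_right[OF f(3)] by auto
    define s where "s = min d e / 2"
    have s: "0 < s" "s < d" "s < e" using d(1) e(1) by (auto simp: s_def)
    have "\<exists>z>0. z < s \<and> f s - f 0 = (s - 0) * f' z"
      by (rule MVT2) (use s d(2) in \<open>auto simp: dist_real_def\<close>)
    then obtain z where z: "0 < z" "z < s" "f s - f 0 = s * f' z" by auto
    then have "0 < s * f' z" using e(2)[of z] s b f(2) by simp
    then show False using z(3) d(2)[of s] s by (auto simp: dist_real_def)
  qed
qed

section \<open>Iterated derivatives as symmetric multilinear forms\<close>

primrec iter_dird :: "(real ^ 'n) list \<Rightarrow> (real ^ 'n::finite \<Rightarrow> real) \<Rightarrow> real ^ 'n \<Rightarrow> real" where
  "iter_dird [] f = f"
| "iter_dird (a # as) f = dird a (iter_dird as f)"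

lemma smooth_iter_dird: "open S \<Longrightarrow> smooth_on S f \<Longrightarrow> smooth_on S (iter_dird as f)"
  by (induction as) (auto intro: smooth_on_dird)

lemma iter_dird_append: "iter_dird (as @ bs) f = iter_dird as (iter_dird bs f)"
  by (induction as) auto

lemma iter_dird_move_front:
  assumes "open S" "smooth_on S f" "x \<in> S"
  shows "iter_dird (bs @ a # cs) f x = iter_dird (a # bs @ cs) f x"
  using assms(3)
proof (induction bs arbitrary: x)
  case (Cons b bs)
  have "iter_dird ((b # bs) @ a # cs) f x = dird b (iter_dird (a # bs @ cs) f) x"
    using dird_cong_open[OF assms(1) Cons.prems Cons.IH, where w = b] by simp
  also have "\<dots> = iter_dird (a # (b # bs) @ cs) f x"
    using dird_commute[OF assms(1) smooth_iter_dird[OF assms(1,2)] Cons.prems] by simp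
  finally show ?case .
qed simp

lemma iter_dird_permute:
  assumes "open S" "smooth_on S f" "x \<in> S" "mset as = mset bs"
  shows "iter_dird as f x = iter_dird bs f x"
  using assms(3,4)
proof (induction as arbitrary: bs x)
  case (Cons a as)
  have "a \<in> set bs" using Cons.prems(2) by (metis list.set_intros(1) mset_eq_setD)
  then obtain ps qs where bs: "bs = ps @ a # qs" by (meson split_list)
  then have "mset as = mset (ps @ qs)" using Cons.prems(2) by simp
  then have "iter_dird as f y = iter_dird (ps @ qs) f y" if "y \<in> S" for y using Cons.IH that by blast
  from dird_cong_open[OF assms(1) Cons.prems(1) this, where w = a]
  have "iter_dird (a # as) f x = iter_dird (a # ps @ qs) f x" by simp
  then show ?case using iter_dird_move_front[OF assms(1,2) Cons.prems(1)] by (simp add: bs)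
qed simp

lemma linear_iter_dird:
  assumes "open S" "smooth_on S f" "x \<in> S"
  shows "linear (\<lambda>a. iter_dird (bs @ a # cs) f x)"
  using linear_dird[OF smooth_iter_dird[OF assms(1,2), of "bs @ cs"] assms(3)]
  by (simp add: iter_dird_move_front[OF assms])

text \<open>The directions vary with \<open>t\<close> too. One is expanded in coordinates; the
  induction hypothesis applies to \<open>dird (axis i 1) f\<close>, with the coordinate derivative
  innermost, and symmetry moves it to the front.\<close>

lemma continuous_on_iter_dird:
  assumes "open S" "smooth_on S f" "continuous_on K p" "p ` K \<subseteq> S"
    "\<And>h. h \<in> set hs \<Longrightarrow> continuous_on K h"
  shows "continuous_on K (\<lambda>t. iter_dird (map (\<lambda>h. h t) hs) f (p t))"
  using assms(2,5)
proof (induction hs arbitrary: f)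
  case Nil
  then show ?case using continuous_on_compose2[OF smooth_on_imp_continuous_on[OF Nil(1)] assms(3,4)] by simp
next
  case (Cons h hs)
  have "continuous_on K (\<lambda>t. h t $ i)" for i using Cons.prems by (intro continuous_on_component) auto
  then have "continuous_on K (\<lambda>t. \<Sum>i\<in>UNIV. h t $ i * iter_dird (map (\<lambda>h. h t) hs) (dird (axis i 1) f) (p t))"
    using Cons.prems by (intro continuous_on_sum continuous_on_mult Cons.IH smooth_on_dird assms(1)) auto
  then show ?case
  proof (rule continuous_on_eq)
    fix t assume "t \<in> K"
    then have pt: "p t \<in> S" using assms(4) by blast
    let ?as = "map (\<lambda>h. h t) hs"
    have "iter_dird ?as (dird (axis i 1) f) (p t) = iter_dird (axis i 1 # ?as) f (p t)" for i
      using iter_dird_move_front[OF assms(1) Cons.prems(1) pt, of ?as "axis i 1" "[]"]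
      by (simp add: iter_dird_append)
    then show "(\<Sum>i\<in>UNIV. h t $ i * iter_dird ?as (dird (axis i 1) f) (p t))
        = iter_dird (map (\<lambda>h. h t) (h # hs)) f (p t)"
      using dird_eq_sum[OF smooth_iter_dird[OF assms(1) Cons.prems(1)] pt, of "h t" ?as]
      by (simp add: partial_deriv_def dird_def)
  qed
qed

text \<open>Summed over a frame, with \<open>v = V i\<close> and \<open>w\<close> the
  \<open>drift\<close> defined below, the second-order entry becomes the generator \<open>L\<close>
  applied to \<open>f\<close>.\<close>

lemma jet2_parabola:
  assumes "open S" "smooth_on S f" "p \<in> S"
  shows "jet2 (\<lambda>t. f (p + t *\<^sub>R v + t\<^sup>2 *\<^sub>R w)) (f p) (dird v f p) (dird v (dird v f) p + 2 * dird w f p)"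
proof (rule jet2I)
  have "isCont (\<lambda>t. p + t *\<^sub>R v + t\<^sup>2 *\<^sub>R w) 0" by (intro continuous_intros)
  then have "\<forall>\<^sub>F t in nhds 0. p + t *\<^sub>R v + t\<^sup>2 *\<^sub>R w \<in> S"
    using assms(1,3) by (auto simp: continuous_at eventually_nhds_conv_at intro!: topological_tendstoD)
  then show "\<forall>\<^sub>F t in nhds 0. ((\<lambda>t. f (p + t *\<^sub>R v + t\<^sup>2 *\<^sub>R w)) has_real_derivative
      dird v f (p + t *\<^sub>R v + t\<^sup>2 *\<^sub>R w) + 2 * t * dird w f (p + t *\<^sub>R v + t\<^sup>2 *\<^sub>R w)) (at t)"
    by eventually_elim (rule parabola_derivative[OF assms(2)])
qed (use parabola_second_derivative[OF assms] in auto)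


subsection \<open>Tensor identities for the soliton Monge--Ampere equation\<close>

context hessian_domain
begin

definition D :: "(real ^ 'n) list \<Rightarrow> real ^ 'n \<Rightarrow> real" where
  "D as x = iter_dird as u x"

lemma D_Cons: "D (a # as) x = dird a (D as) x"
  unfolding D_def[abs_def] by simp

lemma g_eq_D: "g x a b = D [a, b] x"
  by (simp add: g_def D_def)

lemma smooth_D: "smooth_on N (D as)"
  unfolding D_def[abs_def] by (rule smooth_iter_dird[OF open_N smooth_u])

lemma D_permute: "x \<in> N \<Longrightarrow> mset as = mset bs \<Longrightarrow> D as x = D bs x"
  unfolding D_def by (rule iter_dird_permute[OF open_N smooth_u])

lemma linear_D: "x \<in> N \<Longrightarrow> linear (\<lambda>a. D (bs @ a # cs) x)"
  unfolding D_def by (rule linear_iter_dird[OF open_N smooth_u])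

lemma bilinear_D:
  assumes "x \<in> N"
  shows "bilinear (\<lambda>a b. D (bs @ [a, b]) x)"
  unfolding bilinear_def
proof (intro conjI allI)
  show "linear (\<lambda>b. D (bs @ [a, b]) x)" for a using linear_D[OF assms, of "bs @ [a]" "[]"] by simp
  show "linear (\<lambda>a. D (bs @ [a, b]) x)" for b using linear_D[OF assms, of bs "[b]"] by simp
qed

lemma D_line_derivative:
  assumes "x + t *\<^sub>R e \<in> N"
  shows "((\<lambda>t. D as (x + t *\<^sub>R e)) has_real_derivative D (e # as) (x + t *\<^sub>R e)) (at t)"
  unfolding D_Cons
  by (rule has_real_derivative_along[OF smooth_D, of "\<lambda>t. x + t *\<^sub>R e", OF assms])
    (auto intro!: derivative_eq_intros simp: has_vector_derivative_def)

lemma frame_matrix_det: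
  fixes V :: "'n \<Rightarrow> real ^ 'n"
  assumes "x \<in> N"
  shows "det (\<chi> i j. g x (V i) (V j)) = det (hessian u x) * (det (\<chi> a j. V j $ a))\<^sup>2"
proof -
  define M where "M = (\<chi> a j. V j $ a)"
  have "(\<chi> i j. g x (V i) (V j)) = transpose M ** (hessian u x ** M)"
    by (simp add: vec_eq_iff matrix_matrix_mult_def transpose_def M_def g_expand[OF assms]
        sum_distrib_left mult_ac)
  then show ?thesis by (simp add: det_mul power2_eq_square M_def)
qed

lemma frame_gram: "frame (g x) V \<Longrightarrow> (\<chi> i j. g x (V i) (V j)) = (mat 1 :: real ^ 'n ^ 'n)"
  by (simp add: frame_def mat_def)

text \<open>The Gram matrix of a frame is the identity, so this determinant times a square is
  1.\<close>

lemma det_hessian_pos: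
  assumes "x \<in> N"
  shows "0 < det (hessian u x)"
proof -
  obtain V :: "'n \<Rightarrow> real ^ 'n" where "frame (g x) V" by (rule frame_exists[OF spd_g[OF assms]])
  then have "det (hessian u x) * (det (\<chi> a j. V j $ a))\<^sup>2 = 1"
    using frame_matrix_det[OF assms, of V] by (simp add: frame_gram)
  then show ?thesis by (metis mult_pos_pos zero_less_one zero_less_mult_pos2 zero_less_power2 mult_zero_right power_zero_numeral zero_neq_one)
qed

end

locale monge_ampere = hessian_domain N u
  for N :: "(real ^ 'n::finite) set" and u :: "real ^ 'n \<Rightarrow> real" +
  fixes v \<xi> :: "real ^ 'n" and c :: real
  assumes monge_ampere: "x \<in> N \<Longrightarrow> ln (det (hessian u x)) = - (v \<bullet> x) + D [\<xi>] x + c"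
begin

text \<open>The frame at \<open>x\<close> is kept fixed along the line. The determinant of its Gram
  matrix differs from that of the Hessian by the constant factor \<open>k\<close>, which adds only
  \<open>ln k\<close> to the equation, and the Gram matrix is the identity at
  \<open>t = 0\<close>.\<close>

lemma monge_ampere_derivatives:
  fixes V :: "'n \<Rightarrow> real ^ 'n"
  assumes x: "x \<in> N" and V: "frame (g x) V"
  shows "- (v \<bullet> e) + D [e, \<xi>] x = (\<Sum>i\<in>UNIV. D [e, V i, V i] x)"
    and "D [e, e, \<xi>] x = (\<Sum>i\<in>UNIV. D [e, e, V i, V i] x)
      - (\<Sum>i\<in>UNIV. \<Sum>k\<in>UNIV. D [e, V i, V k] x * D [e, V k, V i] x)"
    and "D [e, e, e, \<xi>] x = (\<Sum>i\<in>UNIV. D [e, e, e, V i, V i] x)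
      - 3 * (\<Sum>i\<in>UNIV. \<Sum>k\<in>UNIV. D [e, V i, V k] x * D [e, e, V k, V i] x)
      + 2 * (\<Sum>i\<in>UNIV. \<Sum>k\<in>UNIV. \<Sum>l\<in>UNIV. D [e, V i, V l] x * D [e, V l, V k] x * D [e, V k, V i] x)"
proof -
  define S where "S = (\<lambda>t. x + t *\<^sub>R e) -` N"
  have S: "open S" "0 \<in> S"
    using x open_N by (auto simp: S_def intro!: open_vimage continuous_intros)
  define k where "k = (det (\<chi> a j. V j $ a))\<^sup>2"
  define G where "G t = (\<chi> i j. g (x + t *\<^sub>R e) (V i) (V j))" for t
  have det_G: "det (G t) = det (hessian u (x + t *\<^sub>R e)) * k" if "t \<in> S" for t
    using that frame_matrix_det by (simp add: S_def G_def k_def)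
  have G0: "G 0 = mat 1" by (simp add: G_def frame_gram[OF V])
  have "k \<noteq> 0" using det_G[OF S(2)] by (auto simp: G0)
  then have k: "0 < k" by (simp add: k_def)
  have pos: "0 < det (G t)" if "t \<in> S" for t
    using that k by (simp add: det_G det_hessian_pos S_def)
  have inN: "x + t *\<^sub>R e \<in> N" if "t \<in> S" for t using that by (simp add: S_def)
  define F where "F t = - (v \<bullet> (x + t *\<^sub>R e)) + D [\<xi>] (x + t *\<^sub>R e) + c + ln k" for t
  have F: "ln (det (G t)) = F t" if "t \<in> S" for t
    using that k det_hessian_pos[OF inN[OF that]] monge_ampere[OF inN[OF that]]
    by (simp add: det_G F_def ln_mult)
  have F1: "(F has_real_derivative - (v \<bullet> e) + D [e, \<xi>] (x + t *\<^sub>R e)) (at t)" if "t \<in> S" for t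
    unfolding F_def
    by (auto intro!: derivative_eq_intros D_line_derivative inN that simp: inner_right_distrib)
  have F2: "((\<lambda>t. - (v \<bullet> e) + D [e, \<xi>] (x + t *\<^sub>R e)) has_real_derivative D [e, e, \<xi>] (x + t *\<^sub>R e)) (at t)"
    if "t \<in> S" for t
    by (auto intro!: derivative_eq_intros D_line_derivative inN that)
  have F3: "((\<lambda>t. D [e, e, \<xi>] (x + t *\<^sub>R e)) has_real_derivative D [e, e, e, \<xi>] x) (at 0)"
    using D_line_derivative[OF inN[OF S(2)]] by simp
  have G1: "((\<lambda>t. G t $ i $ j) has_real_derivative D [e, V i, V j] (x + t *\<^sub>R e)) (at t)" if "t \<in> S" for t i j
    using D_line_derivative[OF inN[OF that]] by (simp add: G_def g_eq_D)
  have G2: "((\<lambda>t. D [e, V i, V j] (x + t *\<^sub>R e)) has_real_derivative D [e, e, V i, V j] (x + t *\<^sub>R e)) (at t)"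
    if "t \<in> S" for t i j by (rule D_line_derivative[OF inN[OF that]])
  have G3: "((\<lambda>t. D [e, e, V i, V j] (x + t *\<^sub>R e)) has_real_derivative D [e, e, e, V i, V j] x) (at 0)"
    for i j using D_line_derivative[OF inN[OF S(2)]] by simp
  note res = ln_det_derivatives[of S G "\<lambda>t i j. D [e, V i, V j] (x + t *\<^sub>R e)"
      "\<lambda>t i j. D [e, e, V i, V j] (x + t *\<^sub>R e)" "\<lambda>i j. D [e, e, e, V i, V j] x"
      F "\<lambda>t. - (v \<bullet> e) + D [e, \<xi>] (x + t *\<^sub>R e)" "\<lambda>t. D [e, e, \<xi>] (x + t *\<^sub>R e)",
      OF S pos G0 G1 G2 G3 F F1 F2 F3, simplified]
  show "- (v \<bullet> e) + D [e, \<xi>] x = (\<Sum>i\<in>UNIV. D [e, V i, V i] x)" using res(1) by simp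
  show "D [e, e, \<xi>] x = (\<Sum>i\<in>UNIV. D [e, e, V i, V i] x)
      - (\<Sum>i\<in>UNIV. \<Sum>k\<in>UNIV. D [e, V i, V k] x * D [e, V k, V i] x)" using res(2) by simp
  show "D [e, e, e, \<xi>] x = (\<Sum>i\<in>UNIV. D [e, e, e, V i, V i] x)
      - 3 * (\<Sum>i\<in>UNIV. \<Sum>k\<in>UNIV. D [e, V i, V k] x * D [e, e, V k, V i] x)
      + 2 * (\<Sum>i\<in>UNIV. \<Sum>k\<in>UNIV. \<Sum>l\<in>UNIV. D [e, V i, V l] x * D [e, V l, V k] x * D [e, V k, V i] x)"
    using res(3) by simp
qed

text \<open>Each of the \<open>CARD('n)\<close> frame vectors contributes \<open>2 * drift\<close>
  to the summed second derivative; this factor makes the total \<open>- \<xi>\<close>.\<close>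

definition drift :: "real ^ 'n" where
  "drift = (- 1 / (2 * real CARD('n))) *\<^sub>R \<xi>"

lemma sum_drift:
  assumes "x \<in> N"
  shows "(\<Sum>i\<in>(UNIV :: 'n set). 2 * D (drift # as) x) = - D (\<xi> # as) x"
  using linear_cmul[OF linear_D[OF assms, of "[]" as], of "- 1 / (2 * real CARD('n))" \<xi>]
  by (simp add: drift_def)

text \<open>With coupled frames the (symmetrized) Bregman distance of two diffusing points is a supermartingale: the
  drift terms cancel since the generator maps the coordinates of \<open>\<nabla>u\<close> to the constant \<open>- v\<close>.\<close>

lemma coupled_bregman:
  fixes V V' :: "'n \<Rightarrow> real ^ 'n"
  assumes x: "x \<in> N" "frame (g x) V" and x': "x' \<in> N" "frame (g x') V'"
    and coupled: "(\<Sum>i\<in>UNIV. g x (V' i) (V i) + g x' (V' i) (V i)) \<ge> 2 * real CARD('n)"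
  shows "(\<Sum>i\<in>UNIV. (D [V' i, V' i, a] x' + 2 * D [drift, a] x') - (D [V i, V i, a] x + 2 * D [drift, a] x)
    + 2 * (D [V' i, V' i - V i] x' - D [V i, V' i - V i] x)) \<le> 0"
proof -
  have gen: "(\<Sum>i\<in>UNIV. D [U i, U i, a] y + 2 * D [drift, a] y) = - (v \<bullet> a)"
    if y: "y \<in> N" "frame (g y) U" for y and U :: "'n \<Rightarrow> real ^ 'n"
  proof -
    have "D [U i, U i, a] y = D [a, U i, U i] y" for i by (rule D_permute[OF y(1)]) simp
    moreover have "D [\<xi>, a] y = D [a, \<xi>] y" by (rule D_permute[OF y(1)]) simp
    ultimately show ?thesis
      using monge_ampere_derivatives(1)[OF y, of a] sum_drift[OF y(1), of "[a]"]
      by (simp add: sum.distrib)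
  qed
  note bx = bilinear_simps[OF bilinear_g[OF x(1)]] and bx' = bilinear_simps[OF bilinear_g[OF x'(1)]]
  \<comment> \<open>Both frames are orthonormal, so each index gives 2 minus its coupling term; the
    doubled sum is \<open>4 * CARD('n)\<close> minus twice a quantity of at least
    \<open>2 * CARD('n)\<close>.\<close>
  have "D [V' i, V' i - V i] x' - D [V i, V' i - V i] x = 2 - (g x (V' i) (V i) + g x' (V' i) (V i))" for i
    using x(2) x'(2) g_sym[OF x(1), of "V i" "V' i"]
    by (simp add: g_eq_D[symmetric] bx bx' frame_def)
  then have "(\<Sum>i\<in>UNIV. 2 * (D [V' i, V' i - V i] x' - D [V i, V' i - V i] x))
      = 4 * real CARD('n) - 2 * (\<Sum>i\<in>UNIV. g x (V' i) (V i) + g x' (V' i) (V i))"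
    by (simp add: sum_subtractf sum_distrib_left right_diff_distrib)
  then have "(\<Sum>i\<in>UNIV. 2 * (D [V' i, V' i - V i] x' - D [V i, V' i - V i] x)) \<le> 0" using coupled by simp
  then show ?thesis
    using gen[OF x] gen[OF x'] by (simp only: sum.distrib sum_subtractf)
qed

text \<open>The choice of \<open>E\<close> is parallel transport for the Levi-Civita connection; with it the terms
  containing fourth derivatives cancel.\<close>

lemma end_estimate:
  fixes V :: "'n \<Rightarrow> real ^ 'n"
  assumes x: "x \<in> N" and V: "frame (g x) V" and e: "g x e e = 1" and "0 < \<Theta>"
    and crit: "\<And>w. D [e, e, w] x = \<Theta> * g x e w"
    and sup: "\<And>w. D [e, w, w] x \<le> \<Theta> * g x w w"
  defines "E \<equiv> \<lambda>i. (- 1 / 2) *\<^sub>R (\<Sum>j\<in>UNIV. D [e, V i, V j] x *\<^sub>R V j)"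
  shows "D [V i, e, e] x + 2 * D [e, E i] x = 0"
    and "\<Theta>\<^sup>2 / 4 \<le> (\<Sum>i\<in>UNIV. D [V i, V i, e, e, e] x + 2 * D [drift, e, e, e] x
          + 6 * D [V i, e, e, E i] x + 6 * D [e, E i, E i] x) / \<Theta>
        - (3 / 2) * (\<Sum>i\<in>UNIV. D [V i, V i, e, e] x + 2 * D [drift, e, e] x
          + 4 * D [V i, e, E i] x + 2 * D [E i, E i] x)"
proof -
  define t where "t i j = D [e, V i, V j] x" for i j
  define q where "q i j = D [e, e, V i, V j] x" for i j
  define w where "w i = (\<Sum>j\<in>UNIV. t i j *\<^sub>R V j)" for i
  have E: "E i = (- 1 / 2) *\<^sub>R w i" for i by (simp add: E_def w_def t_def)
  note bg = bilinear_g[OF x]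
  have bT: "bilinear (\<lambda>a b. D [e, a, b] x)" using bilinear_D[OF x, of "[e]"] by simp
  have bQ: "bilinear (\<lambda>a b. D [e, e, a, b] x)" using bilinear_D[OF x, of "[e, e]"] by simp
  have tsym: "t i j = t j i" for i j unfolding t_def by (rule D_permute[OF x]) simp
  have qsym: "q i j = q j i" for i j unfolding q_def by (rule D_permute[OF x]) simp
  have gV: "g x (V i) (V j) = (if i = j then 1 else 0)" for i j using V by (simp add: frame_def)
  define k where "k i = g x e (V i)" for i
  have ek: "e = (\<Sum>i\<in>UNIV. k i *\<^sub>R V i)" unfolding k_def by (rule frame_expand[OF bg V])
  \<comment> \<open>By \<open>crit\<close>, the coordinates of \<open>e\<close> form an eigenvector
    of the matrix \<open>t\<close> with eigenvalue \<open>\<Theta>\<close>.\<close>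
  have tk: "(\<Sum>j\<in>UNIV. t i j * k j) = \<Theta> * k i" for i
  proof -
    have "D [e, V i, e] x = (\<Sum>j\<in>UNIV. t i j * k j)"
      by (subst ek) (simp add: bilinear_sums[OF bT] bilinear_simps[OF bT] t_def mult.commute)
    moreover have "D [e, V i, e] x = D [e, e, V i] x" by (rule D_permute[OF x]) simp
    ultimately show ?thesis by (simp add: crit k_def)
  qed
  have kk: "(\<Sum>i\<in>UNIV. k i * k i) = 1"
    using frame_parseval[OF bg V, of e e] e g_sym[OF x, of "V _" e] by (simp add: k_def)
  define tt where "tt = (\<Sum>i\<in>UNIV. \<Sum>j\<in>UNIV. (t i j)\<^sup>2)"
  define ttt where "ttt = (\<Sum>i\<in>UNIV. \<Sum>j\<in>UNIV. \<Sum>l\<in>UNIV. t i l * t l j * t j i)"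
  define tq where "tq = (\<Sum>i\<in>UNIV. \<Sum>j\<in>UNIV. t i j * q i j)"
  have gw: "g x (V i) (w j) = t j i" for i j
  proof -
    have "g x (V i) (w j) = (\<Sum>l\<in>UNIV. t j l * (if i = l then 1 else 0))"
      by (simp add: w_def bilinear_sums[OF bg] bilinear_simps[OF bg] gV)
    then show ?thesis by (simp add: mult_delta_right)
  qed
  have gww: "g x (w i) (w i) = (\<Sum>j\<in>UNIV. (t i j)\<^sup>2)" for i
    using frame_parseval[OF bg V, of "w i" "w i"] gw g_sym[OF x, of "w i" "V _"] by (simp add: power2_eq_square)
  have Tw: "D [e, V i, w j] x = (\<Sum>l\<in>UNIV. t j l * t i l)" for i j
    by (simp add: w_def bilinear_sums[OF bT] bilinear_simps[OF bT] t_def[symmetric])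
  have Tww: "D [e, w i, w i] x = (\<Sum>j\<in>UNIV. \<Sum>l\<in>UNIV. t i l * t l j * t j i)" for i
  proof -
    have "D [e, w i, w i] x = (\<Sum>j\<in>UNIV. t i j * D [e, V j, w i] x)"
      by (subst (1) w_def) (simp add: bilinear_sums[OF bT] bilinear_simps[OF bT])
    also have "\<dots> = (\<Sum>j\<in>UNIV. \<Sum>l\<in>UNIV. t i l * t l j * t j i)"
    proof -
      have "t i j * (t i l * t j l) = t i l * t l j * t j i" for j l
        using tsym[of i j] tsym[of l j] by simp
      then show ?thesis unfolding Tw sum_distrib_left by (simp only:)
    qed
    finally show ?thesis .
  qed
  have ttt_eq: "(\<Sum>i\<in>UNIV. D [e, w i, w i] x) = ttt" by (simp add: Tww ttt_def)
  have Qw: "D [e, e, V i, w j] x = (\<Sum>l\<in>UNIV. t j l * q i l)" for i j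
    by (simp add: w_def bilinear_sums[OF bQ] bilinear_simps[OF bQ] q_def)
  have p1: "D [V i, e, e] x = D [e, e, V i] x" "D [V i, e, w i] x = D [e, V i, w i] x"
    "D [V i, e, e, w i] x = D [e, e, V i, w i] x"
    "D [V i, V i, e, e] x = D [e, e, V i, V i] x" "D [V i, V i, e, e, e] x = D [e, e, e, V i, V i] x" for i
    by (rule D_permute[OF x]; simp)+
  have lin: "D [V i, e, E i] x = - D [V i, e, w i] x / 2" "D [V i, e, e, E i] x = - D [V i, e, e, w i] x / 2"
    "D [e, E i] x = - D [e, w i] x / 2" for i
    using linear_cmul[OF linear_D[OF x, of "[V i, e]" "[]"], of "- 1 / 2" "w i"]
      linear_cmul[OF linear_D[OF x, of "[V i, e, e]" "[]"], of "- 1 / 2" "w i"]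
      linear_cmul[OF linear_D[OF x, of "[e]" "[]"], of "- 1 / 2" "w i"] by (simp_all add: E)
  have EE: "D [e, E i, E i] x = D [e, w i, w i] x / 4" "D [E i, E i] x = g x (w i) (w i) / 4" for i
    by (simp_all add: E bilinear_simps[OF bT] bilinear_simps[OF bg] flip: g_eq_D)
  have "D [e, w i] x = \<Theta> * k i" for i
  proof -
    have "g x e (w i) = (\<Sum>j\<in>UNIV. t i j * k j)"
      by (simp add: w_def bilinear_sums[OF bg] bilinear_simps[OF bg] k_def)
    then show ?thesis by (simp add: tk g_eq_D)
  qed
  then show "D [V i, e, e] x + 2 * D [e, E i] x = 0"
    by (simp add: p1(1) crit lin(3) k_def)
  have px: "D [\<xi>, e, e, e] x = D [e, e, e, \<xi>] x" "D [\<xi>, e, e] x = D [e, e, \<xi>] x"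
    by (rule D_permute[OF x]; simp)+
  have tq_sum: "(\<Sum>i\<in>UNIV. D [e, e, V i, w i] x) = tq" by (simp add: Qw tq_def)
  have tt_sum: "(\<Sum>i\<in>UNIV. D [e, V i, w i] x) = tt" "(\<Sum>i\<in>UNIV. g x (w i) (w i)) = tt"
    by (simp_all add: Tw gww tt_def power2_eq_square)
  have M2: "D [e, e, \<xi>] x = (\<Sum>i\<in>UNIV. D [e, e, V i, V i] x) - tt"
    using monge_ampere_derivatives(2)[OF x V, of e]
    by (simp add: t_def[symmetric] tt_def power2_eq_square tsym)
  have M3: "D [e, e, e, \<xi>] x = (\<Sum>i\<in>UNIV. D [e, e, e, V i, V i] x) - 3 * tq + 2 * ttt"
  proof -
    have "(\<Sum>i\<in>UNIV. \<Sum>k\<in>UNIV. t i k * q k i) = tq"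
      unfolding tq_def by (intro sum.cong refl) (metis qsym)
    then show ?thesis
      using monge_ampere_derivatives(3)[OF x V, of e] by (simp add: t_def[symmetric] q_def[symmetric] ttt_def)
  qed
  \<comment> \<open>The fifth derivatives minus the \<open>\<xi>\<close> term give
    \<open>3 tq - 2 ttt\<close>, the mixed term with \<open>E\<close> gives \<open>- 3 tq\<close>,
    the last one \<open>3 ttt / 2\<close>. In \<open>S2\<close> the contributions are
    \<open>tt\<close>, \<open>- 2 tt\<close> and \<open>tt / 2\<close>.\<close>
  have S3: "(\<Sum>i\<in>UNIV. D [V i, V i, e, e, e] x + 2 * D [drift, e, e, e] x
          + 6 * D [V i, e, e, E i] x + 6 * D [e, E i, E i] x) = - ttt / 2"
  proof -
    have "(\<Sum>i\<in>UNIV. D [V i, V i, e, e, e] x + 2 * D [drift, e, e, e] x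
          + 6 * D [V i, e, e, E i] x + 6 * D [e, E i, E i] x)
        = (\<Sum>i\<in>UNIV. D [e, e, e, V i, V i] x) + (\<Sum>i\<in>(UNIV :: 'n set). 2 * D [drift, e, e, e] x)
          - 3 * (\<Sum>i\<in>UNIV. D [e, e, V i, w i] x) + (3 / 2) * (\<Sum>i\<in>UNIV. D [e, w i, w i] x)"
      unfolding sum_distrib_left sum.distrib[symmetric] sum_subtractf[symmetric]
      by (intro sum.cong refl) (simp add: p1 lin EE)
    then show ?thesis unfolding sum_drift[OF x] px M3 tq_sum ttt_eq by simp
  qed
  have S2: "(\<Sum>i\<in>UNIV. D [V i, V i, e, e] x + 2 * D [drift, e, e] x
          + 4 * D [V i, e, E i] x + 2 * D [E i, E i] x) = - tt / 2"
  proof -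
    have "(\<Sum>i\<in>UNIV. D [V i, V i, e, e] x + 2 * D [drift, e, e] x
          + 4 * D [V i, e, E i] x + 2 * D [E i, E i] x)
        = (\<Sum>i\<in>UNIV. D [e, e, V i, V i] x) + (\<Sum>i\<in>(UNIV :: 'n set). 2 * D [drift, e, e] x)
          - 2 * (\<Sum>i\<in>UNIV. D [e, V i, w i] x) + (1 / 2) * (\<Sum>i\<in>UNIV. g x (w i) (w i))"
      unfolding sum_distrib_left sum.distrib[symmetric] sum_subtractf[symmetric]
      by (intro sum.cong refl) (simp add: p1 lin EE)
    then show ?thesis unfolding sum_drift[OF x] px M2 tt_sum by simp
  qed
  \<comment> \<open>\<open>sup\<close> is tested on the vectors \<open>w i\<close>, whose squared
    lengths add up to \<open>tt\<close>.\<close>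
  have "ttt \<le> \<Theta> * tt"
    unfolding ttt_eq[symmetric] tt_sum(2)[symmetric] sum_distrib_left by (intro sum_mono sup)
  then have up: "ttt / \<Theta> \<le> tt" using \<open>0 < \<Theta>\<close> by (simp add: field_simps)
  \<comment> \<open>The Hilbert-Schmidt norm of \<open>t\<close> is at least its eigenvalue:
    subtract the rank-one part belonging to \<open>e\<close>.\<close>
  have "0 \<le> (\<Sum>i\<in>UNIV. \<Sum>j\<in>UNIV. (t i j - \<Theta> * k i * k j)\<^sup>2)" by (intro sum_nonneg) auto
  also have "\<dots> = (\<Sum>i\<in>UNIV. \<Sum>j\<in>UNIV. (t i j)\<^sup>2 - 2 * \<Theta> * k i * (t i j * k j) + \<Theta>\<^sup>2 * (k i * k i) * (k j * k j))"
    by (intro sum.cong refl) (simp add: power2_eq_square algebra_simps)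
  also have "\<dots> = tt - (\<Sum>i\<in>UNIV. 2 * \<Theta> * k i * (\<Sum>j\<in>UNIV. t i j * k j))
      + (\<Sum>i\<in>UNIV. \<Theta>\<^sup>2 * (k i * k i) * (\<Sum>j\<in>UNIV. k j * k j))"
    by (simp add: tt_def sum.distrib sum_subtractf sum_distrib_left)
  also have "(\<Sum>i\<in>UNIV. 2 * \<Theta> * k i * (\<Sum>j\<in>UNIV. t i j * k j)) = 2 * \<Theta>\<^sup>2 * (\<Sum>i\<in>UNIV. k i * k i)"
    unfolding tk sum_distrib_left by (intro sum.cong refl) (simp add: power2_eq_square)
  also have "(\<Sum>i\<in>UNIV. \<Theta>\<^sup>2 * (k i * k i) * (\<Sum>j\<in>UNIV. k j * k j)) = \<Theta>\<^sup>2 * (\<Sum>i\<in>UNIV. k i * k i)"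
    by (simp add: kk flip: sum_distrib_left)
  finally have low: "\<Theta>\<^sup>2 \<le> tt" by (simp add: kk)
  \<comment> \<open>By the two bounds this is at least \<open>tt / 4\<close>, hence at least
    \<open>\<Theta>\<^sup>2 / 4\<close>.\<close>
  have "(- ttt / 2) / \<Theta> - (3 / 2) * (- tt / 2) = 3 / 4 * tt - (ttt / \<Theta>) / 2" by simp
  then show "\<Theta>\<^sup>2 / 4 \<le> (\<Sum>i\<in>UNIV. D [V i, V i, e, e, e] x + 2 * D [drift, e, e, e] x
          + 6 * D [V i, e, e, E i] x + 6 * D [e, E i, E i] x) / \<Theta>
        - (3 / 2) * (\<Sum>i\<in>UNIV. D [V i, V i, e, e] x + 2 * D [drift, e, e] x
          + 4 * D [V i, e, E i] x + 2 * D [E i, E i] x)"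
    unfolding S3 S2 using up low by simp
qed

end


subsection \<open>Discrete chains and the maximum principle\<close>

lemma sqrt_le_action:
  fixes b h :: real
  assumes "0 \<le> b" "0 < h"
  shows "sqrt b \<le> (b / h + h) / 2"
proof -
  have "0 \<le> (sqrt b - h)\<^sup>2 / h" using assms by simp
  also have "\<dots> = b / h + h - 2 * sqrt b"
    using assms by (simp add: power2_diff field_simps power2_eq_square)
  finally show ?thesis by simp
qed

text \<open>Tychonoff's theorem for sequences with pointwise convergence.\<close>

lemma compact_product_sets:
  fixes K :: "nat \<Rightarrow> 'a::topological_space set"
  assumes "\<And>i. compact (K i)"
  shows "compact {X. \<forall>i. X i \<in> K i}"
proof -
  have "compactin (product_topology (\<lambda>i. euclidean) UNIV) (PiE UNIV K)"
    using assms by (simp add: compactin_PiE)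
  moreover have "PiE UNIV K = {X. \<forall>i. X i \<in> K i}" by auto
  ultimately show ?thesis by (simp add: euclidean_product_topology)
qed

context hessian_domain
begin

definition chain :: "nat \<Rightarrow> (nat \<Rightarrow> real ^ 'n) \<Rightarrow> bool" where
  "chain m X \<longleftrightarrow> (\<forall>i<m. closed_segment (X i) (X (Suc i)) \<subseteq> N)"

text \<open>A term is at least \<open>2 * sqrt (breg ..)\<close>, with equality when the root is
  \<open>h\<close>: a substitute for twice the length that stays smooth when points coincide. The
  summand \<open>h\<close> limits the number of steps.\<close>

definition action :: "real \<Rightarrow> nat \<Rightarrow> (nat \<Rightarrow> real ^ 'n) \<Rightarrow> real" where
  "action h m X = (\<Sum>i<m. breg (X i) (X (Suc i)) / h + h)"

text \<open>Strict inequalities keep small variations admissible; \<open>1 \<le> m\<close> puts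
  every point on a segment.\<close>

definition admissible ::
    "real ^ 'n \<Rightarrow> real \<Rightarrow> real \<Rightarrow> real \<Rightarrow> nat \<Rightarrow> (nat \<Rightarrow> real ^ 'n) \<Rightarrow> real ^ 'n \<Rightarrow> bool" where
  "admissible z \<rho> a h m X e \<longleftrightarrow> 1 \<le> m \<and> chain m X \<and> X 0 \<in> ball z \<rho> \<and> action h m X < a \<and> e \<noteq> 0"

definition objective ::
    "real ^ 'n \<Rightarrow> real \<Rightarrow> real \<Rightarrow> real \<Rightarrow> real \<Rightarrow> nat \<Rightarrow> (nat \<Rightarrow> real ^ 'n) \<Rightarrow> real ^ 'n \<Rightarrow> real" where
  "objective z \<rho> a h \<epsilon> m X e = D [e, e, e] (X m) * (a - action h m X)
    * (1 - (norm (X 0 - z))\<^sup>2 / \<rho>\<^sup>2) powr \<epsilon> / (g (X m) e e * sqrt (g (X m) e e))"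

lemma chain_in: "chain m X \<Longrightarrow> 1 \<le> m \<Longrightarrow> i \<le> m \<Longrightarrow> X i \<in> N"
proof -
  assume c: "chain m X" "1 \<le> m" "i \<le> m"
  show "X i \<in> N"
  proof (cases "i < m")
    case True
    then show ?thesis using c(1) by (auto simp: chain_def)
  next
    case False
    with c obtain j where "m = Suc j" "i = Suc j" by (cases m) auto
    then show ?thesis using c(1) by (auto simp: chain_def)
  qed
qed

lemma continuous_on_D:
  assumes "continuous_on K p" "p ` K \<subseteq> N" "\<And>h. h \<in> set hs \<Longrightarrow> continuous_on K h"
  shows "continuous_on K (\<lambda>t. D (map (\<lambda>h. h t) hs) (p t))"
  unfolding D_def by (rule continuous_on_iter_dird[OF open_N smooth_u assms])

lemma breg_eq_D: "breg x y = D [y - x] y - D [y - x] x"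
  by (simp add: breg_def D_def)

lemma continuous_on_breg:
  assumes "continuous_on K p" "p ` K \<subseteq> N" "continuous_on K q" "q ` K \<subseteq> N"
  shows "continuous_on K (\<lambda>t. breg (p t) (q t))"
  unfolding breg_eq_D
  using continuous_on_D[OF assms(1,2), of "[\<lambda>t. q t - p t]"]
    continuous_on_D[OF assms(3,4), of "[\<lambda>t. q t - p t]"] assms(1,3)
  by (auto intro!: continuous_on_diff)

lemma chain_reach:
  assumes "chain m X" "reach z r (X 0)" "i \<le> m"
  shows "reach z (r + (\<Sum>j<i. sqrt (breg (X j) (X (Suc j))))) (X i)"
  using assms(3)
proof (induction i)
  case 0
  then show ?case using assms(2) by simp
next
  case (Suc i)
  then show ?case using assms(1) by (intro reach.step[OF Suc.IH]) (auto simp: chain_def)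
qed

text \<open>The action bounds the length of the polygon, so Hopf-Rinow confines it. \<open>C\<close>
  is independent of \<open>h\<close> and \<open>m\<close>, because the step size is later chosen in
  dependence on \<open>C\<close>.\<close>

lemma chains_in_compact:
  assumes "riemannian_complete N (hessian u)" "cball z \<rho> \<subseteq> N" "0 < \<rho>"
  obtains C where "compact C" "C \<subseteq> N"
    "\<And>h m X i. 0 < h \<Longrightarrow> chain m X \<Longrightarrow> X 0 \<in> cball z \<rho> \<Longrightarrow> action h m X \<le> a \<Longrightarrow> i < m \<Longrightarrow>
      closed_segment (X i) (X (Suc i)) \<subseteq> C"
proof -
  have "z \<in> N" using assms by auto
  obtain l L where L: "0 < L" "\<And>x a. x \<in> cball z \<rho> \<Longrightarrow> g x a a \<le> L * (norm a)\<^sup>2"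
    using g_bounds[OF compact_cball assms(2)] by metis
  define r0 where "r0 = sqrt L * \<rho>"
  have start: "reach z r0 y" if "y \<in> cball z \<rho>" for y
    unfolding r0_def using that by (intro reach_cball[OF assms(2) L]) (auto simp: dist_norm norm_minus_commute)
  obtain C where C: "compact C" "C \<subseteq> N" "\<And>y. reach z (r0 + a) y \<Longrightarrow> y \<in> C"
    using hopf_rinow[OF assms(1) \<open>z \<in> N\<close>, of "r0 + a"] unfolding good_def by blast
  show ?thesis
  proof (rule that[OF C(1,2)])
    fix h :: real and m i X
    assume h: "0 < h" and X: "chain m X" "X 0 \<in> cball z \<rho>" "action h m X \<le> a" and i: "i < m"
    have b0: "0 \<le> breg (X j) (X (Suc j))" if "j < m" for j
      using X(1) that by (intro breg_nonneg) (auto simp: chain_def)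
    have "(\<Sum>j<Suc i. sqrt (breg (X j) (X (Suc j)))) \<le> (\<Sum>j<m. sqrt (breg (X j) (X (Suc j))))"
      using i b0 by (intro sum_mono2) auto
    also have "\<dots> \<le> (\<Sum>j<m. (breg (X j) (X (Suc j)) / h + h) / 2)"
      using b0 h by (intro sum_mono sqrt_le_action) auto
    also have "\<dots> = action h m X / 2" by (simp add: action_def sum_divide_distrib)
    finally have half: "(\<Sum>j<Suc i. sqrt (breg (X j) (X (Suc j)))) \<le> action h m X / 2" .
    have "0 \<le> action h m X" using b0 h unfolding action_def by (intro sum_nonneg) auto
    with half X(3) have tot: "(\<Sum>j<Suc i. sqrt (breg (X j) (X (Suc j)))) \<le> a" by linarith
    show "closed_segment (X i) (X (Suc i)) \<subseteq> C"
    proof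
      fix p assume p: "p \<in> closed_segment (X i) (X (Suc i))"
      have seg: "closed_segment (X i) (X (Suc i)) \<subseteq> N" using X(1) i by (auto simp: chain_def)
      obtain s where s: "0 \<le> s" "s \<le> 1" "p = X i + s *\<^sub>R (X (Suc i) - X i)"
        using p by (auto simp: in_segment algebra_simps)
      have segs: "closed_segment (X i) p \<subseteq> N" "closed_segment p (X (Suc i)) \<subseteq> N"
        using closed_segment_split[OF p] seg by auto
      have "sqrt (breg (X i) p) \<le> sqrt (breg (X i) (X (Suc i)))"
        using sqrt_breg_split[OF seg s] real_sqrt_ge_zero[OF breg_nonneg[OF segs(2)]] by linarith
      then have "r0 + (\<Sum>j<i. sqrt (breg (X j) (X (Suc j)))) + sqrt (breg (X i) p) \<le> r0 + a"
        using tot unfolding sum.lessThan_Suc by linarith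
      then have "reach z (r0 + a) p"
        using i by (intro reach.step[OF chain_reach[OF X(1) start[OF X(2)], of i] segs(1)]) auto
      then show "p \<in> C" by (rule C(3))
    qed
  qed
qed

lemma objective_scale:
  assumes "X m \<in> N" "0 < k"
  shows "objective z \<rho> a h \<epsilon> m X (k *\<^sub>R e) = objective z \<rho> a h \<epsilon> m X e"
proof -
  have lin: "D (bs @ (k *\<^sub>R e) # cs) (X m) = k * D (bs @ e # cs) (X m)" for bs cs
    using linear_cmul[OF linear_D[OF assms(1)]] by simp
  have "D [k *\<^sub>R e, k *\<^sub>R e, k *\<^sub>R e] (X m) = k ^ 3 * D [e, e, e] (X m)"
    using lin[of "[]" "[k *\<^sub>R e, k *\<^sub>R e]"] lin[of "[e]" "[k *\<^sub>R e]"] lin[of "[e, e]" "[]"]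
    by (simp add: power3_eq_cube)
  moreover have "g (X m) (k *\<^sub>R e) (k *\<^sub>R e) = k\<^sup>2 * g (X m) e e"
    by (simp add: bilinear_simps[OF bilinear_g[OF assms(1)]] power2_eq_square)
  moreover have "sqrt (k\<^sup>2 * g (X m) e e) = k * sqrt (g (X m) e e)"
    using assms(2) by (simp add: real_sqrt_mult)
  ultimately show ?thesis
    using assms(2) by (simp add: objective_def power2_eq_square power3_eq_cube)
qed

text \<open>The maximum is taken under non-strict constraints, where compactness is available. The
  objective vanishes on the added boundary and is positive at the constant chain, so a maximizer is
  admissible.\<close>

lemma maximizer_exists:
  assumes complete: "riemannian_complete N (hessian u)" and \<rho>: "cball z \<rho> \<subseteq> N" "0 < \<rho>"
    and h: "0 < h" "h < a" and \<epsilon>: "0 < \<epsilon>" and e0: "0 < D [e0, e0, e0] z"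
  obtains m X e where "admissible z \<rho> a h m X e" "g (X m) e e = 1"
    "objective z \<rho> a h \<epsilon> 1 (\<lambda>_. z) e0 \<le> objective z \<rho> a h \<epsilon> m X e"
    "0 < D [e, e, e] (X m)" "0 < objective z \<rho> a h \<epsilon> m X e"
    "\<And>m' Y e'. admissible z \<rho> a h m' Y e' \<Longrightarrow> objective z \<rho> a h \<epsilon> m' Y e' \<le> objective z \<rho> a h \<epsilon> m X e"
proof -
  obtain C where C: "compact C" "C \<subseteq> N"
    "\<And>h m X i. 0 < h \<Longrightarrow> chain m X \<Longrightarrow> X 0 \<in> cball z \<rho> \<Longrightarrow> action h m X \<le> a \<Longrightarrow> i < m \<Longrightarrow>
      closed_segment (X i) (X (Suc i)) \<subseteq> C"
    using chains_in_compact[OF complete \<rho>, of a] by blast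
  have zN: "z \<in> N" using \<rho> by auto
  let ?F = "objective z \<rho> a h \<epsilon>"
  \<comment> \<open>Chains are infinite sequences; pinning the entries beyond \<open>m\<close> to
    \<open>z\<close> makes the full product compact.\<close>
  define P where "P m = {X :: nat \<Rightarrow> real ^ 'n. \<forall>i. X i \<in> (if i \<le> m then C else {z})}" for m
  \<comment> \<open>Lying in the compact set \<open>C\<close> is a closed condition on segments,
    unlike lying in the open set \<open>N\<close>.\<close>
  define Q where "Q m = P m \<inter> (\<lambda>X. X 0) -` cball z \<rho> \<inter>
      (\<Inter>i\<in>{..<m}. \<Inter>t\<in>{0..1}. (\<lambda>X. (1 - t) *\<^sub>R X i + t *\<^sub>R X (Suc i)) -` C)" for m
  define S where "S m = Q m \<inter> action h m -` {..a}" for m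
  have coord: "continuous_on K (\<lambda>X :: nat \<Rightarrow> real ^ 'n. X i)" for K i
    by (rule continuous_on_subset[OF continuous_on_product_coordinates]) simp
  have "compact (P m)" for m unfolding P_def using C(1) by (intro compact_product_sets) auto
  then have closedP: "closed (P m)" for m by (rule compact_imp_closed)
  have "closed (Q m)" for m
    unfolding Q_def using compact_imp_closed[OF C(1)]
    by (intro closed_Int closedP closed_INT ballI closed_vimage continuous_intros coord) auto
  moreover have contA: "continuous_on (Q m) (action h m)" for m
    unfolding action_def[abs_def] using C(2) h(1)
    by (intro continuous_intros continuous_on_breg coord) (auto simp: Q_def P_def)
  ultimately have "closed (S m)" for m
    unfolding S_def by (intro continuous_closed_preimage) auto
  moreover have "S m = P m \<inter> S m" for m by (auto simp: S_def Q_def)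
  ultimately have compS: "compact (S m)" for m
    using \<open>\<And>m. compact (P m)\<close> by (metis compact_Int_closed)
  have segS: "closed_segment (X i) (X (Suc i)) \<subseteq> C" if "X \<in> S m" "i < m" for X m i
    using that by (auto simp: S_def Q_def in_segment)
  have inS: "X \<in> S m" if "chain m X" "1 \<le> m" "X 0 \<in> cball z \<rho>" "\<And>i. m < i \<Longrightarrow> X i = z" "action h m X \<le> a" for X m
  proof -
    have seg: "closed_segment (X i) (X (Suc i)) \<subseteq> C" if "i < m" for i
      using C(3)[OF h(1) \<open>chain m X\<close> \<open>X 0 \<in> cball z \<rho>\<close> \<open>action h m X \<le> a\<close> that] .
    have "X i \<in> C" if "i \<le> m" for i
    proof (cases "i < m")
      case True
      then show ?thesis using seg by auto
    next
      case False
      with that \<open>1 \<le> m\<close> obtain j where "m = Suc j" "i = Suc j" by (cases m) auto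
      then show ?thesis using seg[of j] by auto
    qed
    then have "X \<in> P m" using that(4) by (auto simp: P_def)
    moreover have "(1 - t) *\<^sub>R X i + t *\<^sub>R X (Suc i) \<in> C" if "i < m" "t \<in> {0..1}" for i t
      using seg[OF that(1)] that(2) by (auto simp: in_segment intro!: subsetD[of "closed_segment (X i) (X (Suc i))" C])
    ultimately show ?thesis using that(3,5) by (auto simp: S_def Q_def)
  qed
  have SN: "X m \<in> N" if "X \<in> S m" for X m   proof -
    have "\<forall>i. X i \<in> (if i \<le> m then C else {z})" using that by (simp add: S_def Q_def P_def)
    then have "X m \<in> C" by (metis order_refl)
    then show ?thesis using C(2) by blast
  qed
  have \<eta>0: "0 \<le> 1 - (norm (x - z))\<^sup>2 / \<rho>\<^sup>2" if "x \<in> cball z \<rho>" for x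
  proof -
    have "(norm (x - z))\<^sup>2 \<le> \<rho>\<^sup>2" using that by (intro power_mono) (auto simp: dist_norm norm_minus_commute)
    then show ?thesis using \<rho>(2) by (simp add: divide_le_eq)
  qed
  have contF: "continuous_on (S m \<times> sphere 0 1) (\<lambda>z. ?F m (fst z) (snd z))" for m
  proof -
    let ?K = "S m \<times> sphere (0 :: real ^ 'n) 1"
    have cX: "continuous_on ?K (\<lambda>z. fst z i)" for i
      by (rule continuous_on_compose2[OF coord[of UNIV] continuous_on_fst]) (auto intro: continuous_on_id)
    have ce: "continuous_on ?K snd" by (intro continuous_intros)
    have img: "(\<lambda>z. fst z m) ` ?K \<subseteq> N" using SN by auto
    have c1: "continuous_on ?K (\<lambda>z. D [snd z, snd z, snd z] (fst z m))"
      using continuous_on_D[OF cX img, of "[snd, snd, snd]"] ce by simp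
    have c2: "continuous_on ?K (\<lambda>z. action h m (fst z))"
      by (rule continuous_on_compose2[OF contA continuous_on_fst]) (auto simp: S_def intro: continuous_on_id)
    have c3: "continuous_on ?K (\<lambda>w. (1 - (norm (fst w 0 - z))\<^sup>2 / \<rho>\<^sup>2) powr \<epsilon>)"
      using \<epsilon> \<eta>0 \<rho>(2) by (intro continuous_on_powr' continuous_intros cX) (auto simp: S_def Q_def)
    have c4: "continuous_on ?K (\<lambda>z. g (fst z m) (snd z) (snd z))"
      by (rule continuous_on_g[OF cX ce ce img])
    have "0 < g (fst w m) (snd w) (snd w)" if "w \<in> ?K" for w
      using SN that by (intro g_pos) auto
    then have "\<forall>w\<in>?K. g (fst w m) (snd w) (snd w) * sqrt (g (fst w m) (snd w) (snd w)) \<noteq> 0"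
      by (fastforce simp: less_imp_neq[symmetric])
    then show ?thesis
      unfolding objective_def
      by (intro continuous_on_divide continuous_on_mult continuous_on_diff continuous_on_const
          continuous_on_real_sqrt c1 c2 c3 c4)
  qed
  \<comment> \<open>Every step costs at least \<open>h\<close>, so only finitely many
    \<open>m\<close> compete.\<close>
  define I where "I = {m. 1 \<le> m \<and> real m * h \<le> a}"
  have "finite I"
  proof (rule finite_subset)
    show "I \<subseteq> {..nat \<lceil>a / h\<rceil>}"
    proof
      fix m assume "m \<in> I"
      then have "real m \<le> a / h" using h by (simp add: I_def field_simps)
      then show "m \<in> {..nat \<lceil>a / h\<rceil>}" by simp linarith
    qed
  qed simp
  have const: "(\<lambda>_. z) \<in> S m" if "m \<in> I" for m
    using that \<rho> zN by (intro inS) (auto simp: I_def chain_def action_def mult.commute)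
  have "\<exists>p\<in>S m \<times> sphere 0 1. \<forall>q\<in>S m \<times> sphere 0 1. ?F m (fst q) (snd q) \<le> ?F m (fst p) (snd p)" if "m \<in> I" for m
    using const[OF that] compS contF
    by (intro continuous_attains_sup compact_Times compact_sphere) auto
  then obtain p where p: "\<And>m. m \<in> I \<Longrightarrow> p m \<in> S m \<times> sphere 0 1"
    "\<And>m q. m \<in> I \<Longrightarrow> q \<in> S m \<times> sphere 0 1 \<Longrightarrow> ?F m (fst q) (snd q) \<le> ?F m (fst (p m)) (snd (p m))"
    by metis
  define G where "G m = ?F m (fst (p m)) (snd (p m))" for m
  have "1 \<in> I" using h by (simp add: I_def)
  then have "I \<noteq> {}" by blast
  have "Max (G ` I) \<in> G ` I" using \<open>finite I\<close> \<open>I \<noteq> {}\<close> by (intro Max_in) auto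
  then obtain m where m: "m \<in> I" "Max (G ` I) = G m" by auto
  have Gm: "G m' \<le> G m" if "m' \<in> I" for m'
    using that \<open>finite I\<close> m(2) by (metis Max_ge finite_imageI imageI)
  \<comment> \<open>Normalizing \<open>e'\<close> and resetting the tail moves a competitor into the
    compact set without changing the objective.\<close>
  have best: "?F m' Y e' \<le> G m" if ad: "admissible z \<rho> a h m' Y e'" for m' Y e'
  proof -
    define Y' where "Y' i = (if i \<le> m' then Y i else z)" for i
    define d where "d = (1 / norm e') *\<^sub>R e'"
    have ad': "1 \<le> m'" "chain m' Y" "Y 0 \<in> ball z \<rho>" "action h m' Y < a" "e' \<noteq> 0"
      using ad by (auto simp: admissible_def)
    have act: "action h m' Y' = action h m' Y" by (auto simp: action_def Y'_def intro!: sum.cong)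
    have ch: "chain m' Y'" using ad'(2) by (auto simp: chain_def Y'_def)
    have "Y' \<in> S m'"
      using ad' act ch by (intro inS) (auto simp: Y'_def)
    have "real m' * h = (\<Sum>i<m'. h)" by simp
    also have "\<dots> \<le> action h m' Y" unfolding action_def
      using ad'(2) h(1) by (intro sum_mono) (auto simp: chain_def breg_nonneg)
    finally have "m' \<in> I" using ad' by (simp add: I_def)
    have YN: "Y m' \<in> N" using chain_in[OF ad'(2,1)] by simp
    have "?F m' Y e' = ?F m' Y d"
      unfolding d_def by (rule objective_scale[of Y m', OF YN, symmetric]) (use ad'(5) in simp)
    also have "\<dots> = ?F m' Y' d" by (simp add: objective_def act) (simp add: Y'_def)
    also have "\<dots> \<le> G m'"
      using p(2)[OF \<open>m' \<in> I\<close>, of "(Y', d)"] \<open>Y' \<in> S m'\<close> ad'(5) by (simp add: G_def d_def)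
    also have "\<dots> \<le> G m" by (rule Gm[OF \<open>m' \<in> I\<close>])
    finally show ?thesis .
  qed
  obtain X e where Xe: "p m = (X, e)" by (cases "p m")
  have X: "X \<in> S m" and "norm e = 1" using p(1)[OF m(1)] Xe by auto
  have e_nz: "e \<noteq> 0" using \<open>norm e = 1\<close> by auto
  have GF: "G m = ?F m X e" by (simp add: G_def Xe)
  have "e0 \<noteq> 0" using e0 linear_0[OF linear_D[OF zN, of "[]" "[e0, e0]"]] by auto
  have ad0: "admissible z \<rho> a h 1 (\<lambda>_. z) e0"
    using h \<rho> zN \<open>e0 \<noteq> 0\<close> by (simp add: admissible_def chain_def action_def)
  have "0 < ?F 1 (\<lambda>_. z) e0"
    using e0 h g_pos[OF zN \<open>e0 \<noteq> 0\<close>] by (simp add: objective_def action_def)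
  then have Fpos: "0 < ?F m X e" using best[OF ad0] GF by simp
  have XN: "X m \<in> N" by (rule SN[OF X])
  have geg: "0 < g (X m) e e" by (rule g_pos[OF XN e_nz])
  have Xc: "X 0 \<in> cball z \<rho>" "action h m X \<le> a" using X by (auto simp: S_def Q_def)
  have den: "0 < g (X m) e e * sqrt (g (X m) e e)" using geg by simp
  have num: "0 < D [e, e, e] (X m) * ((a - action h m X) * (1 - (norm (X 0 - z))\<^sup>2 / \<rho>\<^sup>2) powr \<epsilon>)"
    using Fpos den unfolding objective_def zero_less_divide_iff mult.assoc by (meson less_asym)
  moreover have "0 \<le> (a - action h m X) * (1 - (norm (X 0 - z))\<^sup>2 / \<rho>\<^sup>2) powr \<epsilon>" using Xc by simp
  ultimately have Dpos: "0 < D [e, e, e] (X m)"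
    and rest: "0 < (a - action h m X) * (1 - (norm (X 0 - z))\<^sup>2 / \<rho>\<^sup>2) powr \<epsilon>"
    by (auto simp: zero_less_mult_iff)
  then have Aa: "action h m X < a" using Xc(2) by (cases "action h m X = a") auto
  \<comment> \<open>\<open>0 powr \<epsilon>\<close> is 0, so positivity keeps \<open>X 0\<close>
    off the boundary sphere.\<close>
  have "1 - (norm (X 0 - z))\<^sup>2 / \<rho>\<^sup>2 \<noteq> 0"
  proof
    assume z0: "1 - (norm (X 0 - z))\<^sup>2 / \<rho>\<^sup>2 = 0"
    show False using rest unfolding z0 by simp
  qed
  then have "0 < 1 - (norm (X 0 - z))\<^sup>2 / \<rho>\<^sup>2" using \<eta>0[OF Xc(1)] by linarith
  then have "(norm (X 0 - z))\<^sup>2 < \<rho>\<^sup>2" using \<rho>(2) by (simp add: divide_less_eq)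
  then have X0: "X 0 \<in> ball z \<rho>"
    using \<rho>(2) by (auto simp: dist_norm norm_minus_commute power2_less_imp_less)
  have chX: "chain m X" using segS[OF X] C(2) by (auto simp: chain_def)
  define k where "k = 1 / sqrt (g (X m) e e)"
  have k: "0 < k" using geg by (simp add: k_def)
  have Fk: "?F m X (k *\<^sub>R e) = ?F m X e" by (rule objective_scale[of X m, OF XN k])
  have gk: "g (X m) (k *\<^sub>R e) (k *\<^sub>R e) = 1"
    using geg by (simp add: k_def bilinear_simps[OF bilinear_g[OF XN]])
  show ?thesis
  proof (rule that[of m X "k *\<^sub>R e"])
    show "admissible z \<rho> a h m X (k *\<^sub>R e)"
      using m(1) chX X0 Aa e_nz k by (auto simp: admissible_def I_def)
    show "0 < D [k *\<^sub>R e, k *\<^sub>R e, k *\<^sub>R e] (X m)"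
    proof -
      have lin: "D (bs @ (k *\<^sub>R e) # cs) (X m) = k * D (bs @ e # cs) (X m)" for bs cs
        using linear_cmul[OF linear_D[OF XN]] by simp
      have "D [k *\<^sub>R e, k *\<^sub>R e, k *\<^sub>R e] (X m) = k * (k * (k * D [e, e, e] (X m)))"
        using lin[of "[]" "[k *\<^sub>R e, k *\<^sub>R e]"] lin[of "[e]" "[k *\<^sub>R e]"] lin[of "[e, e]" "[]"] by simp
      then show ?thesis using k Dpos by simp
    qed
  qed (use Fk gk best ad0 GF Fpos in auto)
qed

lemma sum_lessThan_split:
  fixes f :: "nat \<Rightarrow> real"
  shows "(\<Sum>j<i + k. f j) = (\<Sum>j<i. f j) + (\<Sum>j<k. f (i + j))"
  by (induction k) (auto simp: add.assoc)

text \<open>At a maximizer no step is long: inserting the midpoint of the segment halves its Bregman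
  distance exactly, at the expense of one more \<open>h\<close>.\<close>

lemma maximizer_short_steps:
  assumes ad: "admissible z \<rho> a h m X e" and h: "0 < h" and pos: "0 < objective z \<rho> a h \<epsilon> m X e"
    and max: "\<And>m' Y e'. admissible z \<rho> a h m' Y e' \<Longrightarrow> objective z \<rho> a h \<epsilon> m' Y e' \<le> objective z \<rho> a h \<epsilon> m X e"
    and i: "i < m"
  shows "breg (X i) (X (Suc i)) \<le> 2 * h\<^sup>2"
proof (rule ccontr)
  assume far: "\<not> ?thesis"
  define p where "p = midpoint (X i) (X (Suc i))"
  \<comment> \<open>Indices after \<open>i\<close> are shifted by one; both ends of the chain stay
    in place.\<close>
  define Y where "Y j = (if j \<le> i then X j else if j = Suc i then p else X (j - 1))" for j
  have ad': "1 \<le> m" "chain m X" "X 0 \<in> ball z \<rho>" "action h m X < a" "e \<noteq> 0"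
    using ad by (auto simp: admissible_def)
  have seg: "closed_segment (X i) (X (Suc i)) \<subseteq> N" using ad'(2) i by (auto simp: chain_def)
  have pin: "p \<in> closed_segment (X i) (X (Suc i))" by (simp add: p_def)
  have segp: "closed_segment (X i) p \<subseteq> N" "closed_segment p (X (Suc i)) \<subseteq> N"
    using closed_segment_split[OF pin] seg by auto
  have chY: "chain (Suc m) Y"
    unfolding chain_def
  proof (intro allI impI)
    fix j assume "j < Suc m"
    consider "j < i" | "j = i" | "j = Suc i" | "Suc i < j" by linarith
    then show "closed_segment (Y j) (Y (Suc j)) \<subseteq> N"
    proof cases
      case 4
      then obtain j' where j': "j = Suc j'" by (cases j) auto
      then show ?thesis using 4 \<open>j < Suc m\<close> ad'(2) by (auto simp: Y_def chain_def)
    qed (use segp ad'(2) i in \<open>auto simp: Y_def chain_def\<close>)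
  qed
  obtain k where k: "m = Suc i + k" using less_imp_Suc_add[OF i] by auto
  define \<phi> where "\<phi> x y = breg x y / h + h" for x y
  have AX: "action h m X = (\<Sum>j<i. \<phi> (X j) (X (Suc j))) + \<phi> (X i) (X (Suc i))
      + (\<Sum>j<k. \<phi> (X (Suc i + j)) (X (Suc (Suc i + j))))"
    unfolding action_def \<phi>_def k sum_lessThan_split[of _ "Suc i" k] by simp
  have "Suc m = Suc (Suc i) + k" using k by simp
  then have AY: "action h (Suc m) Y = (\<Sum>j<i. \<phi> (X j) (X (Suc j))) + \<phi> (X i) p + \<phi> p (X (Suc i))
      + (\<Sum>j<k. \<phi> (X (Suc i + j)) (X (Suc (Suc i + j))))"
    unfolding action_def \<phi>_def by (simp only: sum_lessThan_split[of _ "Suc (Suc i)" k]) (simp add: Y_def)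
  have "\<phi> (X i) p + \<phi> p (X (Suc i)) = (breg (X i) p + breg p (X (Suc i))) / h + 2 * h"
    by (simp add: \<phi>_def add_divide_distrib)
  then have "\<phi> (X i) p + \<phi> p (X (Suc i)) = breg (X i) (X (Suc i)) / 2 / h + 2 * h"
    using breg_midpoint[OF seg] by (simp add: p_def)
  \<comment> \<open>The new pair costs \<open>b / (2 h) + 2 h\<close> instead of
    \<open>b / h + h\<close>, where \<open>b\<close> is the Bregman distance: a gain precisely when
    \<open>b > 2 h\<^sup>2\<close>.\<close>
  moreover have "h < breg (X i) (X (Suc i)) / 2 / h"
    using far h by (simp add: field_simps power2_eq_square)
  ultimately have less: "action h (Suc m) Y < action h m X" unfolding AX AY by (simp add: \<phi>_def)
  have Y0: "Y 0 = X 0" and Ym: "Y (Suc m) = X m" using i by (auto simp: Y_def)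
  have "admissible z \<rho> a h (Suc m) Y e"
    using ad' chY less by (simp add: admissible_def Y0)
  from max[OF this] have le: "objective z \<rho> a h \<epsilon> (Suc m) Y e \<le> objective z \<rho> a h \<epsilon> m X e" .
  define w where "w = D [e, e, e] (X m) * (1 - (norm (X 0 - z))\<^sup>2 / \<rho>\<^sup>2) powr \<epsilon> / (g (X m) e e * sqrt (g (X m) e e))"
  have o1: "objective z \<rho> a h \<epsilon> m X e = w * (a - action h m X)"
    and o2: "objective z \<rho> a h \<epsilon> (Suc m) Y e = w * (a - action h (Suc m) Y)"
    by (simp_all add: objective_def w_def Y0 Ym)
  have "0 < w" using pos ad'(4) by (simp add: o1 zero_less_mult_iff)
  then have "w * (a - action h m X) < w * (a - action h (Suc m) Y)" using less by simp
  then show False using le by (simp add: o1 o2)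
qed

end


subsection \<open>Variation of a maximizing chain\<close>

lemma jet2_eqI: "jet2 f a b c \<Longrightarrow> a = a' \<Longrightarrow> b = b' \<Longrightarrow> c = c' \<Longrightarrow> jet2 f a' b' c'"
  by simp

lemma jet2_power2: "jet2 (\<lambda>t. t\<^sup>2) 0 0 2"
  by (rule jet2I[where f' = "\<lambda>t. 2 * t"]) (auto intro!: always_eventually derivative_eq_intros)

lemma jet2_power3: "jet2 (\<lambda>t. t ^ 3) 0 0 0"
  by (rule jet2I[where f' = "\<lambda>t. 3 * t\<^sup>2"]) (auto intro!: always_eventually derivative_eq_intros)

lemma jet2_norm_parabola:
  fixes x v w :: "'a::real_inner"
  shows "jet2 (\<lambda>t. (norm (x + t *\<^sub>R v + t\<^sup>2 *\<^sub>R w))\<^sup>2) ((norm x)\<^sup>2) (2 * (x \<bullet> v)) (2 * ((norm v)\<^sup>2 + 2 * (x \<bullet> w)))"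
proof -
  have "(norm (x + t *\<^sub>R v + t\<^sup>2 *\<^sub>R w))\<^sup>2 = (norm x)\<^sup>2 + 2 * (x \<bullet> v) * t + ((norm v)\<^sup>2 + 2 * (x \<bullet> w)) * t\<^sup>2
      + 2 * (v \<bullet> w) * t ^ 3 + (norm w)\<^sup>2 * t ^ 4" for t
    unfolding power2_norm_eq_inner
    by (simp add: inner_add_left inner_add_right inner_commute power2_eq_square power3_eq_cube
        power4_eq_xxxx algebra_simps)
  moreover have "jet2 (\<lambda>t. (norm x)\<^sup>2 + 2 * (x \<bullet> v) * t + ((norm v)\<^sup>2 + 2 * (x \<bullet> w)) * t\<^sup>2
      + 2 * (v \<bullet> w) * t ^ 3 + (norm w)\<^sup>2 * t ^ 4) ((norm x)\<^sup>2) (2 * (x \<bullet> v)) (2 * ((norm v)\<^sup>2 + 2 * (x \<bullet> w)))"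
    by (rule jet2I[where f' = "\<lambda>t. 2 * (x \<bullet> v) + 2 * ((norm v)\<^sup>2 + 2 * (x \<bullet> w)) * t
          + 6 * (v \<bullet> w) * t\<^sup>2 + 4 * (norm w)\<^sup>2 * t ^ 3"])
      (auto intro!: always_eventually derivative_eq_intros simp: algebra_simps)
  ultimately show ?thesis by simp
qed

text \<open>A compact segment has positive distance \<open>d\<close> from the complement of
  \<open>S\<close>, and points with equal affine parameter move by less than \<open>d\<close> when
  both ends do.\<close>

lemma eventually_segment_subset:
  fixes p q :: "real \<Rightarrow> 'a::euclidean_space"
  assumes "open S" "closed_segment (p 0) (q 0) \<subseteq> S" "isCont p 0" "isCont q 0"
  shows "\<forall>\<^sub>F t in nhds 0. closed_segment (p t) (q t) \<subseteq> S"
proof -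
  obtain d where d: "0 < d" "\<And>x y. x \<in> closed_segment (p 0) (q 0) \<Longrightarrow> y \<in> - S \<Longrightarrow> d \<le> dist x y"
    using separate_compact_closed[of "closed_segment (p 0) (q 0)" "- S"] assms(1,2)
    by (auto simp: closed_Compl disjoint_eq_subset_Compl)
  have "\<forall>\<^sub>F t in nhds 0. dist (r t) (r 0) < d" if "isCont r 0" for r :: "real \<Rightarrow> 'a"
    using that d(1) by (intro tendstoD) (auto simp: isCont_def tendsto_nhds_iff)
  from this[OF assms(3)] this[OF assms(4)] show ?thesis
  proof eventually_elim
    case (elim t)
    show ?case
    proof
      fix w assume "w \<in> closed_segment (p t) (q t)"
      then obtain s where s: "0 \<le> s" "s \<le> 1" "w = (1 - s) *\<^sub>R p t + s *\<^sub>R q t" by (auto simp: in_segment)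
      define w0 where "w0 = (1 - s) *\<^sub>R p 0 + s *\<^sub>R q 0"
      have w0: "w0 \<in> closed_segment (p 0) (q 0)" using s by (auto simp: w0_def in_segment)
      have "w - w0 = (1 - s) *\<^sub>R (p t - p 0) + s *\<^sub>R (q t - q 0)"
        by (simp add: s(3) w0_def algebra_simps)
      then have "dist w0 w = norm ((1 - s) *\<^sub>R (p t - p 0) + s *\<^sub>R (q t - q 0))"
        by (simp add: dist_norm norm_minus_commute[of w0])
      also have "\<dots> \<le> (1 - s) * norm (p t - p 0) + s * norm (q t - q 0)"
        using norm_triangle_ineq[of "(1 - s) *\<^sub>R (p t - p 0)" "s *\<^sub>R (q t - q 0)"] s by simp
      also have "\<dots> < d"
        using elim s by (intro convex_bound_lt) (auto simp: dist_norm)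
      finally have "dist w0 w < d" .
      then show "w \<in> S" using d(2)[OF w0, of w] by fastforce
    qed
  qed
qed

lemma ln_quotient_powr:
  fixes A B C K :: real
  assumes "0 < A" "0 < K" "0 < B" "0 < C"
  shows "ln (A * B * C powr \<epsilon> / (K * sqrt K)) = ln A - (3 / 2) * ln K + ln B + \<epsilon> * ln C"
  using assms by (simp add: ln_div ln_mult ln_powr ln_sqrt)

lemma spd_cauchy_schwarz:
  assumes "spd g"
  shows "(g a b)\<^sup>2 \<le> g a a * g b b"
proof (cases "b = 0")
  case False
  note bs = bilinear_simps[OF spd_bilinear[OF assms]]
  have b: "0 < g b b" using spd_pos[OF assms False] .
  have "0 \<le> g (g b b *\<^sub>R a - g a b *\<^sub>R b) (g b b *\<^sub>R a - g a b *\<^sub>R b)" by (rule spd_nonneg[OF assms])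
  also have "\<dots> = g b b * (g a a * g b b - (g a b)\<^sup>2)"
    by (simp add: bs spd_sym[OF assms, of b a] power2_eq_square algebra_simps)
  finally show ?thesis using b by (simp add: zero_le_mult_iff)
qed (simp add: bilinear_simps[OF spd_bilinear[OF assms]])

context hessian_domain
begin

lemma jet2_D:
  assumes "x \<in> N"
  shows "jet2 (\<lambda>t. D as (x + t *\<^sub>R v + t\<^sup>2 *\<^sub>R w)) (D as x) (D (v # as) x) (D (v # v # as) x + 2 * D (w # as) x)"
  using jet2_parabola[OF open_N smooth_D assms] unfolding D_Cons by simp

lemma eventually_parabola_in:
  assumes "x \<in> N"
  shows "\<forall>\<^sub>F t in nhds 0. x + t *\<^sub>R v + t\<^sup>2 *\<^sub>R w \<in> N"
proof -
  have "isCont (\<lambda>t. x + t *\<^sub>R v + t\<^sup>2 *\<^sub>R w) 0" by (intro continuous_intros)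
  then show ?thesis
    using assms open_N by (auto simp: isCont_def tendsto_nhds_iff[symmetric] intro!: topological_tendstoD[where l = x])
      (simp add: tendsto_nhds_iff topological_tendstoD)
qed

text \<open>With \<open>breg''\<close>, the first and second derivative of \<open>breg\<close> when
  the points follow parabolas with velocities \<open>v\<close>, \<open>v'\<close> and common
  second-order coefficient \<open>w\<close>; being common, it leaves the displacement
  \<open>y - x\<close> linear in \<open>t\<close>.\<close>

definition breg' where
  "breg' x y v v' = D [v', y - x] y - D [v, y - x] x + (D [v' - v] y - D [v' - v] x)"

definition breg'' where
  "breg'' x y v v' w = (D [v', v', y - x] y + 2 * D [w, y - x] y) - (D [v, v, y - x] x + 2 * D [w, y - x] x)
    + 2 * (D [v', v' - v] y - D [v, v' - v] x)"

lemma jet2_breg: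
  assumes "x \<in> N" "y \<in> N"
  shows "jet2 (\<lambda>t. breg (x + t *\<^sub>R v + t\<^sup>2 *\<^sub>R w) (y + t *\<^sub>R v' + t\<^sup>2 *\<^sub>R w))
    (breg x y) (breg' x y v v') (breg'' x y v v' w)"
proof (rule jet2_cong)
  let ?x = "\<lambda>t. x + t *\<^sub>R v + t\<^sup>2 *\<^sub>R w" and ?y = "\<lambda>t. y + t *\<^sub>R v' + t\<^sup>2 *\<^sub>R w"
  show "\<forall>\<^sub>F t in nhds 0. breg (?x t) (?y t) =
      (D [y - x] (?y t) + t * D [v' - v] (?y t)) - (D [y - x] (?x t) + t * D [v' - v] (?x t))"
    using eventually_parabola_in[OF assms(1), of v w] eventually_parabola_in[OF assms(2), of v' w]
  proof eventually_elim
    case (elim t)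
    have eq: "?y t - ?x t = (y - x) + t *\<^sub>R (v' - v)" by (simp add: algebra_simps)
    have "D [(y - x) + t *\<^sub>R (v' - v)] p = D [y - x] p + t * D [v' - v] p" if "p \<in> N" for p
      using linear_add[OF linear_D[OF that, of "[]" "[]"]] linear_cmul[OF linear_D[OF that, of "[]" "[]"]] by simp
    then show ?case using elim unfolding breg_eq_D eq by simp
  qed
  show "jet2 (\<lambda>t. (D [y - x] (?y t) + t * D [v' - v] (?y t)) - (D [y - x] (?x t) + t * D [v' - v] (?x t)))
    (breg x y) (breg' x y v v') (breg'' x y v v' w)"
    by (rule jet2_eqI, rule jet2_diff; (rule jet2_add[OF jet2_D jet2_mult[OF jet2_id jet2_D]])?)
      (use assms in \<open>simp_all add: breg_eq_D breg'_def breg''_def algebra_simps\<close>)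
qed

lemma D_expand2:
  assumes "x \<in> N"
  shows "D [e + t *\<^sub>R E, e + t *\<^sub>R E] x = D [e, e] x + t * (2 * D [e, E] x) + t\<^sup>2 * D [E, E] x"
proof -
  have b: "bilinear (\<lambda>a b. D [a, b] x)" using bilinear_D[OF assms, of "[]"] by simp
  have "D [E, e] x = D [e, E] x" by (rule D_permute[OF assms]) simp
  then show ?thesis by (simp add: bilinear_simps[OF b] power2_eq_square algebra_simps)
qed

lemma D_expand3:
  assumes "x \<in> N"
  shows "D [e + t *\<^sub>R E, e + t *\<^sub>R E, e + t *\<^sub>R E] x = D [e, e, e] x + t * (3 * D [e, e, E] x)
    + t\<^sup>2 * (3 * D [e, E, E] x) + t ^ 3 * D [E, E, E] x"
proof -
  have lin: "D [e + t *\<^sub>R E, a, b] x = D [e, a, b] x + t * D [E, a, b] x" for a b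
    using linear_add[OF linear_D[OF assms, of "[]" "[a, b]"]]
      linear_cmul[OF linear_D[OF assms, of "[]" "[a, b]"]] by simp
  have b: "bilinear (\<lambda>a b. D [c, a, b] x)" for c using bilinear_D[OF assms, of "[c]"] by simp
  have "D [e, E, e] x = D [e, e, E] x" "D [E, e, e] x = D [e, e, E] x"
    "D [E, e, E] x = D [e, E, E] x" "D [E, E, e] x = D [e, E, E] x"
    by (rule D_permute[OF assms]; simp)+
  then show ?thesis
    by (simp add: lin bilinear_simps[OF b] power2_eq_square power3_eq_cube algebra_simps)
qed

text \<open>Under the logarithm the factors separate: \<open>n\<close> belongs to the cubic form,
  \<open>k\<close> to the squared length of \<open>e\<close>, \<open>a\<close> to the action,
  \<open>\<eta>\<close> to the cut-off. The velocities \<open>V i\<close> and \<open>E\<close> are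
  left free, since several variations of one maximizer are later compared.\<close>

lemma maximizer_variation:
  assumes ad: "admissible z \<rho> a h m X e" and e1: "g (X m) e e = 1" and \<rho>: "0 < \<rho>"
    and pos: "0 < D [e, e, e] (X m)"
    and max: "\<And>m' Y e'. admissible z \<rho> a h m' Y e' \<Longrightarrow> objective z \<rho> a h \<epsilon> m' Y e' \<le> objective z \<rho> a h \<epsilon> m X e"
  fixes V :: "nat \<Rightarrow> real ^ 'n" and w E :: "real ^ 'n"
  defines "\<Theta> \<equiv> D [e, e, e] (X m)"
    and "n1 \<equiv> D [V m, e, e, e] (X m) + 3 * D [e, e, E] (X m)"
    and "n2 \<equiv> D [V m, V m, e, e, e] (X m) + 2 * D [w, e, e, e] (X m) + 6 * D [V m, e, e, E] (X m) + 6 * D [e, E, E] (X m)"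
    and "k1 \<equiv> D [V m, e, e] (X m) + 2 * D [e, E] (X m)"
    and "k2 \<equiv> D [V m, V m, e, e] (X m) + 2 * D [w, e, e] (X m) + 4 * D [V m, e, E] (X m) + 2 * D [E, E] (X m)"
    and "R \<equiv> a - action h m X"
    and "a1 \<equiv> (\<Sum>i<m. breg' (X i) (X (Suc i)) (V i) (V (Suc i))) / h"
    and "a2 \<equiv> (\<Sum>i<m. breg'' (X i) (X (Suc i)) (V i) (V (Suc i)) w) / h"
    and "\<eta> \<equiv> 1 - (norm (X 0 - z))\<^sup>2 / \<rho>\<^sup>2"
    and "\<eta>1 \<equiv> - 2 * ((X 0 - z) \<bullet> V 0) / \<rho>\<^sup>2"
    and "\<eta>2 \<equiv> - 2 * ((norm (V 0))\<^sup>2 + 2 * ((X 0 - z) \<bullet> w)) / \<rho>\<^sup>2"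
  shows "n1 / \<Theta> - (3 / 2) * k1 - a1 / R + \<epsilon> * (\<eta>1 / \<eta>) = 0"
    and "(n2 / \<Theta> - (n1 / \<Theta>)\<^sup>2) - (3 / 2) * (k2 - k1\<^sup>2) + (- a2 / R - (a1 / R)\<^sup>2)
      + \<epsilon> * (\<eta>2 / \<eta> - (\<eta>1 / \<eta>)\<^sup>2) \<le> 0"
proof -
  have ad': "1 \<le> m" "chain m X" "X 0 \<in> ball z \<rho>" "action h m X < a" "e \<noteq> 0"
    using ad by (auto simp: admissible_def)
  have XN: "X i \<in> N" if "i \<le> m" for i by (rule chain_in[OF ad'(2,1) that])
  define Y where "Y t i = X i + t *\<^sub>R V i + t\<^sup>2 *\<^sub>R w" for t i
  define et where "et t = e + t *\<^sub>R E" for t :: real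
  have YN: "\<forall>\<^sub>F t in nhds 0. Y t m \<in> N" unfolding Y_def by (rule eventually_parabola_in[OF XN]) simp
  have jN: "jet2 (\<lambda>t. D [et t, et t, et t] (Y t m)) \<Theta> n1 n2"
  proof (rule jet2_cong)
    show "\<forall>\<^sub>F t in nhds 0. D [et t, et t, et t] (Y t m) = D [e, e, e] (Y t m) + t * (3 * D [e, e, E] (Y t m))
        + t\<^sup>2 * (3 * D [e, E, E] (Y t m)) + t ^ 3 * D [E, E, E] (Y t m)"
      using YN by eventually_elim (simp add: et_def D_expand3)
    show "jet2 (\<lambda>t. D [e, e, e] (Y t m) + t * (3 * D [e, e, E] (Y t m))
        + t\<^sup>2 * (3 * D [e, E, E] (Y t m)) + t ^ 3 * D [E, E, E] (Y t m)) \<Theta> n1 n2"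
      unfolding Y_def
      by (rule jet2_eqI, rule jet2_add[OF jet2_add[OF jet2_add[OF jet2_D jet2_mult[OF jet2_id jet2_cmult[OF jet2_D]]]
              jet2_mult[OF jet2_power2 jet2_cmult[OF jet2_D]]] jet2_mult[OF jet2_power3 jet2_D]])
        (simp_all add: XN \<Theta>_def n1_def n2_def)
  qed
  have jK: "jet2 (\<lambda>t. g (Y t m) (et t) (et t)) 1 k1 k2"
  proof (rule jet2_cong)
    show "\<forall>\<^sub>F t in nhds 0. g (Y t m) (et t) (et t) = D [e, e] (Y t m) + t * (2 * D [e, E] (Y t m))
        + t\<^sup>2 * D [E, E] (Y t m)"
      using YN by eventually_elim (simp add: et_def D_expand2 g_eq_D)
    show "jet2 (\<lambda>t. D [e, e] (Y t m) + t * (2 * D [e, E] (Y t m)) + t\<^sup>2 * D [E, E] (Y t m)) 1 k1 k2"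
      unfolding Y_def
      by (rule jet2_eqI, rule jet2_add[OF jet2_add[OF jet2_D jet2_mult[OF jet2_id jet2_cmult[OF jet2_D]]]
              jet2_mult[OF jet2_power2 jet2_D]])
        (use e1 in \<open>simp_all add: XN k1_def k2_def g_eq_D\<close>)
  qed
  have jR: "jet2 (\<lambda>t. a - action h m (Y t)) R (- a1) (- a2)"
  proof -
    have "jet2 (\<lambda>t. \<Sum>i<m. 1 / h * breg (Y t i) (Y t (Suc i)) + h)
        (\<Sum>i<m. 1 / h * breg (X i) (X (Suc i)) + h)
        (\<Sum>i<m. 1 / h * breg' (X i) (X (Suc i)) (V i) (V (Suc i)) + 0)
        (\<Sum>i<m. 1 / h * breg'' (X i) (X (Suc i)) (V i) (V (Suc i)) w + 0)"
      unfolding Y_def by (intro jet2_sum jet2_add jet2_cmult jet2_const jet2_breg XN) auto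
    then have "jet2 (\<lambda>t. action h m (Y t)) (action h m X) a1 a2"
      by (simp add: action_def a1_def a2_def sum_divide_distrib)
    from jet2_diff[OF jet2_const[of a] this] show ?thesis by (simp add: R_def)
  qed
  have j\<eta>: "jet2 (\<lambda>t. 1 - (norm (Y t 0 - z))\<^sup>2 / \<rho>\<^sup>2) \<eta> \<eta>1 \<eta>2"
  proof -
    have "Y t 0 - z = (X 0 - z) + t *\<^sub>R V 0 + t\<^sup>2 *\<^sub>R w" for t by (simp add: Y_def)
    then have "jet2 (\<lambda>t. 1 - (1 / \<rho>\<^sup>2) * (norm (Y t 0 - z))\<^sup>2) (1 - (1 / \<rho>\<^sup>2) * (norm (X 0 - z))\<^sup>2)
        (0 - (1 / \<rho>\<^sup>2) * (2 * ((X 0 - z) \<bullet> V 0))) (0 - (1 / \<rho>\<^sup>2) * (2 * ((norm (V 0))\<^sup>2 + 2 * ((X 0 - z) \<bullet> w))))"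
      by (simp only:) (intro jet2_diff jet2_const jet2_cmult jet2_norm_parabola)
    then show ?thesis
      by (simp add: \<eta>_def \<eta>1_def \<eta>2_def diff_divide_distrib add_divide_distrib)
  qed
  have "0 < \<Theta>" using pos by (simp add: \<Theta>_def)
  have "0 < R" using ad'(4) by (simp add: R_def)
  have "norm (X 0 - z) < \<rho>" using ad'(3) by (simp add: dist_norm norm_minus_commute)
  then have "(norm (X 0 - z))\<^sup>2 < \<rho>\<^sup>2" by (intro power_strict_mono) auto
  then have "0 < \<eta>" using \<rho> by (simp add: \<eta>_def divide_less_eq)
  define f where "f t = ln (D [et t, et t, et t] (Y t m)) - (3 / 2) * ln (g (Y t m) (et t) (et t))
      + ln (a - action h m (Y t)) + \<epsilon> * ln (1 - (norm (Y t 0 - z))\<^sup>2 / \<rho>\<^sup>2)" for t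
  have jf: "jet2 f (ln \<Theta> - (3 / 2) * ln 1 + ln R + \<epsilon> * ln \<eta>)
      (n1 / \<Theta> - (3 / 2) * (k1 / 1) + (- a1) / R + \<epsilon> * (\<eta>1 / \<eta>))
      ((n2 / \<Theta> - (n1 / \<Theta>)\<^sup>2) - (3 / 2) * (k2 / 1 - (k1 / 1)\<^sup>2) + ((- a2) / R - ((- a1) / R)\<^sup>2)
        + \<epsilon> * (\<eta>2 / \<eta> - (\<eta>1 / \<eta>)\<^sup>2))"
    unfolding f_def
    using \<open>0 < \<Theta>\<close> \<open>0 < R\<close> \<open>0 < \<eta>\<close>
    by (intro jet2_add jet2_diff jet2_cmult jet2_ln jN jK jR j\<eta>) auto
  have ln_obj: "ln (objective z \<rho> a h \<epsilon> m (Y t) (et t)) = f t" and obj_pos: "0 < objective z \<rho> a h \<epsilon> m (Y t) (et t)"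
    if p: "0 < D [et t, et t, et t] (Y t m)" "0 < g (Y t m) (et t) (et t)" "0 < a - action h m (Y t)"
      "0 < 1 - (norm (Y t 0 - z))\<^sup>2 / \<rho>\<^sup>2" for t
  proof -
    have "0 < (1 - (norm (Y t 0 - z))\<^sup>2 / \<rho>\<^sup>2) powr \<epsilon>" using p(4) by (simp only: powr_gt_zero)
    then show "0 < objective z \<rho> a h \<epsilon> m (Y t) (et t)"
      unfolding objective_def using p(1-3) by (intro divide_pos_pos mult_pos_pos real_sqrt_gt_zero)
    show "ln (objective z \<rho> a h \<epsilon> m (Y t) (et t)) = f t"
      unfolding objective_def f_def using p by (intro ln_quotient_powr)
  qed
  have seg: "\<forall>\<^sub>F t in nhds 0. \<forall>i\<in>{..<m}. closed_segment (Y t i) (Y t (Suc i)) \<subseteq> N"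
  proof (rule eventually_ball_finite)
    show "\<forall>i\<in>{..<m}. \<forall>\<^sub>F t in nhds 0. closed_segment (Y t i) (Y t (Suc i)) \<subseteq> N"
      using ad'(2) unfolding Y_def
      by (intro ballI eventually_segment_subset open_N continuous_intros) (auto simp: chain_def)
  qed simp
  have p1: "\<forall>\<^sub>F t in nhds 0. 0 < D [et t, et t, et t] (Y t m)"
    by (rule order_tendstoD(1)[OF jet2_continuous[OF jN] \<open>0 < \<Theta>\<close>])
  have p2: "\<forall>\<^sub>F t in nhds 0. 0 < g (Y t m) (et t) (et t)"
    by (rule order_tendstoD(1)[OF jet2_continuous[OF jK]]) simp
  have p3: "\<forall>\<^sub>F t in nhds 0. 0 < a - action h m (Y t)"
    by (rule order_tendstoD(1)[OF jet2_continuous[OF jR] \<open>0 < R\<close>])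
  have p4: "\<forall>\<^sub>F t in nhds 0. 0 < 1 - (norm (Y t 0 - z))\<^sup>2 / \<rho>\<^sup>2"
    by (rule order_tendstoD(1)[OF jet2_continuous[OF j\<eta>] \<open>0 < \<eta>\<close>])
  have X0: "Y 0 = X" "et 0 = e" by (auto simp: Y_def et_def)
  have "\<forall>\<^sub>F t in nhds 0. f t \<le> f 0"
    using seg p1 p2 p3 p4 YN
  proof eventually_elim
    case (elim t)
    have "(norm (Y t 0 - z))\<^sup>2 < \<rho>\<^sup>2" using elim(5) \<rho> by (simp add: divide_less_eq)
    then have "norm (Y t 0 - z) < \<rho>" using \<rho> by (auto intro: power2_less_imp_less)
    moreover have "et t \<noteq> 0" using elim(3,6) bilinear_simps(9)[OF bilinear_g] by force
    ultimately have "admissible z \<rho> a h m (Y t) (et t)"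
      using elim ad'(1) by (auto simp: admissible_def chain_def dist_norm norm_minus_commute)
    then have "objective z \<rho> a h \<epsilon> m (Y t) (et t) \<le> objective z \<rho> a h \<epsilon> m (Y 0) (et 0)"
      using max by (simp add: X0)
    then have "ln (objective z \<rho> a h \<epsilon> m (Y t) (et t)) \<le> ln (objective z \<rho> a h \<epsilon> m (Y 0) (et 0))"
      using obj_pos[OF elim(2-5)] by simp
    then show ?case
      using ln_obj[OF elim(2-5)] ln_obj[OF eventually_nhds_x_imp_x[OF p1] eventually_nhds_x_imp_x[OF p2] eventually_nhds_x_imp_x[OF p3] eventually_nhds_x_imp_x[OF p4]] by simp
  qed
  from jet2_max[OF jf this]
  show "n1 / \<Theta> - (3 / 2) * k1 - a1 / R + \<epsilon> * (\<eta>1 / \<eta>) = 0"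
    and "(n2 / \<Theta> - (n1 / \<Theta>)\<^sup>2) - (3 / 2) * (k2 - k1\<^sup>2) + (- a2 / R - (a1 / R)\<^sup>2)
      + \<epsilon> * (\<eta>2 / \<eta> - (\<eta>1 / \<eta>)\<^sup>2) \<le> 0" by simp_all
qed

section \<open>Gradient of a short step in its end points\<close>

lemma metric_comparable:
  assumes "compact C" "C \<subseteq> N"
  obtains d where "0 < d" "\<And>x y b. x \<in> C \<Longrightarrow> y \<in> C \<Longrightarrow> dist x y < d \<Longrightarrow> g x b b \<le> 2 * g y b b"
proof -
  obtain l L where l: "0 < l" "\<And>x b. x \<in> C \<Longrightarrow> l * (norm b)\<^sup>2 \<le> g x b b"
    using g_bounds[OF assms] by metis
  define S where "S = C \<times> sphere (0 :: real ^ 'n) 1"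
  have "continuous_on S (\<lambda>p. g (fst p) (snd p) (snd p))"
    by (rule continuous_on_g) (use assms(2) in \<open>auto simp: S_def intro!: continuous_intros\<close>)
  moreover have "compact S" unfolding S_def by (intro compact_Times assms(1) compact_sphere)
  ultimately have "uniformly_continuous_on S (\<lambda>p. g (fst p) (snd p) (snd p))"
    by (rule compact_uniformly_continuous)
  then obtain d where d: "0 < d" "\<And>p q. p \<in> S \<Longrightarrow> q \<in> S \<Longrightarrow> dist q p < d \<Longrightarrow>
      dist (g (fst q) (snd q) (snd q)) (g (fst p) (snd p) (snd p)) < l"
    using l(1) unfolding uniformly_continuous_on_def by metis
  show ?thesis
  proof (rule that[OF d(1)])
    fix x y b assume xy: "x \<in> C" "y \<in> C" "dist x y < d"
    have N: "x \<in> N" "y \<in> N" using xy assms(2) by auto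
    show "g x b b \<le> 2 * g y b b"
    proof (cases "b = 0")
      case False
      define b1 where "b1 = (1 / norm b) *\<^sub>R b"
      have "norm b1 = 1" using False by (simp add: b1_def)
      then have "dist (g x b1 b1) (g y b1 b1) < l"
        using d(2)[of "(y, b1)" "(x, b1)"] xy by (simp add: S_def dist_Pair_Pair)
      moreover have "l \<le> g y b1 b1" using l(2)[OF xy(2), of b1] \<open>norm b1 = 1\<close> by simp
      ultimately have "g x b1 b1 \<le> 2 * g y b1 b1" by (simp add: dist_real_def)
      then have "g x b b / (norm b)\<^sup>2 \<le> 2 * g y b b / (norm b)\<^sup>2"
        by (simp add: b1_def bilinear_simps[OF bilinear_g[OF N(1)]] bilinear_simps[OF bilinear_g[OF N(2)]] power2_eq_square)
      then show ?thesis using False by (simp add: divide_le_cancel)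
    qed (use N in \<open>simp add: bilinear_simps[OF bilinear_g]\<close>)
  qed
qed

text \<open>Up to sign this is the derivative of \<open>breg\<close> when one end moves in the unit
  direction \<open>b\<close>. A short step lets \<open>g\<close> vary by a factor of at most 2, and
  Cauchy-Schwarz bounds the two summands by \<open>2 h\<close> and \<open>4 h\<close>.\<close>

lemma step_gradient:
  assumes "compact C" "C \<subseteq> N"
  obtains h0 where "0 < h0" "\<And>h x y w b. 0 < h \<Longrightarrow> h < h0 \<Longrightarrow> closed_segment x y \<subseteq> C \<Longrightarrow>
    breg x y \<le> 2 * h\<^sup>2 \<Longrightarrow> w \<in> closed_segment x y \<Longrightarrow> g w b b = 1 \<Longrightarrow>
    \<bar>D [b, y - x] w + (D [b] y - D [b] x)\<bar> \<le> 6 * h"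
proof -
  obtain d where d: "0 < d" "\<And>x y b. x \<in> C \<Longrightarrow> y \<in> C \<Longrightarrow> dist x y < d \<Longrightarrow> g x b b \<le> 2 * g y b b"
    using metric_comparable[OF assms] by blast
  obtain l0 L where l0: "0 < l0" "\<And>x b. x \<in> C \<Longrightarrow> l0 * (norm b)\<^sup>2 \<le> g x b b"
    using g_bounds[OF assms] by metis
  define l where "l = sqrt l0"
  have l: "0 < l" "\<And>x b. x \<in> C \<Longrightarrow> l\<^sup>2 * (norm b)\<^sup>2 \<le> g x b b" using l0 by (auto simp: l_def)
  show ?thesis
  \<comment> \<open>Puts the Euclidean length of the step, at most \<open>2 h / l\<close>, below the
    comparability radius \<open>d\<close>.\<close>
  proof (rule that[of "d * l / 2"])
    show "0 < d * l / 2" using d l by simp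
    fix h x y w b
    assume h: "0 < h" "h < d * l / 2" and seg: "closed_segment x y \<subseteq> C" and br: "breg x y \<le> 2 * h\<^sup>2"
      and w: "w \<in> closed_segment x y" and b: "g w b b = 1"
    have segN: "closed_segment x y \<subseteq> N" using seg assms(2) by blast
    have "norm (y - x) \<le> sqrt (breg x y) / l" using l seg by (intro segment_euclidean segN) auto
    also have "\<dots> \<le> sqrt ((2 * h)\<^sup>2) / l"
    proof (intro divide_right_mono real_sqrt_le_mono)
      have "(2 * h)\<^sup>2 = 4 * h\<^sup>2" by (simp add: power_mult_distrib)
      then show "breg x y \<le> (2 * h)\<^sup>2" using br zero_le_power2[of h] by linarith
    qed (use l in simp)
    also have "\<dots> = 2 * h / l" unfolding real_sqrt_abs using h by simp
    also have "\<dots> < d" using h l by (simp add: field_simps)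
    finally have short: "norm (y - x) < d" .
    have cmp: "g p c c \<le> 2 * g q c c" if pq: "p \<in> closed_segment x y" "q \<in> closed_segment x y" for p q c
    proof -
      obtain s where s: "0 \<le> s" "s \<le> 1" "p = (1 - s) *\<^sub>R x + s *\<^sub>R y"
        using pq(1) unfolding in_segment by metis
      obtain s' where s': "0 \<le> s'" "s' \<le> 1" "q = (1 - s') *\<^sub>R x + s' *\<^sub>R y"
        using pq(2) unfolding in_segment by metis
      have "p - q = (s - s') *\<^sub>R (y - x)" unfolding s(3) s'(3) by (simp add: algebra_simps)
      then have "dist p q = \<bar>s - s'\<bar> * norm (y - x)" by (simp add: dist_norm)
      also have "\<dots> \<le> 1 * norm (y - x)" using s s' by (intro mult_right_mono) auto
      finally have "dist p q \<le> norm (y - x)" by simp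
      then have "dist p q < d" using short by linarith
      moreover have "p \<in> C" "q \<in> C" using pq seg by auto
      ultimately show ?thesis by (intro d(2))
    qed
    have pt: "x + t *\<^sub>R (y - x) \<in> closed_segment x y" if "0 < t" "t < 1" for t
      using that by (intro in_closed_segmentI) auto
    obtain t where t: "0 < t" "t < 1" "breg x y = g (x + t *\<^sub>R (y - x)) (y - x) (y - x)"
      by (rule breg_MVT[OF segN])
    have ga: "g p (y - x) (y - x) \<le> 4 * h\<^sup>2" if "p \<in> closed_segment x y" for p
      using cmp[OF that pt[OF t(1,2)], of "y - x"] t(3) br by linarith
    have "(g w b (y - x))\<^sup>2 \<le> g w b b * g w (y - x) (y - x)"
      using w segN by (intro spd_cauchy_schwarz spd_g) auto
    also have "\<dots> \<le> (2 * h)\<^sup>2" using ga[OF w] b by (simp add: power_mult_distrib)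
    finally have "\<bar>g w b (y - x)\<bar> \<le> \<bar>2 * h\<bar>" by (simp only: abs_le_square_iff)
    then have 1: "\<bar>g w b (y - x)\<bar> \<le> 2 * h" using h by simp
    have "\<exists>s>0. s < 1 \<and> D [b] (x + 1 *\<^sub>R (y - x)) - D [b] (x + 0 *\<^sub>R (y - x))
        = (1 - 0) * D [y - x, b] (x + s *\<^sub>R (y - x))"
      by (rule MVT2) (use D_line_derivative in_segmentI[OF segN] in auto)
    then obtain s where s: "0 < s" "s < 1" "D [b] y - D [b] x = g (x + s *\<^sub>R (y - x)) (y - x) b"
      by (auto simp: g_eq_D)
    define p where "p = x + s *\<^sub>R (y - x)"
    have p: "p \<in> closed_segment x y" using pt[OF s(1,2)] by (simp add: p_def)
    have "(g p (y - x) b)\<^sup>2 \<le> g p (y - x) (y - x) * g p b b"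
      using p segN by (intro spd_cauchy_schwarz spd_g) auto
    also have "\<dots> \<le> (4 * h\<^sup>2) * 2"
      using ga[OF p] cmp[OF p w, of b] b g_nonneg[of p b] p segN by (intro mult_mono) auto
    also have "\<dots> \<le> (4 * h)\<^sup>2" by (simp add: power_mult_distrib)
    finally have "\<bar>g p (y - x) b\<bar> \<le> \<bar>4 * h\<bar>" by (simp only: abs_le_square_iff)
    then have 2: "\<bar>g p (y - x) b\<bar> \<le> 4 * h" using h by simp
    show "\<bar>D [b, y - x] w + (D [b] y - D [b] x)\<bar> \<le> 6 * h"
      using 1 2 s(3) by (simp add: p_def g_eq_D)
  qed
qed

end


subsection \<open>Vanishing of the third derivatives\<close>

context hessian_domain
begin

lemma D_zero: "x \<in> N \<Longrightarrow> D (bs @ 0 # cs) x = 0"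
  using linear_0[OF linear_D] by blast

lemma D_neg: "x \<in> N \<Longrightarrow> D (bs @ (- a) # cs) x = - D (bs @ a # cs) x"
  using linear_neg[OF linear_D] by blast

text \<open>Maximality is tested at \<open>e + k\<close> and \<open>e - k\<close>, with
  \<open>k\<close> a unit vector orthogonal to \<open>e\<close>. Adding cancels the odd term and
  bounds \<open>D [e, k, k]\<close>; the part of \<open>w\<close> along \<open>e\<close> is governed
  by \<open>crit\<close>.\<close>

lemma cubic_form_sup:
  assumes x: "x \<in> N" and e: "g x e e = 1" and "0 < \<Theta>" and \<Theta>: "D [e, e, e] x = \<Theta>"
    and crit: "\<And>w. D [e, e, w] x = \<Theta> * g x e w"
    and max: "\<And>a. a \<noteq> 0 \<Longrightarrow> D [a, a, a] x \<le> \<Theta> * (g x a a * sqrt (g x a a))"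
  shows "D [e, w, w] x \<le> \<Theta> * g x w w"
proof -
  note bg = bilinear_simps[OF bilinear_g[OF x]]
  have "bilinear (\<lambda>a b. D [e, a, b] x)" using bilinear_D[OF x, of "[e]"] by simp
  note bT = bilinear_simps[OF this]
  have max0: "D [a, a, a] x \<le> \<Theta> * (g x a a * sqrt (g x a a))" for a
    using max[of a] D_zero[OF x, of "[]" "[0, 0]"] by (cases "a = 0") (auto simp: bg)
  define r where "r = g x e w"
  define f where "f = w - r *\<^sub>R e"
  have ef: "g x e f = 0" "g x f e = 0" using e g_sym[OF x, of w e] by (simp_all add: f_def bg r_def)
  have main: "D [e, f, f] x \<le> \<Theta> * g x f f"
  proof (cases "f = 0")
    case True
    then show ?thesis by (simp add: bg bT)
  next
    case False
    define s where "s = sqrt (g x f f)"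
    have s: "0 < s" "s\<^sup>2 = g x f f" using g_pos[OF x False] by (auto simp: s_def)
    define k where "k = (1 / s) *\<^sub>R f"
    have "g x k k = g x f f / s\<^sup>2" by (simp add: k_def bg power2_eq_square)
    then have kk: "g x k k = 1" unfolding s(2)[symmetric] using s(1) by simp
    have ek: "g x e k = 0" "g x k e = 0" using ef by (simp_all add: k_def bg)
    have ex: "D [e + t *\<^sub>R k, e + t *\<^sub>R k, e + t *\<^sub>R k] x = \<Theta> + t\<^sup>2 * (3 * D [e, k, k] x) + t ^ 3 * D [k, k, k] x" for t
      using D_expand3[OF x, of e t k] crit[of k] by (simp add: \<Theta> ek)
    have gt: "g x (e + t *\<^sub>R k) (e + t *\<^sub>R k) = 1 + t\<^sup>2" for t
      using e by (simp add: bg ek kk power2_eq_square)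
    have "\<Theta> + 3 * D [e, k, k] x + D [k, k, k] x \<le> \<Theta> * (2 * sqrt 2)"
      using max0[of "e + 1 *\<^sub>R k"] unfolding ex gt by simp
    moreover have "\<Theta> + 3 * D [e, k, k] x - D [k, k, k] x \<le> \<Theta> * (2 * sqrt 2)"
      using max0[of "e + (-1) *\<^sub>R k"] unfolding ex gt by simp
    ultimately have "6 * D [e, k, k] x \<le> \<Theta> * (4 * sqrt 2 - 2)" by (simp add: algebra_simps)
    \<comment> \<open>The test vectors have squared length 2, whence \<open>sqrt 2\<close>; here the
      crude \<open>sqrt 2 \<le> 2\<close> is enough.\<close>
    also have "\<dots> \<le> \<Theta> * 6"
    proof -
      have "sqrt 2 \<le> sqrt (2\<^sup>2)" by (intro real_sqrt_le_mono) simp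
      then show ?thesis using \<open>0 < \<Theta>\<close> by simp
    qed
    finally have "s\<^sup>2 * D [e, k, k] x \<le> s\<^sup>2 * \<Theta>" by (intro mult_left_mono) auto
    moreover have "D [e, f, f] x = s\<^sup>2 * D [e, k, k] x" using s(1) by (simp add: k_def bT power2_eq_square)
    ultimately show ?thesis unfolding s(2) by (simp add: mult.commute)
  qed
  have w: "w = r *\<^sub>R e + f" by (simp add: f_def)
  have "D [e, e, f] x = 0" using crit[of f] ef by simp
  moreover have "D [e, f, e] x = D [e, e, f] x" by (rule D_permute[OF x]) simp
  ultimately have "D [e, w, w] x = r\<^sup>2 * \<Theta> + D [e, f, f] x"
    unfolding w by (simp add: bT \<Theta> power2_eq_square)
  moreover have "g x w w = r\<^sup>2 + g x f f"
    unfolding w using e by (simp add: bg ef power2_eq_square)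
  ultimately show ?thesis using main by (simp add: algebra_simps)
qed

text \<open>\<open>c1\<close>, \<open>c2\<close> bound the generator of \<open>- ln \<eta>\<close>, where \<open>\<eta> x = 1 - (|x - z| / \<rho>)\<^sup>2\<close>, by its squared gradient.\<close>

definition barrier_constants :: "real ^ 'n \<Rightarrow> real \<Rightarrow> real ^ 'n \<Rightarrow> real \<Rightarrow> real \<Rightarrow> bool" where
  "barrier_constants z \<rho> w c1 c2 \<longleftrightarrow> 0 \<le> c1 \<and> 0 \<le> c2 \<and> (\<forall>x (V :: 'n \<Rightarrow> real ^ 'n) \<eta>. x \<in> ball z \<rho> \<longrightarrow> frame (g x) V \<longrightarrow> \<eta> = 1 - (norm (x - z))\<^sup>2 / \<rho>\<^sup>2 \<longrightarrow>
      (\<Sum>i\<in>UNIV. (- 2 * ((x - z) \<bullet> V i) / \<rho>\<^sup>2 / \<eta>)\<^sup>2 - (- 2 * ((norm (V i))\<^sup>2 + 2 * ((x - z) \<bullet> w)) / \<rho>\<^sup>2) / \<eta>)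
      \<le> c1 + c2 * (\<Sum>i\<in>UNIV. (- 2 * ((x - z) \<bullet> V i) / \<rho>\<^sup>2 / \<eta>)\<^sup>2))"

text \<open>Where \<open>\<eta>\<close> is at least 1/2, the factor \<open>1 / \<eta>\<close> is
  bounded. Near the sphere the squared gradient grows like \<open>1 / \<eta>\<^sup>2\<close> and
  absorbs the other terms, which grow only like \<open>1 / \<eta>\<close>.\<close>

lemma barrier_constants_exist:
  assumes \<rho>: "cball z \<rho> \<subseteq> N" "0 < \<rho>"
  shows "\<exists>c1 c2. barrier_constants z \<rho> w c1 c2"
proof -
  obtain l L where l: "0 < l" and L: "0 < L" and lL: "\<And>x a. x \<in> cball z \<rho> \<Longrightarrow> l * (norm a)\<^sup>2 \<le> g x a a"
    "\<And>x a. x \<in> cball z \<rho> \<Longrightarrow> g x a a \<le> L * (norm a)\<^sup>2"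
    using g_bounds[OF compact_cball \<rho>(1)] by metis
  define n where "n = real CARD('n)"
  define K1 where "K1 = 2 * (1 / l + 2 * (\<rho> * norm w)) / \<rho>\<^sup>2"
  define K2 where "K2 = L * \<rho>\<^sup>2 / 2"
  have K: "0 \<le> K1" "0 \<le> K2" using l L \<rho>(2) by (auto simp: K1_def K2_def)
  have "barrier_constants z \<rho> w (2 * n * K1) (n * K1 * K2 + 1)"
    unfolding barrier_constants_def
  proof (intro conjI allI impI)
    fix x :: "real ^ 'n" and V :: "'n \<Rightarrow> real ^ 'n" and \<eta>
    assume x: "x \<in> ball z \<rho>" and V: "frame (g x) V" and \<eta>_def: "\<eta> = 1 - (norm (x - z))\<^sup>2 / \<rho>\<^sup>2"
    have xN: "x \<in> N" and xc: "x \<in> cball z \<rho>" using x \<rho>(1) by auto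
    have nx: "norm (x - z) < \<rho>" using x by (simp add: dist_norm norm_minus_commute)
    then have "(norm (x - z))\<^sup>2 < \<rho>\<^sup>2" by (intro power_strict_mono) auto
    then have \<eta>: "0 < \<eta>" "\<eta> \<le> 1" using \<rho>(2) by (auto simp: \<eta>_def divide_less_eq)
    define c where "c = x - z"
    define S where "S = (\<Sum>i\<in>UNIV. (c \<bullet> V i)\<^sup>2)"
    define \<Sigma> where "\<Sigma> = (\<Sum>i\<in>UNIV. (- 2 * (c \<bullet> V i) / \<rho>\<^sup>2 / \<eta>)\<^sup>2)"
    have \<Sigma>_eq: "\<Sigma> = 4 * S / (\<rho>\<^sup>2 * \<eta>)\<^sup>2"
      by (simp add: \<Sigma>_def S_def power_divide power_mult_distrib sum_distrib_left sum_divide_distrib)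
    have "0 \<le> S" by (simp add: S_def sum_nonneg)
    then have "0 \<le> \<Sigma>" by (simp add: \<Sigma>_eq)
    \<comment> \<open>Keeps the gradient from being small near the sphere; obtained by
      Cauchy-Schwarz between the coefficients \<open>g x c (V i)\<close> and the products of
      \<open>c\<close> with \<open>V i\<close>.\<close>
    have c_le: "(norm c)\<^sup>2 \<le> L * S"
    proof -
      have "c = (\<Sum>i\<in>UNIV. g x c (V i) *\<^sub>R V i)" by (rule frame_expand[OF bilinear_g[OF xN] V])
      then have "(norm c)\<^sup>2 = (\<Sum>i\<in>UNIV. g x c (V i) * (c \<bullet> V i))"
        by (metis (no_types, lifting) inner_scaleR_right inner_sum_right power2_norm_eq_inner sum.cong)
      then have "((norm c)\<^sup>2)\<^sup>2 \<le> (\<Sum>i\<in>UNIV. (g x c (V i))\<^sup>2) * S"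
        unfolding S_def using Cauchy_Schwarz_ineq_sum[of "\<lambda>i. g x c (V i)" "\<lambda>i. c \<bullet> V i" UNIV] by simp
      also have "(\<Sum>i\<in>UNIV. (g x c (V i))\<^sup>2) = g x c c"
        using frame_parseval[OF bilinear_g[OF xN] V, of c c] g_sym[OF xN, of "V _" c]
        by (simp add: power2_eq_square)
      also have "g x c c * S \<le> (L * (norm c)\<^sup>2) * S"
        using lL(2)[OF xc] \<open>0 \<le> S\<close> by (intro mult_right_mono) auto
      finally have "(norm c)\<^sup>2 * (norm c)\<^sup>2 \<le> (norm c)\<^sup>2 * (L * S)"
        by (simp add: power2_eq_square mult_ac)
      then show ?thesis
        using \<open>0 \<le> S\<close> L mult_le_cancel_left_pos[of "(norm c)\<^sup>2" "(norm c)\<^sup>2" "L * S"] by (cases "c = 0") simp_all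
    qed
    have inv: "1 / \<eta> \<le> 2 + K2 * \<Sigma>"
    proof (cases "1 / 2 \<le> \<eta>")
      case True
      then have "1 / \<eta> \<le> 2" by (simp add: divide_le_eq)
      then show ?thesis using K(2) \<open>0 \<le> \<Sigma>\<close> mult_nonneg_nonneg[of K2 \<Sigma>] by linarith
    next
      case False
      have "(norm c)\<^sup>2 = \<rho>\<^sup>2 * (1 - \<eta>)" using \<rho>(2) by (simp add: \<eta>_def c_def)
      moreover have "\<rho>\<^sup>2 * (1 / 2) \<le> \<rho>\<^sup>2 * (1 - \<eta>)" using False by (intro mult_left_mono) auto
      ultimately have "\<rho>\<^sup>2 \<le> 2 * (L * S)" using c_le by linarith
      then have "\<rho>\<^sup>2 * \<rho>\<^sup>2 \<le> \<rho>\<^sup>2 * (2 * (L * S))" by (intro mult_left_mono) auto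
      moreover have "K2 * \<Sigma> = \<rho>\<^sup>2 * (2 * (L * S)) / (\<rho>\<^sup>2 * \<rho>\<^sup>2 * \<eta>\<^sup>2)"
        by (simp add: K2_def \<Sigma>_eq power_mult_distrib power2_eq_square)
      ultimately have "\<rho>\<^sup>2 * \<rho>\<^sup>2 / (\<rho>\<^sup>2 * \<rho>\<^sup>2 * \<eta>\<^sup>2) \<le> K2 * \<Sigma>"
        by (simp only:) (intro divide_right_mono, auto)
      then have "1 / \<eta>\<^sup>2 \<le> K2 * \<Sigma>" using \<rho>(2) by simp
      moreover have "1 / \<eta> \<le> 1 / \<eta>\<^sup>2" using \<eta> by (simp add: power2_eq_square field_simps)
      ultimately show ?thesis by linarith
    qed
    have each: "- (- 2 * ((norm (V i))\<^sup>2 + 2 * (c \<bullet> w)) / \<rho>\<^sup>2) / \<eta> \<le> K1 * (1 / \<eta>)" for i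
    proof -
      have "l * (norm (V i))\<^sup>2 \<le> 1" using lL(1)[OF xc, of "V i"] V by (simp add: frame_def)
      then have "(norm (V i))\<^sup>2 \<le> 1 / l" using l by (simp add: field_simps)
      moreover have "c \<bullet> w \<le> \<rho> * norm w"
      proof (rule order_trans[OF norm_cauchy_schwarz])
        show "norm c * norm w \<le> \<rho> * norm w" using nx by (intro mult_right_mono) (auto simp: c_def)
      qed
      ultimately have "2 * ((norm (V i))\<^sup>2 + 2 * (c \<bullet> w)) \<le> 2 * (1 / l + 2 * (\<rho> * norm w))"
        by (intro mult_left_mono add_mono) simp_all
      then have "2 * ((norm (V i))\<^sup>2 + 2 * (c \<bullet> w)) / \<rho>\<^sup>2 / \<eta> \<le> K1 / \<eta>"
        unfolding K1_def using \<eta> by (intro divide_right_mono) auto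
      moreover have "- (- 2 * q / \<rho>\<^sup>2) / \<eta> = 2 * q / \<rho>\<^sup>2 / \<eta>" for q by simp
      ultimately show ?thesis by (simp only: times_divide_eq_right mult_1_right)
    qed
    have "(\<Sum>i\<in>UNIV. (- 2 * (c \<bullet> V i) / \<rho>\<^sup>2 / \<eta>)\<^sup>2 - (- 2 * ((norm (V i))\<^sup>2 + 2 * (c \<bullet> w)) / \<rho>\<^sup>2) / \<eta>)
        = \<Sigma> + (\<Sum>i\<in>UNIV. - (- 2 * ((norm (V i))\<^sup>2 + 2 * (c \<bullet> w)) / \<rho>\<^sup>2) / \<eta>)"
      by (simp add: \<Sigma>_def sum.distrib[symmetric])
    also have "\<dots> \<le> \<Sigma> + (\<Sum>i\<in>(UNIV :: 'n set). K1 * (1 / \<eta>))" by (intro add_left_mono sum_mono each)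
    also have "\<dots> = \<Sigma> + (n * K1) * (1 / \<eta>)" by (simp add: n_def)
    also have "\<dots> \<le> \<Sigma> + (n * K1) * (2 + K2 * \<Sigma>)"
      using inv K(1) by (intro add_left_mono mult_left_mono) (auto simp: n_def)
    also have "\<dots> = 2 * n * K1 + (n * K1 * K2 + 1) * \<Sigma>" by (simp add: algebra_simps)
    finally show "(\<Sum>i\<in>UNIV. (- 2 * ((x - z) \<bullet> V i) / \<rho>\<^sup>2 / \<eta>)\<^sup>2
        - (- 2 * ((norm (V i))\<^sup>2 + 2 * ((x - z) \<bullet> w)) / \<rho>\<^sup>2) / \<eta>)
      \<le> 2 * n * K1 + (n * K1 * K2 + 1) * (\<Sum>i\<in>UNIV. (- 2 * ((x - z) \<bullet> V i) / \<rho>\<^sup>2 / \<eta>)\<^sup>2)"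
      by (simp only: c_def \<Sigma>_def)
  qed (use K in \<open>auto simp: n_def\<close>)
  then show ?thesis by blast
qed

text \<open>Frames are passed on from point to point, so that each consecutive pair is coupled as
  \<open>coupled_bregman\<close> demands.\<close>

lemma coupled_frames_along:
  assumes "\<And>i. i \<le> m \<Longrightarrow> X i \<in> N"
  obtains F :: "nat \<Rightarrow> 'n \<Rightarrow> real ^ 'n" where "\<And>i. i \<le> m \<Longrightarrow> frame (g (X i)) (F i)"
    "\<And>i. i < m \<Longrightarrow> (\<Sum>j\<in>UNIV. g (X i) (F (Suc i) j) (F i j) + g (X (Suc i)) (F (Suc i) j) (F i j))
      \<ge> 2 * real CARD('n)"
proof -
  have "\<exists>F :: nat \<Rightarrow> 'n \<Rightarrow> real ^ 'n. \<forall>i. (i \<le> m \<longrightarrow> frame (g (X i)) (F i)) \<and>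
    (i < m \<longrightarrow> (\<Sum>j\<in>UNIV. g (X i) (F (Suc i) j) (F i j) + g (X (Suc i)) (F (Suc i) j) (F i j))
      \<ge> 2 * real CARD('n))"
  proof (rule dependent_nat_choice)
    have "X 0 \<in> N" using assms[of 0] by simp
    then obtain V :: "'n \<Rightarrow> real ^ 'n" where "frame (g (X 0)) V" by (rule frame_exists[OF spd_g])
    then show "\<exists>x. 0 \<le> m \<longrightarrow> frame (g (X 0)) (x :: 'n \<Rightarrow> real ^ 'n)" by blast
  next
    fix V :: "'n \<Rightarrow> real ^ 'n" and i
    assume V: "i \<le> m \<longrightarrow> frame (g (X i)) V"
    show "\<exists>V'. (Suc i \<le> m \<longrightarrow> frame (g (X (Suc i))) V') \<and>
      (i < m \<longrightarrow> 2 * real CARD('n) \<le> (\<Sum>j\<in>UNIV. g (X i) (V' j) (V j) + g (X (Suc i)) (V' j) (V j)))"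
    proof (cases "i < m")
      case True
      then obtain V' where "frame (g (X (Suc i))) V'"
        "2 * real CARD('n) \<le> (\<Sum>j\<in>UNIV. g (X i) (V' j) (V j) + g (X (Suc i)) (V' j) (V j))"
        using coupled_frame[OF spd_g spd_g, of "X i" "X (Suc i)" V] assms V by auto
      then show ?thesis by blast
    qed auto
  qed
  then show ?thesis using that by blast
qed

lemma breg'_zero: "x \<in> N \<Longrightarrow> y \<in> N \<Longrightarrow> breg' x y 0 0 = 0"
  using D_zero[of _ "[]"] by (simp add: breg'_def)

text \<open>When one end of a step moves alone, the derivative takes the form bounded in
  \<open>step_gradient\<close>.\<close>

lemma breg'_end: "x \<in> N \<Longrightarrow> y \<in> N \<Longrightarrow> breg' x y 0 b = D [b, y - x] y + (D [b] y - D [b] x)"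
  using D_zero[of x "[]" "[y - x]"] by (simp add: breg'_def)

lemma breg'_start: "x \<in> N \<Longrightarrow> y \<in> N \<Longrightarrow> breg' x y b 0 = - (D [b, y - x] x + (D [b] y - D [b] x))"
  using D_zero[of y "[]" "[y - x]"] D_neg[of x "[]" b "[]"] D_neg[of y "[]" b "[]"] by (simp add: breg'_def)

end

context monge_ampere
begin

text \<open>Four kinds of variation of one maximizer are combined: \<open>e\<close> alone, the end
  point, the start point, and all points along coupled frames. Each end gradient is bounded by 6,
  that of the action by 12, both over \<open>R\<close>; thus
  \<open>720 = 4 * (6\<^sup>2 + 12\<^sup>2)\<close> and \<open>36 = 6\<^sup>2\<close>.\<close>

lemma third_derivative_bound:
  assumes complete: "riemannian_complete N (hessian u)" and \<rho>: "cball z \<rho> \<subseteq> N" "0 < \<rho>"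
    and e0: "0 < D [e0, e0, e0] z"
    and bar: "barrier_constants z \<rho> drift c1 c2"
    and "0 < a"
  shows "(D [e0, e0, e0] z / (g z e0 e0 * sqrt (g z e0 e0)) * (a / 2))\<^sup>2
    \<le> 720 * real CARD('n) + 4 * (c1 + 36 * real CARD('n) * c2) * a"
proof -
  have c: "0 \<le> c1" "0 \<le> c2" using bar by (auto simp: barrier_constants_def)
  define n where "n = real CARD('n)"
  define \<epsilon> where "\<epsilon> = 1 / a"
  have \<epsilon>: "0 < \<epsilon>" using \<open>0 < a\<close> by (simp add: \<epsilon>_def)
  obtain C where C: "compact C" "C \<subseteq> N"
    "\<And>h m X i. 0 < h \<Longrightarrow> chain m X \<Longrightarrow> X 0 \<in> cball z \<rho> \<Longrightarrow> action h m X \<le> a \<Longrightarrow> i < m \<Longrightarrow>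
      closed_segment (X i) (X (Suc i)) \<subseteq> C"
    using chains_in_compact[OF complete \<rho>, of a] by blast
  obtain h0 where h0: "0 < h0" "\<And>h x y w b. 0 < h \<Longrightarrow> h < h0 \<Longrightarrow> closed_segment x y \<subseteq> C \<Longrightarrow>
    breg x y \<le> 2 * h\<^sup>2 \<Longrightarrow> w \<in> closed_segment x y \<Longrightarrow> g w b b = 1 \<Longrightarrow>
    \<bar>D [b, y - x] w + (D [b] y - D [b] x)\<bar> \<le> 6 * h"
    using step_gradient[OF C(1,2)] by blast
  \<comment> \<open>Below \<open>h0\<close> for the gradient bound; at most \<open>a / 2\<close> so
    that the one-step constant chain at \<open>z\<close>, of action \<open>h\<close>, keeps at least
    \<open>a / 2\<close>.\<close>
  define h where "h = min (h0 / 2) (a / 2)"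
  have h: "0 < h" "h < h0" "h \<le> a / 2" "h < a" using h0(1) \<open>0 < a\<close> by (auto simp: h_def)
  obtain m X e where ad: "admissible z \<rho> a h m X e" and e1: "g (X m) e e = 1"
    and start: "objective z \<rho> a h \<epsilon> 1 (\<lambda>_. z) e0 \<le> objective z \<rho> a h \<epsilon> m X e"
    and Dpos: "0 < D [e, e, e] (X m)" and Fpos: "0 < objective z \<rho> a h \<epsilon> m X e"
    and max: "\<And>m' Y e'. admissible z \<rho> a h m' Y e' \<Longrightarrow> objective z \<rho> a h \<epsilon> m' Y e' \<le> objective z \<rho> a h \<epsilon> m X e"
    using maximizer_exists[OF complete \<rho> h(1,4) \<epsilon> e0] by blast
  have ad': "1 \<le> m" "chain m X" "X 0 \<in> ball z \<rho>" "action h m X < a" "e \<noteq> 0"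
    using ad by (auto simp: admissible_def)
  have XN: "X i \<in> N" if "i \<le> m" for i by (rule chain_in[OF ad'(2,1) that])
  have XmN: "X m \<in> N" using XN by simp
  have segC: "closed_segment (X i) (X (Suc i)) \<subseteq> C" if "i < m" for i
    using C(3)[OF h(1) ad'(2) _ _ that] ad'(3,4) by auto
  have short: "breg (X i) (X (Suc i)) \<le> 2 * h\<^sup>2" if "i < m" for i
    by (rule maximizer_short_steps[OF ad h(1) Fpos max that])
  define \<Theta> where "\<Theta> = D [e, e, e] (X m)"
  define R where "R = a - action h m X"
  define \<eta> where "\<eta> = 1 - (norm (X 0 - z))\<^sup>2 / \<rho>\<^sup>2"
  have \<Theta>: "0 < \<Theta>" using Dpos by (simp add: \<Theta>_def)
  have R: "0 < R" using ad'(4) by (simp add: R_def)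
  have "norm (X 0 - z) < \<rho>" using ad'(3) by (simp add: dist_norm norm_minus_commute)
  then have "(norm (X 0 - z))\<^sup>2 < \<rho>\<^sup>2" by (intro power_strict_mono) auto
  then have \<eta>: "0 < \<eta>" "\<eta> \<le> 1" using \<rho>(2) by (auto simp: \<eta>_def divide_less_eq)
  note var = maximizer_variation[OF ad e1 \<rho>(2) Dpos max, folded \<Theta>_def R_def \<eta>_def]
  obtain m' where m': "m = Suc m'" using ad'(1) by (cases m) auto
  have zero: "D (0 # as) (X i) = 0" "D [e, 0] (X m) = 0" "D [e, e, 0] (X m) = 0" if "i \<le> m" for i as
    using D_zero[OF XN[OF that], of "[]" as] D_zero[OF XmN, of "[e]" "[]"] D_zero[OF XmN, of "[e, e]" "[]"]
    by auto
  have bz: "breg' (X i) (X (Suc i)) 0 0 = 0" if "i < m" for i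
    using that by (intro breg'_zero XN) auto
  have crit: "D [e, e, w] (X m) = \<Theta> * g (X m) e w" for w
  proof -
    have "(\<Sum>i<m. breg' (X i) (X (Suc i)) 0 0) = 0" using bz by simp
    then have "3 * D [e, e, w] (X m) / \<Theta> - 3 / 2 * (2 * D [e, w] (X m)) = 0"
      using var(1)[where V = "\<lambda>_. 0" and E = w] zero by simp
    then show ?thesis using \<Theta> by (simp add: g_eq_D field_simps)
  qed
  have sup: "D [e, w, w] (X m) \<le> \<Theta> * g (X m) w w" for w
  proof (rule cubic_form_sup[OF XmN e1 \<Theta> \<Theta>_def[symmetric] crit])
    fix b :: "real ^ 'n" assume b: "b \<noteq> 0"
    have "admissible z \<rho> a h m X b" using ad' b by (simp add: admissible_def)
    then have le: "objective z \<rho> a h \<epsilon> m X b \<le> objective z \<rho> a h \<epsilon> m X e" by (rule max)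
    define q where "q = g (X m) b b * sqrt (g (X m) b b)"
    define s where "s = R * \<eta> powr \<epsilon>"
    have s: "0 < s" using R \<eta> by (simp add: s_def)
    have q: "0 < q" using g_pos[OF XmN b] by (simp add: q_def)
    have "D [b, b, b] (X m) / q * s \<le> \<Theta> * s"
      using le by (simp add: objective_def e1 \<Theta>_def R_def[symmetric] \<eta>_def[symmetric] q_def[symmetric] s_def mult.assoc)
    then have "D [b, b, b] (X m) / q \<le> \<Theta>" using s by (rule mult_right_le_imp_le)
    then show "D [b, b, b] (X m) \<le> \<Theta> * (g (X m) b b * sqrt (g (X m) b b))"
      using q by (simp add: q_def[symmetric] divide_le_eq)
  qed
  obtain F :: "nat \<Rightarrow> 'n \<Rightarrow> real ^ 'n" where F: "\<And>i. i \<le> m \<Longrightarrow> frame (g (X i)) (F i)"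
    "\<And>i. i < m \<Longrightarrow> (\<Sum>j\<in>UNIV. g (X i) (F (Suc i) j) (F i j) + g (X (Suc i)) (F (Suc i) j) (F i j))
      \<ge> 2 * real CARD('n)"
    using coupled_frames_along[of m X] XN by blast
  define E where "E i = (- 1 / 2) *\<^sub>R (\<Sum>j\<in>UNIV. D [e, F m i, F m j] (X m) *\<^sub>R F m j)" for i
  note est = end_estimate[OF XmN F(1)[OF order_refl] e1 \<Theta> crit sup, folded E_def]
  define N1 where "N1 i = D [F m i, e, e, e] (X m) + 3 * D [e, e, E i] (X m)" for i
  define A1 where "A1 i = (\<Sum>k<m. breg' (X k) (X (Suc k)) (F k i) (F (Suc k) i)) / h" for i
  define A2 where "A2 i = (\<Sum>k<m. breg'' (X k) (X (Suc k)) (F k i) (F (Suc k) i) drift) / h" for i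
  define H1 where "H1 i = - 2 * ((X 0 - z) \<bullet> F 0 i) / \<rho>\<^sup>2" for i
  define H2 where "H2 i = - 2 * ((norm (F 0 i))\<^sup>2 + 2 * ((X 0 - z) \<bullet> drift)) / \<rho>\<^sup>2" for i
  define N2 where "N2 i = D [F m i, F m i, e, e, e] (X m) + 2 * D [drift, e, e, e] (X m)
          + 6 * D [F m i, e, e, E i] (X m) + 6 * D [e, E i, E i] (X m)" for i
  define k2 where "k2 i = D [F m i, F m i, e, e] (X m) + 2 * D [drift, e, e] (X m)
          + 4 * D [F m i, e, E i] (X m) + 2 * D [E i, E i] (X m)" for i
  have first: "N1 i / \<Theta> - A1 i / R + \<epsilon> * (H1 i / \<eta>) = 0" for i
    using var(1)[where V = "\<lambda>k. F k i" and E = "E i"] est(1)[of i]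
    by (simp add: N1_def A1_def H1_def)
  have second: "(N2 i / \<Theta> - (N1 i / \<Theta>)\<^sup>2) - (3 / 2) * k2 i + (- A2 i / R - (A1 i / R)\<^sup>2)
      + \<epsilon> * (H2 i / \<eta> - (H1 i / \<eta>)\<^sup>2) \<le> 0" for i
    using var(2)[where V = "\<lambda>k. F k i" and w = drift and E = "E i"] est(1)[of i]
    by (simp add: N1_def N2_def k2_def A1_def A2_def H1_def H2_def)
  have unit: "g (X k) (F k i) (F k i) = 1" if "k \<le> m" for k i
    using F(1)[OF that] by (simp add: frame_def)
  \<comment> \<open>Only the last point moves, and \<open>e\<close> with it; \<open>E\<close> makes
    the length of \<open>e\<close> stationary, so the cubic form alone balances the action.\<close>
  have end_bound: "\<bar>N1 i / \<Theta>\<bar> \<le> 6 / R" for i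
  proof -
    let ?V = "\<lambda>k. if k = m then F m i else 0"
    have "(\<Sum>k<m. breg' (X k) (X (Suc k)) (?V k) (?V (Suc k))) = breg' (X m') (X m) 0 (F m i)"
      using bz by (simp add: m')
    also have "\<dots> = D [F m i, X m - X m'] (X m) + (D [F m i] (X m) - D [F m i] (X m'))"
      using XN by (intro breg'_end) (auto simp: m')
    finally have "\<bar>\<Sum>k<m. breg' (X k) (X (Suc k)) (?V k) (?V (Suc k))\<bar> \<le> 6 * h"
      using h0(2)[OF h(1,2) segC[of m'] short[of m'], of "X m" "F m i"] unit[of m i] by (simp add: m')
    then have "\<bar>(\<Sum>k<m. breg' (X k) (X (Suc k)) (?V k) (?V (Suc k))) / h / R\<bar> \<le> 6 / R"
      using h(1) R by (simp add: abs_divide divide_right_mono divide_le_eq)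
    moreover have "N1 i / \<Theta> = (\<Sum>k<m. breg' (X k) (X (Suc k)) (?V k) (?V (Suc k))) / h / R"
      using var(1)[where V = ?V and E = "E i"] est(1)[of i] ad'(1)
      by (simp add: N1_def)
    ultimately show ?thesis by simp
  qed
  \<comment> \<open>Only the first point moves, so the cut-off alone balances the action.\<close>
  have start_bound: "\<bar>\<epsilon> * (H1 i / \<eta>)\<bar> \<le> 6 / R" for i
  proof -
    let ?V = "\<lambda>k. if k = 0 then F 0 i else 0"
    have "(\<Sum>k<m. breg' (X k) (X (Suc k)) (?V k) (?V (Suc k))) = breg' (X 0) (X 1) (F 0 i) 0"
      using bz unfolding m' sum.lessThan_Suc_shift by simp
    also have "\<dots> = - (D [F 0 i, X 1 - X 0] (X 0) + (D [F 0 i] (X 1) - D [F 0 i] (X 0)))"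
      using XN ad'(1) by (intro breg'_start) auto
    finally have "\<bar>\<Sum>k<m. breg' (X k) (X (Suc k)) (?V k) (?V (Suc k))\<bar> \<le> 6 * h"
      using h0(2)[OF h(1,2) segC[of 0] short[of 0], of "X 0" "F 0 i"] unit[of 0 i] ad'(1)
      by (simp only: abs_minus_cancel) simp
    then have "\<bar>(\<Sum>k<m. breg' (X k) (X (Suc k)) (?V k) (?V (Suc k))) / h / R\<bar> \<le> 6 / R"
      using h(1) R by (simp add: abs_divide divide_right_mono divide_le_eq)
    moreover have "\<epsilon> * (H1 i / \<eta>) = (\<Sum>k<m. breg' (X k) (X (Suc k)) (?V k) (?V (Suc k))) / h / R"
      using var(1)[where V = ?V and E = 0] zero ad'(1) by (simp add: H1_def)
    ultimately show ?thesis by simp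
  qed
  \<comment> \<open>The first-order condition for the coupled motion expresses the variation of the
    action through the two end terms.\<close>
  have A1_bound: "\<bar>A1 i / R\<bar> \<le> 12 / R" for i
  proof -
    have "A1 i / R = N1 i / \<Theta> + \<epsilon> * (H1 i / \<eta>)" using first[of i] by simp
    then have "\<bar>A1 i / R\<bar> \<le> 6 / R + 6 / R" using end_bound[of i] start_bound[of i] by linarith
    then show ?thesis by simp
  qed
  have sumA2: "(\<Sum>i\<in>UNIV. A2 i) \<le> 0"
  proof -
    have "(\<Sum>i\<in>UNIV. A2 i) = (\<Sum>k<m. \<Sum>i\<in>UNIV. breg'' (X k) (X (Suc k)) (F k i) (F (Suc k) i) drift) / h"
      unfolding A2_def sum_divide_distrib[symmetric] by (subst sum.swap) simp
    also have "\<dots> \<le> 0"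
    proof (rule divide_nonpos_pos[OF sum_nonpos h(1)])
      fix k assume "k \<in> {..<m}"
      then show "(\<Sum>i\<in>UNIV. breg'' (X k) (X (Suc k)) (F k i) (F (Suc k) i) drift) \<le> 0"
        unfolding breg''_def using F XN by (intro coupled_bregman) auto
    qed
    finally show ?thesis .
  qed
  define \<Sigma> where "\<Sigma> = (\<Sum>i\<in>UNIV. (H1 i / \<eta>)\<^sup>2)"
  have barrier: "(\<Sum>i\<in>UNIV. (H1 i / \<eta>)\<^sup>2 - H2 i / \<eta>) \<le> c1 + c2 * \<Sigma>"
    using bar ad'(3) F(1)[of 0] \<eta>_def unfolding barrier_constants_def H1_def H2_def \<Sigma>_def by blast
  have "\<Theta>\<^sup>2 / 4 \<le> (\<Sum>i\<in>UNIV. N2 i) / \<Theta> - (3 / 2) * (\<Sum>i\<in>UNIV. k2 i)"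
    unfolding N2_def k2_def by (rule est(2))
  also have "\<dots> = (\<Sum>i\<in>UNIV. N2 i / \<Theta> - (3 / 2) * k2 i)"
    by (simp add: sum_subtractf sum_divide_distrib sum_distrib_left)
  also have "\<dots> \<le> (\<Sum>i\<in>UNIV. (N1 i / \<Theta>)\<^sup>2 + (A1 i / R)\<^sup>2 + A2 i / R + \<epsilon> * ((H1 i / \<eta>)\<^sup>2 - H2 i / \<eta>))"
  proof (rule sum_mono)
    fix i :: 'n
    show "N2 i / \<Theta> - (3 / 2) * k2 i \<le> (N1 i / \<Theta>)\<^sup>2 + (A1 i / R)\<^sup>2 + A2 i / R + \<epsilon> * ((H1 i / \<eta>)\<^sup>2 - H2 i / \<eta>)"
      using second[of i] by (simp add: right_diff_distrib)
  qed
  also have "\<dots> = (\<Sum>i\<in>UNIV. (N1 i / \<Theta>)\<^sup>2) + (\<Sum>i\<in>UNIV. (A1 i / R)\<^sup>2) + (\<Sum>i\<in>UNIV. A2 i) / R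
      + \<epsilon> * (\<Sum>i\<in>UNIV. (H1 i / \<eta>)\<^sup>2 - H2 i / \<eta>)"
    by (simp only: sum.distrib sum_divide_distrib sum_distrib_left)
  also have "\<dots> \<le> n * (6 / R)\<^sup>2 + n * (12 / R)\<^sup>2 + 0 + \<epsilon> * (c1 + c2 * \<Sigma>)"
  proof (intro add_mono)
    show "(\<Sum>i\<in>UNIV. (N1 i / \<Theta>)\<^sup>2) \<le> n * (6 / R)\<^sup>2"
      unfolding n_def using end_bound by (intro sum_bounded_above) (metis power2_abs power_mono abs_ge_zero)
    show "(\<Sum>i\<in>UNIV. (A1 i / R)\<^sup>2) \<le> n * (12 / R)\<^sup>2"
      unfolding n_def using A1_bound by (intro sum_bounded_above) (metis power2_abs power_mono abs_ge_zero)
    show "(\<Sum>i\<in>UNIV. A2 i) / R \<le> 0" using sumA2 R by (simp add: divide_nonpos_pos)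
    show "\<epsilon> * (\<Sum>i\<in>UNIV. (H1 i / \<eta>)\<^sup>2 - H2 i / \<eta>) \<le> \<epsilon> * (c1 + c2 * \<Sigma>)"
      using barrier \<epsilon> by (intro mult_left_mono) auto
  qed
  also have "\<dots> \<le> n * (6 / R)\<^sup>2 + n * (12 / R)\<^sup>2 + 0 + \<epsilon> * (c1 + c2 * (n * (6 / R * a)\<^sup>2))"
  proof -
    \<comment> \<open>\<open>start_bound\<close> divided by
      \<open>\<epsilon> = 1 / a\<close>.\<close>
    have "\<Sigma> \<le> n * (6 / R * a)\<^sup>2"
      unfolding \<Sigma>_def n_def
    proof (rule sum_bounded_above)
      fix i :: 'n
      have "\<bar>H1 i / \<eta>\<bar> = \<bar>\<epsilon> * (H1 i / \<eta>)\<bar> * a" using \<open>0 < a\<close> by (simp add: \<epsilon>_def abs_mult abs_divide)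
      also have "\<dots> \<le> 6 / R * a" using start_bound[of i] \<open>0 < a\<close> by (intro mult_right_mono) auto
      finally show "(H1 i / \<eta>)\<^sup>2 \<le> (6 / R * a)\<^sup>2" by (metis power2_abs power_mono abs_ge_zero)
    qed
    then show ?thesis using c(2) \<epsilon> by (intro add_left_mono mult_left_mono) auto
  qed
  finally have main: "\<Theta>\<^sup>2 / 4 \<le> n * (6 / R)\<^sup>2 + n * (12 / R)\<^sup>2 + 0 + \<epsilon> * (c1 + c2 * (n * (6 / R * a)\<^sup>2))" .
  have "R \<le> a"
  proof -
    have "0 \<le> action h m X"
      unfolding action_def using ad'(2) h(1) by (intro sum_nonneg) (auto simp: chain_def breg_nonneg)
    then show ?thesis by (simp add: R_def)
  qed
  have "(\<Theta> * R)\<^sup>2 = 4 * (\<Theta>\<^sup>2 / 4 * R\<^sup>2)" by (simp add: power_mult_distrib)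
  also have "\<dots> \<le> 4 * ((n * (6 / R)\<^sup>2 + n * (12 / R)\<^sup>2 + 0 + \<epsilon> * (c1 + c2 * (n * (6 / R * a)\<^sup>2))) * R\<^sup>2)"
    using main by (intro mult_left_mono mult_right_mono) auto
  also have "\<dots> = 720 * n + 4 * (c1 * R\<^sup>2 / a + 36 * n * c2 * a)"
    using R \<open>0 < a\<close> by (simp add: \<epsilon>_def field_simps power2_eq_square)
  also have "\<dots> \<le> 720 * n + 4 * (c1 * a + 36 * n * c2 * a)"
  proof -
    have "R\<^sup>2 \<le> a * a" using R \<open>R \<le> a\<close> by (simp add: power2_eq_square mult_mono)
    then have "c1 * R\<^sup>2 \<le> c1 * (a * a)" using c(1) by (rule mult_left_mono)
    then have "c1 * R\<^sup>2 / a \<le> c1 * a" using \<open>0 < a\<close> by (simp add: divide_le_eq mult.assoc)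
    then show ?thesis by simp
  qed
  finally have up: "(\<Theta> * R)\<^sup>2 \<le> 720 * n + 4 * (c1 + 36 * n * c2) * a" by (simp add: algebra_simps)
  define \<Theta>0 where "\<Theta>0 = D [e0, e0, e0] z / (g z e0 e0 * sqrt (g z e0 e0))"
  have zN: "z \<in> N" using \<rho> by auto
  have "e0 \<noteq> 0" using e0 D_zero[OF zN, of "[]" "[e0, e0]"] by auto
  then have \<Theta>0: "0 < \<Theta>0" using e0 g_pos[OF zN] by (simp add: \<Theta>0_def)
  have "\<Theta>0 * (a / 2) \<le> \<Theta>0 * (a - h)" using h(3) \<Theta>0 by (intro mult_left_mono) auto
  also have "\<dots> = objective z \<rho> a h \<epsilon> 1 (\<lambda>_. z) e0" by (simp add: objective_def action_def \<Theta>0_def)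
  also have "\<dots> \<le> objective z \<rho> a h \<epsilon> m X e" by (rule start)
  also have "\<dots> = (\<Theta> * R) * \<eta> powr \<epsilon>" by (simp add: objective_def e1 \<Theta>_def R_def \<eta>_def)
  \<comment> \<open>The cut-off is at most 1 at the maximizer and equals 1 at
    \<open>z\<close>.\<close>
  also have "\<dots> \<le> (\<Theta> * R) * 1"
    using \<Theta> R \<eta> \<epsilon> by (intro mult_left_mono powr_le1) auto
  finally have "(\<Theta>0 * (a / 2))\<^sup>2 \<le> (\<Theta> * R)\<^sup>2" using \<Theta>0 \<open>0 < a\<close> by (intro power_mono) auto
  then show ?thesis using up unfolding \<Theta>0_def n_def by linarith
qed

text \<open>The bound has a left side quadratic and a right side linear in \<open>a\<close>, with
  constants independent of \<open>a\<close>.\<close>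

lemma third_derivative_nonpos:
  assumes "riemannian_complete N (hessian u)" "z \<in> N"
  shows "D [e, e, e] z \<le> 0"
proof (rule ccontr)
  assume "\<not> ?thesis"
  then have e: "0 < D [e, e, e] z" by simp
  obtain \<rho> where \<rho>: "0 < \<rho>" "cball z \<rho> \<subseteq> N" using open_N assms(2) open_contains_cball by blast
  obtain c1 c2 where c: "barrier_constants z \<rho> drift c1 c2" using barrier_constants_exist[OF \<rho>(2,1)] by blast
  define \<Theta> where "\<Theta> = D [e, e, e] z / (g z e e * sqrt (g z e e))"
  define B where "B = 720 * real CARD('n)"
  define K where "K = 4 * (c1 + 36 * real CARD('n) * c2)"
  have bound: "(\<Theta> * (a / 2))\<^sup>2 \<le> B + K * a" if "0 < a" for a
    using third_derivative_bound[OF assms(1) \<rho>(2,1) e c that] by (simp add: \<Theta>_def B_def K_def)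
  have "e \<noteq> 0" using e D_zero[OF assms(2), of "[]" "[e, e]"] by auto
  then have \<Theta>: "0 < \<Theta>" using e g_pos[OF assms(2)] by (simp add: \<Theta>_def)
  have BK: "0 \<le> B" "0 \<le> K" using c by (auto simp: B_def K_def barrier_constants_def)
  \<comment> \<open>Chosen so that \<open>\<Theta>\<^sup>2 / 4 * a\<close> exceeds
    \<open>B + K\<close>.\<close>
  define a where "a = 1 + 4 * (B + K) / \<Theta>\<^sup>2"
  have "1 \<le> a" using BK by (simp add: a_def)
  have "(B + K) * a < (\<Theta> * (a / 2))\<^sup>2"
  proof -
    have "(\<Theta> * (a / 2))\<^sup>2 = \<Theta>\<^sup>2 / 4 * a * a" by (simp add: power2_eq_square)
    moreover have "\<Theta>\<^sup>2 / 4 * a = \<Theta>\<^sup>2 / 4 + (B + K)" using \<Theta> by (simp add: a_def field_simps)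
    moreover have "0 < \<Theta>\<^sup>2 / 4" using \<Theta> by simp
    ultimately show ?thesis using \<open>1 \<le> a\<close> by (simp only:) (intro mult_strict_right_mono, auto)
  qed
  moreover have "B + K * a \<le> (B + K) * a" using BK \<open>1 \<le> a\<close> mult_left_mono[of 1 a B] by (simp add: algebra_simps)
  ultimately show False using bound[of a] \<open>1 \<le> a\<close> by linarith
qed

text \<open>The cubic form is odd, so nonpositivity makes it vanish; adding its expansions at
  \<open>b + w\<close> and \<open>b - w\<close> isolates the mixed value.\<close>

lemma third_derivative_zero:
  assumes "riemannian_complete N (hessian u)" "x \<in> N"
  shows "D [b, w, w] x = 0"
proof -
  have cub: "D [e, e, e] x = 0" for e
  proof -
    have "D [- e, - e, - e] x = - D [e, e, e] x"
      using D_neg[OF assms(2), of "[]" e "[- e, - e]"] D_neg[OF assms(2), of "[e]" e "[- e]"]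
        D_neg[OF assms(2), of "[e, e]" e "[]"] by simp
    then show ?thesis
      using third_derivative_nonpos[OF assms, of e] third_derivative_nonpos[OF assms, of "- e"] by simp
  qed
  show ?thesis
    using D_expand3[OF assms(2), of b 1 w] D_expand3[OF assms(2), of b "-1" w] cub by simp
qed

section \<open>Rigidity: from vanishing third derivatives to the quadratic polynomial\<close>

lemma metric_constant:
  assumes "riemannian_complete N (hessian u)" "closed_segment x y \<subseteq> N"
  shows "g y a a = g x a a"
proof -
  have "\<exists>t>0. t < 1 \<and> D [a, a] (x + 1 *\<^sub>R (y - x)) - D [a, a] (x + 0 *\<^sub>R (y - x))
      = (1 - 0) * D [y - x, a, a] (x + t *\<^sub>R (y - x))"
    by (rule MVT2) (use D_line_derivative in_segmentI[OF assms(2)] in auto)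
  then show ?thesis
    using third_derivative_zero[OF assms(1)] in_segmentI[OF assms(2)] by (auto simp: g_eq_D)
qed

text \<open>A ray from \<open>p\<close> to a point outside would leave \<open>N\<close> at a first
  time \<open>t1\<close>. Since \<open>g\<close> is constant along it, the approach has finite
  length, and completeness would place the exit point in \<open>N\<close>.\<close>

lemma domain_is_whole_space:
  assumes complete: "riemannian_complete N (hessian u)" and p: "p \<in> N"
  shows "N = UNIV"
proof (rule ccontr)
  assume "N \<noteq> UNIV"
  then obtain q where q: "q \<notin> N" by blast
  define r where "r t = p + t *\<^sub>R (q - p)" for t
  define T where "T = {t. 0 \<le> t \<and> r t \<notin> N}"
  have "closed T"
  proof -
    have "T = {0..} \<inter> r -` (- N)" by (auto simp: T_def)
    moreover have "closed (r -` (- N))"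
      unfolding r_def using open_N by (intro closed_vimage continuous_intros) auto
    ultimately show ?thesis by auto
  qed
  have "1 \<in> T" using q by (simp add: T_def r_def)
  have bdd: "bdd_below T" by (auto simp: T_def bdd_below_def)
  define t1 where "t1 = Inf T"
  have "t1 \<in> T" unfolding t1_def using \<open>closed T\<close> \<open>1 \<in> T\<close> bdd by (intro closed_contains_Inf) auto
  then have t1: "0 \<le> t1" "r t1 \<notin> N" by (auto simp: T_def)
  have before: "r t \<in> N" if "0 \<le> t" "t < t1" for t
    using that cInf_lower[OF _ bdd, of t] by (fastforce simp: T_def t1_def)
  have "0 < t1" using t1 p by (cases "t1 = 0") (auto simp: r_def)
  have seg: "closed_segment (r s) (r t) \<subseteq> N" if "0 \<le> s" "s < t1" "0 \<le> t" "t < t1" for s t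
  proof
    fix x assume "x \<in> closed_segment (r s) (r t)"
    then obtain k where k: "0 \<le> k" "k \<le> 1" "x = (1 - k) *\<^sub>R r s + k *\<^sub>R r t" unfolding in_segment by blast
    have "x = r ((1 - k) * s + k * t)" unfolding k(3) r_def by (simp add: algebra_simps)
    moreover have "0 \<le> (1 - k) * s + k * t" using k that by simp
    moreover have "(1 - k) * s + k * t < t1" using k that by (intro convex_bound_lt) auto
    ultimately show "x \<in> N" using before by simp
  qed
  define M where "M = g p (q - p) (q - p)"
  have "0 \<le> M" using g_nonneg[OF p] by (simp add: M_def)
  have dist_le: "riemannian_dist N (hessian u) (r s) (r t) \<le> ennreal (\<bar>t - s\<bar> * sqrt M)"
    if st: "0 \<le> s" "s < t1" "0 \<le> t" "t < t1" for s t
  proof -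
    obtain k where k: "0 < k" "k < 1" "breg (r s) (r t) = g (r s + k *\<^sub>R (r t - r s)) (r t - r s) (r t - r s)"
      by (rule breg_MVT[OF seg[OF st]])
    have rd: "r t - r s = (t - s) *\<^sub>R (q - p)" by (simp add: r_def algebra_simps)
    define s' where "s' = s + k * (t - s)"
    have s': "0 \<le> s'" "s' < t1"
    proof -
      have "s' = (1 - k) * s + k * t" by (simp add: s'_def algebra_simps)
      then show "0 \<le> s'" "s' < t1" using k st by (auto intro!: convex_bound_lt)
    qed
    have pt: "r s + k *\<^sub>R (r t - r s) = r s'" unfolding rd by (simp add: r_def s'_def algebra_simps)
    have "g (r s') (q - p) (q - p) = M"
      unfolding M_def using seg[of 0 s'] \<open>0 < t1\<close> s' by (intro metric_constant[OF complete]) (simp add: r_def)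
    moreover have "breg (r s) (r t) = g (r s') (r t - r s) (r t - r s)" using k(3) unfolding pt .
    ultimately have "breg (r s) (r t) = (t - s)\<^sup>2 * M"
      unfolding rd using bilinear_simps(5,6)[OF bilinear_g[OF before[OF s']]] by (simp add: power2_eq_square)
    then have "sqrt (breg (r s) (r t)) = \<bar>t - s\<bar> * sqrt M" by (simp add: real_sqrt_mult)
    then show ?thesis using reach_dist[OF reach_segment[OF seg[OF st] order_refl]] by simp
  qed
  define \<tau> where "\<tau> k = t1 * (1 - inverse (real (Suc k)))" for k
  have \<tau>: "0 \<le> \<tau> k" "\<tau> k < t1" for k
  proof -
    have "inverse (real (Suc k)) \<le> 1" by (simp add: inverse_le_1_iff)
    then show "0 \<le> \<tau> k" using t1(1) by (simp add: \<tau>_def)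
    have "t1 * (1 - inverse (real (Suc k))) < t1 * 1" using \<open>0 < t1\<close> by (intro mult_strict_left_mono) auto
    then show "\<tau> k < t1" by (simp add: \<tau>_def)
  qed
  have "(\<lambda>k. t1 * (1 - inverse (real (Suc k)))) \<longlonglongrightarrow> t1 * (1 - 0)"
    by (intro tendsto_intros LIMSEQ_inverse_real_of_nat)
  then have \<tau>_lim: "\<tau> \<longlonglongrightarrow> t1" by (simp add: \<tau>_def[abs_def])
  have cauchy: "\<exists>K. \<forall>m\<ge>K. \<forall>k\<ge>K. riemannian_dist N (hessian u) (r (\<tau> m)) (r (\<tau> k)) < e" if "0 < e" for e :: ennreal
  proof -
    obtain d where d: "0 < d" "ennreal d < e"
    proof (cases e)
      case (real r)
      then show ?thesis using that \<open>0 < e\<close> by (intro that[of "r / 2"]) (auto simp: ennreal_less_iff)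
    next
      case top
      then show ?thesis by (intro that[of 1]) auto
    qed
    define d' where "d' = d / (sqrt M + 1)"
    have sM: "0 < sqrt M + 1" using \<open>0 \<le> M\<close> by (simp add: add_nonneg_pos)
    have "0 < d'" using d sM by (simp add: d'_def)
    then obtain K where K: "\<And>m k. m \<ge> K \<Longrightarrow> k \<ge> K \<Longrightarrow> dist (\<tau> m) (\<tau> k) < d'"
      using LIMSEQ_imp_Cauchy[OF \<tau>_lim] unfolding Cauchy_def by blast
    have "riemannian_dist N (hessian u) (r (\<tau> m)) (r (\<tau> k)) < e" if "m \<ge> K" "k \<ge> K" for m k
    proof -
      have "\<bar>\<tau> k - \<tau> m\<bar> * sqrt M \<le> d' * (sqrt M + 1)"
        using K[OF that] \<open>0 < d'\<close> \<open>0 \<le> M\<close> by (intro mult_mono) (auto simp: dist_real_def)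
      also have "\<dots> = d" using sM by (simp add: d'_def)
      finally have "ennreal (\<bar>\<tau> k - \<tau> m\<bar> * sqrt M) \<le> ennreal d" by (rule ennreal_leI)
      then show ?thesis using dist_le[OF \<tau> \<tau>, of m k] d(2) by (meson le_less_trans order_trans)
    qed
    then show ?thesis by blast
  qed
  have "(\<forall>k. r (\<tau> k) \<in> N) \<and>
      (\<forall>e>0. \<exists>K. \<forall>m\<ge>K. \<forall>k\<ge>K. riemannian_dist N (hessian u) (r (\<tau> m)) (r (\<tau> k)) < e)"
    using before[OF \<tau>] cauchy by blast
  then have "\<exists>x\<in>N. (\<lambda>k. riemannian_dist N (hessian u) (r (\<tau> k)) x) \<longlonglongrightarrow> 0"
    using complete unfolding riemannian_complete_def by (elim allE impE)
  then obtain x where x: "x \<in> N" "(\<lambda>k. riemannian_dist N (hessian u) (r (\<tau> k)) x) \<longlonglongrightarrow> 0" by blast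
  have "(\<lambda>k. r (\<tau> k)) \<longlonglongrightarrow> x" by (rule riemannian_limit_imp_limit[OF x])
  moreover have "(\<lambda>k. r (\<tau> k)) \<longlonglongrightarrow> r t1" unfolding r_def by (intro tendsto_intros \<tau>_lim)
  ultimately have "x = r t1" by (rule LIMSEQ_unique)
  then show False using x(1) t1(2) by simp
qed

text \<open>With \<open>g\<close> constant, integrating twice along rays from 0 gives Taylor's
  formula without remainder.\<close>

lemma solution_quadratic:
  assumes complete: "riemannian_complete N (hessian u)" and N: "N = UNIV"
  shows "quadratic_polynomial u"
proof -
  have inN: "x \<in> N" for x using N by simp
  have const: "g x a a = g 0 a a" for x a
    by (rule metric_constant[OF complete]) (simp add: N)
  have taylor: "u x = u 0 + D [x] 0 + g 0 x x / 2" for x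
  proof -
    have d1: "((\<lambda>t. D [x] (0 + t *\<^sub>R x) - t * g 0 x x) has_real_derivative 0) (at t)" for t
      using D_line_derivative[of 0 t x "[x]"] inN const[of "t *\<^sub>R x" x]
      by (auto intro!: derivative_eq_intros simp: g_eq_D)
    have lin: "D [x] (t *\<^sub>R x) = D [x] 0 + t * g 0 x x" for t
      using DERIV_isconst_all[OF allI, OF d1, of t 0] by simp
    have d0: "((\<lambda>t. D [] (0 + t *\<^sub>R x) - t * D [x] 0 - t\<^sup>2 / 2 * g 0 x x) has_real_derivative 0) (at t)" for t
      using D_line_derivative[of 0 t x "[]"] inN lin[of t]
      by (auto intro!: derivative_eq_intros)
    have "D [] (1 *\<^sub>R x) - 1 * D [x] 0 - 1\<^sup>2 / 2 * g 0 x x = D [] 0"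
      using DERIV_isconst_all[OF allI, OF d0, of 1 0] by simp
    then show ?thesis by (simp add: D_def)
  qed
  define A where "A = (1 / 2) *\<^sub>R hessian u 0"
  define b where "b = (\<chi> i. partial_deriv i u 0)"
  have lin: "D [x] 0 = (\<Sum>i\<in>UNIV. b $ i * x $ i)" for x
    using dird_eq_sum[OF smooth_u inN, of x 0] by (simp add: D_def b_def mult.commute)
  have quad: "g 0 x x / 2 = (\<Sum>i\<in>UNIV. \<Sum>j\<in>UNIV. A $ i $ j * x $ i * x $ j)" for x
    by (simp add: g_expand[OF inN] A_def sum_divide_distrib mult_ac)
  have "u x = (\<Sum>i\<in>UNIV. \<Sum>j\<in>UNIV. A $ i $ j * x $ i * x $ j) + (\<Sum>i\<in>UNIV. b $ i * x $ i) + u 0" for x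
    using taylor[of x] lin[of x] quad[of x] by linarith
  moreover have "hessian u 0 $ j $ i = hessian u 0 $ i $ j" for i j
    unfolding hessian_entry by (rule g_sym[OF inN])
  then have "transpose A = A" by (simp add: A_def transpose_def vec_eq_iff)
  moreover have "A \<noteq> 0"
  proof
    assume "A = 0"
    then have "hessian u 0 = 0" by (simp add: A_def)
    then have "g 0 w w = 0" for w by (simp add: g_expand[OF inN])
    \<comment> \<open>Index types are nonempty, so some coordinate vector exists to contradict
      positive definiteness.\<close>
    then show False using g_pos[OF inN, of "axis undefined 1" 0] by simp
  qed
  ultimately show ?thesis unfolding quadratic_polynomial_def by blast
qed

end

theorem corollary4p9:
  fixes N :: "(real ^ 'n::finite) set"
    and u :: "real ^ 'n \<Rightarrow> real"
    and v \<xi> :: "real ^ 'n"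
    and c :: real
  assumes "open N" and "N \<noteq> {}"
    and "smooth_on N u"
    and "strictly_convex_on N u"
    and "\<And>x. x \<in> N \<Longrightarrow>
           ln (det (hessian u x)) =
             - (\<Sum>j\<in>UNIV. v $ j * x $ j) + (\<Sum>i\<in>UNIV. \<xi> $ i * partial_deriv i u x) + c"
    and "riemannian_complete N (hessian u)"
  shows "N = UNIV \<and> quadratic_polynomial u"
proof -
  interpret hessian_domain N u by unfold_locales (use assms in auto)
  interpret monge_ampere N u v \<xi> c
  proof
    fix x assume "x \<in> N"
    then show "ln (det (hessian u x)) = - (v \<bullet> x) + D [\<xi>] x + c"
      using assms(5) dird_eq_sum[OF assms(3)] by (simp add: inner_vec_def D_def)
  qed
  obtain p where "p \<in> N" using assms(2) by blast
  then have "N = UNIV" by (rule domain_is_whole_space[OF assms(6)])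
  then show ?thesis using solution_quadratic[OF assms(6)] by blast
qed

end
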